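(* Set \[ B_1=\frac54+\frac53C_1\xi_0+\frac{37}{12}\xi_0^4,\qquad B_2=\frac53\xi_0^2\bigl(C_1+5\xi_0^3\bigr). \] Then, for every $b>4\Theta_0$, \[ \lambda(b)<\Theta_0b-C_1\sqrt b+\frac{B_1+B_2b^{-1/2}}{1-2\xi_0b^{-1/2}}, \] and, for every $b\geq130$, \[ \lambda(b)<\Theta_0b-C_1\sqrt b+B_1+B_2b^{-1/2}. \]
   Context: Let $\mathbb{D}$ be the open unit disk in $\mathbb{R}^2$ and $\mathbf{A}(x_1,x_2)=\frac12(-x_2,x_1)$. For $b\in\mathbb{R}$ let $H_b$ be the self-adjoint operator in $L^2(\mathbb{D})$ (complex-valued functions) associated with the closed quadratic form $q_b[u]=\int_{\mathbb{D}}|(-i\nabla+b\mathbf{A})u|^2\,d\mathbf{x}$, $u\in H^1(\mathbb{D})$ (magnetic Neumann Laplacian), and let $\lambda(b)=\inf\operatorname{spec}H_b$ be its lowest eigenvalue. For $\xi\in\mathbb{R}$ let $\mu(\xi)$ denote the lowest eigenvalue of $-\frac{d^2}{dt^2}+(t-\xi)^2$ in $L^2(\mathbb{R}_+)$, $\mathbb{R}_+=(0,+\infty)$, with a Neumann condition at the origin. The de Gennes constant is $\Theta_0=\inf_{\xi\in\mathbb{R}}\mu(\xi)$. Denote by $\xi_0>0$ the (unique) minimizer of $\xi\mapsto\mu(\xi)$, by $\varphi_0$ the corresponding positive eigenfunction of $-\frac{d^2}{dt^2}+(t-\xi_0)^2$ (Neumann condition at $0$, eigenvalue $\Theta_0$),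 normalized in $L^2(\mathbb{R}_+)$, and set $C_1=\varphi_0(0)^2/3$. It is known that $\Theta_0=\xi_0^2$. *)

theory Defs
  imports "HOL-Analysis.Analysis"
begin

section \<open>Square-integrable functions and unbounded operators\<close>

text \<open>
  Elements of \<open>L\<^sup>2(M)\<close> are represented by functions; functions that agree almost everywhere
  represent the same element.
\<close>

definition L2 :: "'a measure \<Rightarrow> ('a \<Rightarrow> 'b::real_normed_vector) set" where
  "L2 M = {u \<in> borel_measurable M. integrable M (\<lambda>x. (norm (u x))\<^sup>2)}"

definition L2_norm :: "'a measure \<Rightarrow> ('a \<Rightarrow> 'b::real_normed_vector) \<Rightarrow> real" where
  "L2_norm M u = sqrt (LINT x|M. (norm (u x))\<^sup>2)"

text \<open>
  An unbounded operator is given by its graph: \<open>A u f\<close> means that \<open>u\<close> lies in the domain of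
  \<open>A\<close> and \<open>A u = f\<close>. The number \<open>z\<close> is in the resolvent set iff \<open>A - z\<close> is a bijection from the
  domain of \<open>A\<close> onto \<open>L\<^sup>2(M)\<close> (modulo almost everywhere equality) with bounded inverse. The
  equation \<open>(A - z) u = f\<close> is written as \<open>A u = f + z u\<close>.
\<close>

definition resolvent_set ::
    "'a measure \<Rightarrow> (('a \<Rightarrow> complex) \<Rightarrow> ('a \<Rightarrow> complex) \<Rightarrow> bool) \<Rightarrow> complex set" where
  "resolvent_set M A = {z.
     (\<forall>f\<in>L2 M. \<exists>u. A u (\<lambda>x. f x + z * u x)) \<and>
     (\<forall>u. A u (\<lambda>x. z * u x) \<longrightarrow> (AE x in M. u x = 0)) \<and>
     (\<exists>C. \<forall>f\<in>L2 M. \<forall>u. A u (\<lambda>x. f x + z * u x) \<longrightarrow> L2_norm M u \<le> C * L2_norm M f)}"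

definition spectrum ::
    "'a measure \<Rightarrow> (('a \<Rightarrow> complex) \<Rightarrow> ('a \<Rightarrow> complex) \<Rightarrow> bool) \<Rightarrow> complex set" where
  "spectrum M A = - resolvent_set M A"


section \<open>The magnetic Neumann Laplacian on the unit disk\<close>

definition disk :: "(real \<times> real) measure" where
  "disk = restrict_space lborel (ball 0 1)"

coinductive smooth :: "(real \<times> real \<Rightarrow> real) \<Rightarrow> bool" where
  "smooth \<psi>" if "\<And>x. (\<psi> has_derivative (\<lambda>h. fst h * \<psi>1 x + snd h * \<psi>2 x)) (at x)"
    and "smooth \<psi>1" and "smooth \<psi>2"

definition test_functions :: "(real \<times> real \<Rightarrow> real) set" where
  "test_functions = {\<psi>. smooth \<psi> \<and> closure {x. \<psi> x \<noteq> 0} \<subseteq> ball 0 1}"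

text \<open>
  The Sobolev space \<open>H\<^sup>1\<close> of the disk consists of the functions \<open>u\<close> that have a weak gradient
  \<open>g\<close> in the following sense; the weak gradient is unique almost everywhere.
\<close>

definition weak_gradient ::
    "(real \<times> real \<Rightarrow> complex) \<Rightarrow> (real \<times> real \<Rightarrow> complex \<times> complex) \<Rightarrow> bool" where
  "weak_gradient u g \<longleftrightarrow>
     u \<in> L2 disk \<and> (\<lambda>x. fst (g x)) \<in> L2 disk \<and> (\<lambda>x. snd (g x)) \<in> L2 disk \<and>
     (\<forall>\<psi>\<in>test_functions.
        (LINT x|disk. u x * of_real (frechet_derivative \<psi> (at x) (1, 0)))
          = - (LINT x|disk. fst (g x) * of_real (\<psi> x)) \<and>
        (LINT x|disk. u x * of_real (frechet_derivative \<psi> (at x) (0, 1)))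
          = - (LINT x|disk. snd (g x) * of_real (\<psi> x)))"

definition vec_pot :: "real \<times> real \<Rightarrow> real \<times> real" where
  "vec_pot x = (- snd x / 2, fst x / 2)"

text \<open>\<open>(- i \<nabla> + b A) u\<close> for a function \<open>u\<close> with weak gradient \<open>g\<close>\<close>

definition magnetic_gradient ::
    "real \<Rightarrow> (real \<times> real \<Rightarrow> complex) \<Rightarrow> (real \<times> real \<Rightarrow> complex \<times> complex)
      \<Rightarrow> real \<times> real \<Rightarrow> complex \<times> complex" where
  "magnetic_gradient b u g x =
     (- \<i> * fst (g x) + of_real (b * fst (vec_pot x)) * u x,
      - \<i> * snd (g x) + of_real (b * snd (vec_pot x)) * u x)"

text \<open>
  The sesquilinear form whose diagonal is \<open>q\<^sub>b\<close>: for \<open>u = v\<close> and \<open>g = h\<close> the integrand is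
  \<open>|(- i \<nabla> + b A) u|\<^sup>2\<close>.
\<close>

definition magnetic_form ::
    "real \<Rightarrow> (real \<times> real \<Rightarrow> complex) \<Rightarrow> (real \<times> real \<Rightarrow> complex \<times> complex)
      \<Rightarrow> (real \<times> real \<Rightarrow> complex) \<Rightarrow> (real \<times> real \<Rightarrow> complex \<times> complex) \<Rightarrow> complex" where
  "magnetic_form b u g v h =
     (LINT x|disk. fst (magnetic_gradient b u g x) * cnj (fst (magnetic_gradient b v h x))
                 + snd (magnetic_gradient b u g x) * cnj (snd (magnetic_gradient b v h x)))"

text \<open>
  The self-adjoint operator associated with the closed form \<open>q\<^sub>b\<close> (first representation theorem):
  \<open>u\<close> is in the domain and is mapped to \<open>f \<in> L\<^sup>2\<close> iff \<open>u \<in> H\<^sup>1\<close> and \<open>q\<^sub>b(u, v) = \<langle>f, v\<rangle>\<close> for all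
  \<open>v \<in> H\<^sup>1\<close>.
\<close>

definition magnetic_neumann ::
    "real \<Rightarrow> (real \<times> real \<Rightarrow> complex) \<Rightarrow> (real \<times> real \<Rightarrow> complex) \<Rightarrow> bool" where
  "magnetic_neumann b u f \<longleftrightarrow>
     f \<in> L2 disk \<and>
     (\<exists>g. weak_gradient u g \<and>
        (\<forall>v h. weak_gradient v h \<longrightarrow>
           magnetic_form b u g v h = (LINT x|disk. f x * cnj (v x))))"

text \<open>
  The spectrum is real. The infimum is formed in the extended reals, so that it is meaningful
  before the spectrum is known to be nonempty and bounded below.
\<close>

definition lambda :: "real \<Rightarrow> ereal" where
  "lambda b = Inf (ereal ` {E. complex_of_real E \<in> spectrum disk (magnetic_neumann b)})"


section \<open>The de Gennes operator on the half-line\<close>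

definition half_line :: "real measure" where
  "half_line = restrict_space lborel {0<..}"

text \<open>
  The Neumann realization of \<open>- d\<^sup>2/dt\<^sup>2 + (t - \<xi>)\<^sup>2\<close>: its domain consists of the \<open>u \<in> L\<^sup>2\<close> such that
  \<open>u\<close> and \<open>u'\<close> are locally absolutely continuous on \<open>[0, \<infinity>)\<close>, \<open>u'(0) = 0\<close> and
  \<open>f = - u'' + (t - \<xi>)\<^sup>2 u \<in> L\<^sup>2\<close>. Absolute continuity of \<open>u'\<close>, the Neumann condition and the
  differential equation are together expressed by the integral formula for \<open>u'\<close>. Domain
  elements are represented by their continuously differentiable representatives, of which
  only the values on \<open>[0, \<infinity>)\<close> matter. The coefficients are real, so real-valued functions
  suffice for eigenvalues and eigenfunctions.
\<close>

definition de_gennes :: "real \<Rightarrow> (real \<Rightarrow> real) \<Rightarrow> (real \<Rightarrow> real) \<Rightarrow> bool" where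
  "de_gennes \<xi> u f \<longleftrightarrow>
     u \<in> L2 half_line \<and> f \<in> L2 half_line \<and>
     (\<exists>u'. \<forall>t\<ge>0. (u has_real_derivative u' t) (at t within {0..}) \<and>
                 u' t = (LBINT s:{0..t}. (s - \<xi>)\<^sup>2 * u s - f s))"

definition de_gennes_eigenfunction :: "real \<Rightarrow> real \<Rightarrow> (real \<Rightarrow> real) \<Rightarrow> bool" where
  "de_gennes_eigenfunction \<xi> E u \<longleftrightarrow>
     de_gennes \<xi> u (\<lambda>t. E * u t) \<and> (\<exists>t\<ge>0. u t \<noteq> 0)"

definition mu :: "real \<Rightarrow> real" where
  "mu \<xi> = Inf {E. \<exists>u. de_gennes_eigenfunction \<xi> E u}"

definition Theta0 :: real where
  "Theta0 = (INF \<xi>. mu \<xi>)"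

end

theory Submission
  imports Defs
begin

text \<open>
  The bound is the Rayleigh quotient of one trial function. With \<open>h = 1 / sqrt b\<close> and the
  boundary variable \<open>t = sqrt b (1 - |x|\<^sup>2) / 2\<close>, so that \<open>|x|\<^sup>2 = 1 - 2 h t\<close>, it is, in complex
  notation \<open>x = r exp (\<i> \<theta>)\<close>, the function \<open>u(x) = exp (- \<i> k \<theta>) r \<phi>(t)\<close>, where \<open>\<phi>\<close> is the ground state of
  the half-line operator and \<open>k\<close> is a natural number with \<open>b / 2 - k = sqrt b (\<xi> + h \<delta>)\<close>, \<open>|\<delta>| \<le> 1 / 2\<close>.
  The variable \<open>t\<close> turns the area element into a constant multiple of \<open>dt\<close>, and the factor \<open>r\<close>
  removes the centrifugal singularity at the origin: up to a common factor, energy and mass of \<open>u\<close> are \<open>b N\<close> and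
  \<open>D\<close> with

  \<open>N = \<integral> ((1 - 2 h t) \<phi>' - h \<phi>)\<^sup>2 + (t - \<xi> - h \<delta>)\<^sup>2 \<phi>\<^sup>2 dt\<close> and \<open>D = \<integral> (1 - 2 h t) \<phi>\<^sup>2 dt\<close>

  over \<open>0 < t < 1 / (2 h)\<close>. Since the first integrand is nonnegative and the second one is
  negative beyond the endpoint, both integrals may be extended to the whole half-line. There
  they are polynomials in \<open>h\<close> whose coefficients are moments of \<open>\<phi>\<^sup>2\<close>, \<open>\<phi> \<phi>'\<close> and \<open>\<phi>'\<^sup>2\<close> of degree at most two.
  Integrating the derivatives of \<open>(t - \<xi>)\<^sup>k\<close> times \<open>\<phi>\<^sup>2\<close>, \<open>\<phi> \<phi>'\<close> and \<open>\<phi>'\<^sup>2\<close> expresses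
  all of them through \<open>\<xi>\<close> and \<open>\<phi>(0)\<^sup>2 = 3 C\<^sub>1\<close>, and one obtains
  (\<open>lambda_le\<close>)

  \<open>\<lambda>(b) \<le> \<Theta>\<^sub>0 b - C\<^sub>1 sqrt b + (7/4 - 3/2 C\<^sub>1 \<xi> + 5/2 \<xi>\<^sup>4) / (1 - 2 \<xi> h)\<close>.

  The constant here is smaller than \<open>B\<^sub>1\<close> because \<open>C\<^sub>1 \<xi> \<ge> 1/6\<close>: the decreasing probability density
  \<open>\<phi>\<^sup>2\<close> is bounded by \<open>\<phi>(0)\<^sup>2\<close>, so its mean \<open>\<xi>\<close> is at least that of the uniform density of this
  height. This gives the first claim. For the second claim one also uses \<open>3 C\<^sub>1 \<xi> \<ge> 1 - \<xi>\<^sup>2\<close>, which is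
  the positivity of \<open>\<integral> (\<phi>' + (t - \<xi>) \<phi>)\<^sup>2\<close>, and \<open>\<xi> < 1\<close>; the rest is a polynomial
  inequality (\<open>denominator_free_constant_bound\<close>).

  Three facts from spectral theory enter. The variational principle
  \<open>\<lambda>(b) \<le> q\<^sub>b[u] / |u|\<^sup>2\<close> is derived directly from the definition of the resolvent set, as the
  infimum of the Rayleigh quotients cannot lie in it (\<open>lambda_le_rayleigh_quotient\<close>). That the ground state
  decays, so that all integrations by parts are legitimate, follows by identifying it with an
  explicit parabolic cylinder function by means of the Wronskian. The identity \<open>\<Theta>\<^sub>0 = \<xi>\<^sup>2\<close> follows
  from the minimality of \<open>\<xi>\<close>: otherwise the derivative of the decaying solution would change sign at
  \<open>- \<xi>\<close>, this sign change would persist for a slightly smaller energy, and its new zero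
  would give a half-line operator with an eigenvalue below \<open>\<Theta>\<^sub>0\<close> (\<open>ground_state\<close>).
\<close>

section \<open>The variational principle\<close>

lemma borel_measurable_cnj [measurable (raw)]:
  "f \<in> borel_measurable M \<Longrightarrow> (\<lambda>x. cnj (f x)) \<in> borel_measurable M"
  by (rule measurable_compose[OF _ borel_measurable_continuous_onI]) (auto intro: continuous_intros)

lemma L2_mult_cnj_integrable:
  fixes f g :: "'a \<Rightarrow> complex"
  assumes "f \<in> L2 M" "g \<in> L2 M"
  shows "integrable M (\<lambda>x. f x * cnj (g x))"
proof (rule Bochner_Integration.integrable_bound)
  show "integrable M (\<lambda>x. (norm (f x))\<^sup>2 + (norm (g x))\<^sup>2)"
    using assms by (auto simp: L2_def)
  show "(\<lambda>x. f x * cnj (g x)) \<in> borel_measurable M"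
    using assms by (auto simp: L2_def)
  show "AE x in M. norm (f x * cnj (g x)) \<le> norm ((norm (f x))\<^sup>2 + (norm (g x))\<^sup>2)"
  proof (rule AE_I2)
    fix x
    have "2 * (norm (f x) * norm (g x)) \<le> (norm (f x))\<^sup>2 + (norm (g x))\<^sup>2"
      using sum_squares_bound[of "norm (f x)" "norm (g x)"] by simp
    moreover have "0 \<le> norm (f x) * norm (g x)" by simp
    ultimately have "norm (f x) * norm (g x) \<le> (norm (f x))\<^sup>2 + (norm (g x))\<^sup>2"
      by linarith
    then show "norm (f x * cnj (g x)) \<le> norm ((norm (f x))\<^sup>2 + (norm (g x))\<^sup>2)"
      by (simp add: norm_mult)
  qed
qed

lemma L2_add:
  fixes f g :: "'a \<Rightarrow> complex"
  assumes "f \<in> L2 M" "g \<in> L2 M"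
  shows "(\<lambda>x. f x + g x) \<in> L2 M"
proof -
  have m: "f \<in> borel_measurable M" "g \<in> borel_measurable M"
    using assms by (auto simp: L2_def)
  have "integrable M (\<lambda>x. (norm (f x + g x))\<^sup>2)"
  proof (rule Bochner_Integration.integrable_bound)
    show "integrable M (\<lambda>x. 2 * (norm (f x))\<^sup>2 + 2 * (norm (g x))\<^sup>2)"
      using assms by (auto simp: L2_def)
    show "AE x in M. norm ((norm (f x + g x))\<^sup>2) \<le> norm (2 * (norm (f x))\<^sup>2 + 2 * (norm (g x))\<^sup>2)"
    proof (rule AE_I2)
      fix x
      have "(norm (f x + g x))\<^sup>2 \<le> (norm (f x) + norm (g x))\<^sup>2"
        by (intro power_mono norm_triangle_ineq) auto
      also have "\<dots> \<le> 2 * (norm (f x))\<^sup>2 + 2 * (norm (g x))\<^sup>2"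
        using sum_squares_bound[of "norm (f x)" "norm (g x)"] by (simp add: power2_sum)
      finally show "norm ((norm (f x + g x))\<^sup>2) \<le> norm (2 * (norm (f x))\<^sup>2 + 2 * (norm (g x))\<^sup>2)"
        by simp
    qed
  qed (use m in measurable)
  with m show ?thesis by (auto simp: L2_def)
qed

lemma L2_cmult:
  fixes f :: "'a \<Rightarrow> complex"
  assumes "f \<in> L2 M"
  shows "(\<lambda>x. c * f x) \<in> L2 M"
  using assms by (auto simp: L2_def norm_mult power_mult_distrib)

lemma L2_bounded_mult:
  fixes f :: "'a \<Rightarrow> complex"
  assumes "f \<in> L2 M" "k \<in> borel_measurable M" "\<And>x. x \<in> space M \<Longrightarrow> norm (k x :: complex) \<le> K"
  shows "(\<lambda>x. k x * f x) \<in> L2 M"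
proof -
  have m: "f \<in> borel_measurable M" and i: "integrable M (\<lambda>x. (norm (f x))\<^sup>2)"
    using assms by (auto simp: L2_def)
  have "integrable M (\<lambda>x. (norm (k x * f x))\<^sup>2)"
  proof (rule Bochner_Integration.integrable_bound)
    show "integrable M (\<lambda>x. K\<^sup>2 * (norm (f x))\<^sup>2)"
      using i by simp
    show "AE x in M. norm ((norm (k x * f x))\<^sup>2) \<le> norm (K\<^sup>2 * (norm (f x))\<^sup>2)"
    proof (rule AE_I2)
      fix x assume "x \<in> space M"
      then have "(norm (k x))\<^sup>2 \<le> K\<^sup>2" by (intro power_mono assms) auto
      then show "norm ((norm (k x * f x))\<^sup>2) \<le> norm (K\<^sup>2 * (norm (f x))\<^sup>2)"
        by (simp add: norm_mult power_mult_distrib mult_right_mono)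
    qed
  qed (use m assms in measurable)
  with m assms show ?thesis by (auto simp: L2_def)
qed

lemma integral_mult_cnj_self:
  fixes f :: "'a \<Rightarrow> complex"
  shows "(LINT x|M. f x * cnj (f x)) = of_real ((L2_norm M f)\<^sup>2)"
proof -
  have "(LINT x|M. f x * cnj (f x)) = (LINT x|M. of_real ((norm (f x))\<^sup>2))"
    by (rule Bochner_Integration.integral_cong[OF refl complex_norm_square[symmetric]])
  also have "\<dots> = of_real (LINT x|M. (norm (f x))\<^sup>2)"
    by (rule integral_complex_of_real)
  also have "(LINT x|M. (norm (f x))\<^sup>2) = (L2_norm M f)\<^sup>2"
    unfolding L2_norm_def by (simp add: integral_nonneg_AE)
  finally show ?thesis .
qed

lemma smooth_has_derivative:
  assumes "smooth \<psi>"
  shows "\<exists>\<psi>1 \<psi>2. (\<forall>x. (\<psi> has_derivative (\<lambda>h. fst h * \<psi>1 x + snd h * \<psi>2 x)) (at x)) \<and>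
    continuous_on UNIV \<psi>1 \<and> continuous_on UNIV \<psi>2"
proof -
  have c: "continuous_on UNIV f" if "smooth f" for f :: "real \<times> real \<Rightarrow> real"
    using that
  proof (cases rule: smooth.cases)
    case (1 \<psi>1 \<psi>2)
    then show ?thesis
      by (intro continuous_at_imp_continuous_on) (auto intro: has_derivative_continuous)
  qed
  from assms show ?thesis
  proof (cases rule: smooth.cases)
    case (1 \<psi>1 \<psi>2)
    then show ?thesis using c by (intro exI[of _ \<psi>1] exI[of _ \<psi>2]) auto
  qed
qed

lemma continuous_bounded_on_ball:
  fixes f :: "real \<times> real \<Rightarrow> real"
  assumes "continuous_on UNIV f"
  shows "\<exists>K. \<forall>x\<in>ball 0 1. \<bar>f x\<bar> \<le> K"
proof -
  have "compact (f ` cball 0 1)"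
    by (rule compact_continuous_image[OF continuous_on_subset[OF assms]]) simp_all
  then obtain K where "\<forall>y\<in>f ` cball 0 1. norm y \<le> K"
    using compact_imp_bounded bounded_iff by metis
  then show ?thesis by (intro exI[of _ K]) auto
qed

lemma space_disk [simp]: "space disk = ball 0 1"
  by (simp add: disk_def space_restrict_space)

lemma finite_measure_disk: "finite_measure disk"
proof
  show "emeasure disk (space disk) \<noteq> \<infinity>"
    using emeasure_lborel_ball_finite[of "0 :: real \<times> real" 1]
    by (simp add: disk_def emeasure_restrict_space space_restrict_space)
qed

lemma borel_measurable_disk:
  "f \<in> borel_measurable borel \<Longrightarrow> f \<in> borel_measurable disk"
  by (simp add: disk_def measurable_restrict_space1)

lemma bounded_L2_disk:
  fixes f :: "real \<times> real \<Rightarrow> complex"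
  assumes "f \<in> borel_measurable borel" "\<And>x. x \<in> ball 0 1 \<Longrightarrow> norm (f x) \<le> K"
  shows "f \<in> L2 disk"
proof -
  interpret finite_measure disk by (rule finite_measure_disk)
  have "integrable disk (\<lambda>x. (norm (f x))\<^sup>2)"
  proof (rule integrable_const_bound[of _ "K\<^sup>2"])
    show "AE x in disk. norm ((norm (f x))\<^sup>2) \<le> K\<^sup>2"
      using assms(2) by (intro AE_I2) (auto intro!: power_mono)
    show "(\<lambda>x. (norm (f x))\<^sup>2) \<in> borel_measurable disk"
      using assms(1) by (intro borel_measurable_disk) auto
  qed
  then show ?thesis
    using assms(1) by (auto simp: L2_def borel_measurable_disk)
qed

text \<open>
  This is what makes the two sides of the defining identities of a weak gradient absolutely
  convergent, hence linear in the function and its gradient.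
\<close>
lemma test_function_L2:
  assumes "\<psi> \<in> test_functions"
  shows "(\<lambda>x. of_real (\<psi> x) :: complex) \<in> L2 disk"
    and "(\<lambda>x. of_real (frechet_derivative \<psi> (at x) (1, 0)) :: complex) \<in> L2 disk"
    and "(\<lambda>x. of_real (frechet_derivative \<psi> (at x) (0, 1)) :: complex) \<in> L2 disk"
proof -
  have s: "smooth \<psi>" using assms by (auto simp: test_functions_def)
  obtain \<psi>1 \<psi>2 where
    d: "\<forall>x. (\<psi> has_derivative (\<lambda>h. fst h * \<psi>1 x + snd h * \<psi>2 x)) (at x)"
    and c: "continuous_on UNIV \<psi>1" "continuous_on UNIV \<psi>2"
    using smooth_has_derivative[OF s] by (elim exE conjE)
  have c0: "continuous_on UNIV \<psi>"
    by (rule continuous_at_imp_continuous_on) (use d has_derivative_continuous in \<open>fast\<close>)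
  have L: "(\<lambda>x. of_real (f x) :: complex) \<in> L2 disk" if f: "continuous_on UNIV f" for f
  proof -
    obtain K where "\<forall>x\<in>ball 0 1. \<bar>f x\<bar> \<le> K"
      using continuous_bounded_on_ball[OF f] by blast
    moreover have "f \<in> borel_measurable borel"
      using f by (rule borel_measurable_continuous_onI)
    ultimately show ?thesis
      by (intro bounded_L2_disk[of _ K]) auto
  qed
  have eq: "frechet_derivative \<psi> (at x) = (\<lambda>h. fst h * \<psi>1 x + snd h * \<psi>2 x)" for x
    by (rule frechet_derivative_at[OF d[rule_format], symmetric])
  show "(\<lambda>x. of_real (\<psi> x) :: complex) \<in> L2 disk"
    and "(\<lambda>x. of_real (frechet_derivative \<psi> (at x) (1, 0)) :: complex) \<in> L2 disk"
    and "(\<lambda>x. of_real (frechet_derivative \<psi> (at x) (0, 1)) :: complex) \<in> L2 disk"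
    using L[OF c0] L[OF c(1)] L[OF c(2)] by (auto simp: eq)
qed

lemma weak_gradient_lincomb:
  assumes "weak_gradient u g" "weak_gradient v h"
  shows "weak_gradient (\<lambda>x. u x + c * v x)
           (\<lambda>x. (fst (g x) + c * fst (h x), snd (g x) + c * snd (h x)))"
proof -
  have L: "u \<in> L2 disk" "(\<lambda>x. fst (g x)) \<in> L2 disk" "(\<lambda>x. snd (g x)) \<in> L2 disk"
    "v \<in> L2 disk" "(\<lambda>x. fst (h x)) \<in> L2 disk" "(\<lambda>x. snd (h x)) \<in> L2 disk"
    using assms by (auto simp: weak_gradient_def)
  have lin: "(LINT x|disk. (p x + c * q x) * of_real (k x))
      = (LINT x|disk. p x * of_real (k x)) + c * (LINT x|disk. q x * of_real (k x))"
    if "p \<in> L2 disk" "q \<in> L2 disk" "(\<lambda>x. of_real (k x) :: complex) \<in> L2 disk"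
    for p q :: "real \<times> real \<Rightarrow> complex" and k
  proof -
    have i: "integrable disk (\<lambda>x. p x * of_real (k x))" "integrable disk (\<lambda>x. q x * of_real (k x))"
      using L2_mult_cnj_integrable[OF that(1) that(3)] L2_mult_cnj_integrable[OF that(2) that(3)]
      by auto
    have "(LINT x|disk. (p x + c * q x) * of_real (k x))
      = (LINT x|disk. p x * of_real (k x) + c * (q x * of_real (k x)))"
      by (simp add: algebra_simps)
    also have "\<dots> = (LINT x|disk. p x * of_real (k x)) + c * (LINT x|disk. q x * of_real (k x))"
      using i by (subst Bochner_Integration.integral_add) auto
    finally show ?thesis .
  qed
  show ?thesis
    unfolding weak_gradient_def
  proof (intro conjI ballI)
    fix \<psi> assume t: "\<psi> \<in> test_functions"
    note T = test_function_L2[OF t]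
    show "(LINT x|disk. (u x + c * v x) * of_real (frechet_derivative \<psi> (at x) (1, 0)))
      = - (LINT x|disk. fst (fst (g x) + c * fst (h x), snd (g x) + c * snd (h x)) * of_real (\<psi> x))"
      using assms t by (simp add: lin[OF L(1,4) T(2)] lin[OF L(2,5) T(1)] weak_gradient_def)
    show "(LINT x|disk. (u x + c * v x) * of_real (frechet_derivative \<psi> (at x) (0, 1)))
      = - (LINT x|disk. snd (fst (g x) + c * fst (h x), snd (g x) + c * snd (h x)) * of_real (\<psi> x))"
      using assms t by (simp add: lin[OF L(1,4) T(3)] lin[OF L(3,6) T(1)] weak_gradient_def)
  qed (auto intro!: L2_add L2_cmult L)
qed

lemma magnetic_gradient_L2:
  assumes "weak_gradient u g"
  shows "(\<lambda>x. fst (magnetic_gradient b u g x)) \<in> L2 disk"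
    and "(\<lambda>x. snd (magnetic_gradient b u g x)) \<in> L2 disk"
proof -
  have L: "u \<in> L2 disk" "(\<lambda>x. fst (g x)) \<in> L2 disk" "(\<lambda>x. snd (g x)) \<in> L2 disk"
    using assms by (auto simp: weak_gradient_def)
  have b: "norm (complex_of_real (b * fst (vec_pot x))) \<le> \<bar>b\<bar>"
    "norm (complex_of_real (b * snd (vec_pot x))) \<le> \<bar>b\<bar>" if "x \<in> ball 0 1" for x :: "real \<times> real"
  proof -
    have "\<bar>fst x\<bar> \<le> 1" "\<bar>snd x\<bar> \<le> 1"
      using that norm_fst_le[of "fst x" "snd x"] norm_snd_le[of "snd x" "fst x"] by auto
    then show "norm (complex_of_real (b * fst (vec_pot x))) \<le> \<bar>b\<bar>"
      "norm (complex_of_real (b * snd (vec_pot x))) \<le> \<bar>b\<bar>"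
      using mult_left_le[of "\<bar>fst x\<bar> / 2" "\<bar>b\<bar>"] mult_left_le[of "\<bar>snd x\<bar> / 2" "\<bar>b\<bar>"]
      by (simp_all add: vec_pot_def abs_mult norm_mult)
  qed
  have m: "(\<lambda>x. complex_of_real (b * fst (vec_pot x))) \<in> borel_measurable disk"
    "(\<lambda>x. complex_of_real (b * snd (vec_pot x))) \<in> borel_measurable disk"
    unfolding vec_pot_def
    by (auto intro!: borel_measurable_disk borel_measurable_continuous_onI continuous_intros)
  have k: "(\<lambda>x. complex_of_real (b * fst (vec_pot x)) * u x) \<in> L2 disk"
    "(\<lambda>x. complex_of_real (b * snd (vec_pot x)) * u x) \<in> L2 disk"
    by (rule L2_bounded_mult[OF L(1) m(1)], rule b, simp)
      (rule L2_bounded_mult[OF L(1) m(2)], rule b, simp)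
  show "(\<lambda>x. fst (magnetic_gradient b u g x)) \<in> L2 disk"
    unfolding magnetic_gradient_def fst_conv by (rule L2_add[OF L2_cmult[OF L(2)] k(1)])
  show "(\<lambda>x. snd (magnetic_gradient b u g x)) \<in> L2 disk"
    unfolding magnetic_gradient_def snd_conv by (rule L2_add[OF L2_cmult[OF L(3)] k(2)])
qed

lemma magnetic_form_lincomb_left:
  assumes "weak_gradient u g" "weak_gradient v h" "weak_gradient w k"
  shows "magnetic_form b (\<lambda>x. u x + c * v x)
           (\<lambda>x. (fst (g x) + c * fst (h x), snd (g x) + c * snd (h x))) w k
         = magnetic_form b u g w k + c * magnetic_form b v h w k"
proof -
  let ?F = "\<lambda>p q x. fst (magnetic_gradient b p q x) * cnj (fst (magnetic_gradient b w k x))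
                 + snd (magnetic_gradient b p q x) * cnj (snd (magnetic_gradient b w k x))"
  have i: "integrable disk (?F p q)" if "weak_gradient p q" for p q
    by (rule Bochner_Integration.integrable_add[OF
          L2_mult_cnj_integrable[OF magnetic_gradient_L2(1)[OF that] magnetic_gradient_L2(1)[OF assms(3)]]
          L2_mult_cnj_integrable[OF magnetic_gradient_L2(2)[OF that] magnetic_gradient_L2(2)[OF assms(3)]]])
  have "(LINT x|disk. ?F (\<lambda>x. u x + c * v x)
           (\<lambda>x. (fst (g x) + c * fst (h x), snd (g x) + c * snd (h x))) x)
    = (LINT x|disk. ?F u g x + c * ?F v h x)"
    by (rule Bochner_Integration.integral_cong[OF refl])
      (simp add: magnetic_gradient_def ring_distribs)
  also have "\<dots> = (LINT x|disk. ?F u g x) + (LINT x|disk. c * ?F v h x)"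
    by (rule Bochner_Integration.integral_add[OF i[OF assms(1)] integrable_mult_right[OF i[OF assms(2)]]])
  also have "(LINT x|disk. c * ?F v h x) = c * (LINT x|disk. ?F v h x)"
    by (rule Bochner_Integration.integral_mult_right_zero)
  finally show ?thesis unfolding magnetic_form_def .
qed

lemma magnetic_form_cnj: "cnj (magnetic_form b u g v h) = magnetic_form b v h u g"
  unfolding magnetic_form_def
  by (subst Bochner_Integration.integral_cnj[symmetric]) (simp add: mult.commute del: Bochner_Integration.integral_cnj)

lemma Re_magnetic_form:
  assumes "weak_gradient v h"
  shows "Re (magnetic_form b v h v h) = (LINT x|disk. (norm (fst (magnetic_gradient b v h x)))\<^sup>2
     + (norm (snd (magnetic_gradient b v h x)))\<^sup>2)"
proof -
  have "magnetic_form b v h v h = (LINT x|disk. of_real ((norm (fst (magnetic_gradient b v h x)))\<^sup>2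
     + (norm (snd (magnetic_gradient b v h x)))\<^sup>2))"
    unfolding magnetic_form_def
    by (rule Bochner_Integration.integral_cong[OF refl]) (metis complex_norm_square of_real_add)
  then show ?thesis by (simp only: integral_complex_of_real Re_complex_of_real)
qed

lemma Re_magnetic_form_nonneg:
  assumes "weak_gradient v h"
  shows "Re (magnetic_form b v h v h) \<ge> 0"
  unfolding Re_magnetic_form[OF assms] by (intro integral_nonneg_AE) auto

lemma magnetic_form_lincomb_right:
  assumes "weak_gradient u g" "weak_gradient v h" "weak_gradient w k"
  shows "magnetic_form b w k (\<lambda>x. u x + c * v x)
           (\<lambda>x. (fst (g x) + c * fst (h x), snd (g x) + c * snd (h x)))
         = magnetic_form b w k u g + cnj c * magnetic_form b w k v h"
  using arg_cong[OF magnetic_form_lincomb_left[OF assms, of b c], of cnj]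
  by (simp add: magnetic_form_cnj)

lemma integral_lincomb_mult_cnj:
  fixes u v w :: "'a \<Rightarrow> complex"
  assumes "u \<in> L2 M" "v \<in> L2 M" "w \<in> L2 M"
  shows "(LINT x|M. (u x + c * v x) * cnj (w x))
       = (LINT x|M. u x * cnj (w x)) + c * (LINT x|M. v x * cnj (w x))"
proof -
  have "(LINT x|M. (u x + c * v x) * cnj (w x)) = (LINT x|M. u x * cnj (w x) + c * (v x * cnj (w x)))"
    by (simp add: algebra_simps)
  also have "\<dots> = (LINT x|M. u x * cnj (w x)) + c * (LINT x|M. v x * cnj (w x))"
    using L2_mult_cnj_integrable[OF assms(1,3)] L2_mult_cnj_integrable[OF assms(2,3)]
    by (subst Bochner_Integration.integral_add) auto
  finally show ?thesis .
qed

lemma L2_norm_nonneg: "L2_norm M u \<ge> 0"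
  unfolding L2_norm_def by (intro real_sqrt_ge_zero integral_nonneg_AE) auto

text \<open>
  Expansion of the square of a norm, with a real coefficient; it is used to complete the square in the
  proof of the variational principle and to bound the real part of an inner product.
\<close>
lemma L2_norm_minus_scaled:
  fixes u v :: "'a \<Rightarrow> complex"
  assumes "u \<in> L2 M" "v \<in> L2 M"
  shows "(L2_norm M (\<lambda>x. v x + of_real (- s) * u x))\<^sup>2
    = (L2_norm M v)\<^sup>2 - 2 * s * Re (LINT x|M. v x * cnj (u x)) + s\<^sup>2 * (L2_norm M u)\<^sup>2"
proof -
  let ?w = "\<lambda>x. v x + of_real (- s) * u x"
  have wL: "?w \<in> L2 M" using assms by (intro L2_add L2_cmult)
  have c: "cnj (LINT x|M. p x * cnj (q x)) = (LINT x|M. q x * cnj (p x))" for p q :: "'a \<Rightarrow> complex"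
    by (subst Bochner_Integration.integral_cnj[symmetric]) (simp add: mult.commute del: Bochner_Integration.integral_cnj)
  have "of_real ((L2_norm M ?w)\<^sup>2) = (LINT x|M. ?w x * cnj (?w x))"
    by (rule integral_mult_cnj_self[symmetric])
  also have "\<dots> = (LINT x|M. v x * cnj (?w x)) + of_real (- s) * (LINT x|M. u x * cnj (?w x))"
    by (rule integral_lincomb_mult_cnj[OF assms(2,1) wL])
  also have "(LINT x|M. v x * cnj (?w x)) = cnj (LINT x|M. ?w x * cnj (v x))"
    by (rule c[symmetric])
  also have "(LINT x|M. ?w x * cnj (v x))
      = of_real ((L2_norm M v)\<^sup>2) + of_real (- s) * (LINT x|M. u x * cnj (v x))"
    by (subst integral_lincomb_mult_cnj[OF assms(2,1,2)]) (simp only: integral_mult_cnj_self)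
  also have "(LINT x|M. u x * cnj (?w x)) = cnj (LINT x|M. ?w x * cnj (u x))"
    by (rule c[symmetric])
  also have "(LINT x|M. ?w x * cnj (u x))
      = (LINT x|M. v x * cnj (u x)) + of_real (- s) * of_real ((L2_norm M u)\<^sup>2)"
    by (subst integral_lincomb_mult_cnj[OF assms(2,1,1)]) (simp only: integral_mult_cnj_self)
  finally have "Re (of_real ((L2_norm M ?w)\<^sup>2)) = (L2_norm M v)\<^sup>2
    - s * Re (LINT x|M. u x * cnj (v x)) - s * Re (LINT x|M. v x * cnj (u x)) + s\<^sup>2 * (L2_norm M u)\<^sup>2"
    by (simp only:) (simp add: power2_eq_square algebra_simps del: of_real_power)
  moreover have "Re (LINT x|M. u x * cnj (v x)) = Re (LINT x|M. v x * cnj (u x))"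
    unfolding c[of v u, symmetric] by simp
  ultimately show ?thesis by simp
qed

text \<open>
  Let \<open>E\<close> be the infimum of the Rayleigh quotients and suppose that \<open>H - E\<close> has an inverse bounded by \<open>C\<close>. For
  \<open>v\<close> in the form domain and \<open>u = (H - E)\<^sup>-\<^sup>1 v\<close>, nonnegativity of the form of \<open>H - E\<close> at \<open>v - s u\<close> reads
  \<open>(q - E)[v] - 2 s |v|\<^sup>2 + s\<^sup>2 Re \<langle>v, u\<rangle> \<ge> 0\<close>. With \<open>s = 1 / C\<close> and \<open>|u| \<le> C |v|\<close> this gives
  \<open>(q - E)[v] \<ge> |v|\<^sup>2 / C\<close> for every \<open>v\<close>, which contradicts the choice of \<open>E\<close>.
\<close>
lemma lambda_le_rayleigh_quotient:
  assumes v0: "weak_gradient v0 h0" and nz: "L2_norm disk v0 > 0"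
  shows "lambda b \<le> ereal (Re (magnetic_form b v0 h0 v0 h0) / (L2_norm disk v0)\<^sup>2)"
proof -
  define S where "S = {Re (magnetic_form b v h v h) / (L2_norm disk v)\<^sup>2 | v h.
    weak_gradient v h \<and> L2_norm disk v > 0}"
  define E where "E = Inf S"
  have bdd: "bdd_below S"
    by (rule bdd_belowI[of _ 0]) (auto simp: S_def intro!: divide_nonneg_nonneg Re_magnetic_form_nonneg)
  have in_S: "Re (magnetic_form b v0 h0 v0 h0) / (L2_norm disk v0)\<^sup>2 \<in> S"
    using v0 nz by (auto simp: S_def)
  have E_le: "E * (L2_norm disk v)\<^sup>2 \<le> Re (magnetic_form b v h v h)" if "weak_gradient v h" for v h
  proof (cases "L2_norm disk v > 0")
    case True
    then have "E \<le> Re (magnetic_form b v h v h) / (L2_norm disk v)\<^sup>2"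
      unfolding E_def using that by (intro cInf_lower bdd) (auto simp: S_def)
    then show ?thesis using True by (simp add: field_simps)
  next
    case False
    then have "L2_norm disk v = 0" using L2_norm_nonneg[of disk v] by linarith
    then show ?thesis using Re_magnetic_form_nonneg[OF that] by simp
  qed
  have "complex_of_real E \<notin> resolvent_set disk (magnetic_neumann b)"
  proof
    assume "complex_of_real E \<in> resolvent_set disk (magnetic_neumann b)"
    then obtain C0 where
      surj: "\<And>f. f \<in> L2 disk \<Longrightarrow> \<exists>u. magnetic_neumann b u (\<lambda>x. f x + complex_of_real E * u x)" and
      C0: "\<And>f u. f \<in> L2 disk \<Longrightarrow> magnetic_neumann b u (\<lambda>x. f x + complex_of_real E * u x)
         \<Longrightarrow> L2_norm disk u \<le> C0 * L2_norm disk f"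
      unfolding resolvent_set_def by blast
    \<comment> \<open>\<open>C0\<close> is only some real number; a positive bound is needed for the choice of \<open>s\<close> below.\<close>
    define C where "C = max C0 1"
    have Cpos: "C > 0" by (simp add: C_def)
    have gap: "(E + 1 / C) * (L2_norm disk v)\<^sup>2 \<le> Re (magnetic_form b v h v h)"
      if vh: "weak_gradient v h" for v h
    proof -
      have vL: "v \<in> L2 disk" using vh by (auto simp: weak_gradient_def)
      obtain u where u: "magnetic_neumann b u (\<lambda>x. v x + complex_of_real E * u x)"
        using surj[OF vL] by blast
      then obtain g where ug: "weak_gradient u g" and
        rep: "\<And>w k. weak_gradient w k \<Longrightarrow>
          magnetic_form b u g w k = (LINT x|disk. (v x + complex_of_real E * u x) * cnj (w x))"
        unfolding magnetic_neumann_def by blast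
      have uL: "u \<in> L2 disk" using ug by (auto simp: weak_gradient_def)
      define s where "s = 1 / C"
      let ?w = "\<lambda>x. v x + of_real (- s) * u x"
      let ?k = "\<lambda>x. (fst (h x) + of_real (- s) * fst (g x), snd (h x) + of_real (- s) * snd (g x))"
      define N where "N = (L2_norm disk v)\<^sup>2"
      define U where "U = (L2_norm disk u)\<^sup>2"
      define R where "R = Re (LINT x|disk. v x * cnj (u x))"
      define Q where "Q = Re (magnetic_form b v h v h)"
      have wk: "weak_gradient ?w ?k" by (rule weak_gradient_lincomb[OF vh ug])
      have cR: "Re (LINT x|disk. u x * cnj (v x)) = R"
      proof -
        have "cnj (LINT x|disk. v x * cnj (u x)) = (LINT x|disk. u x * cnj (v x))"
          by (subst Bochner_Integration.integral_cnj[symmetric]) (simp add: mult.commute del: Bochner_Integration.integral_cnj)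
        then show ?thesis unfolding R_def by (metis cnj.sel(1))
      qed
      have auv: "Re (magnetic_form b u g v h) = N + E * R"
        unfolding rep[OF vh] integral_lincomb_mult_cnj[OF vL uL vL] integral_mult_cnj_self
        by (simp add: N_def cR)
      have auu: "Re (magnetic_form b u g u g) = R + E * U"
        unfolding rep[OF ug] integral_lincomb_mult_cnj[OF vL uL uL] integral_mult_cnj_self
        by (simp add: U_def R_def)
      have avu: "Re (magnetic_form b v h u g) = N + E * R"
        unfolding auv[symmetric] magnetic_form_cnj[of b u g v h, symmetric] by simp
      have "Re (magnetic_form b ?w ?k ?w ?k) = Q - 2 * s * (N + E * R) + s\<^sup>2 * (R + E * U)"
        unfolding magnetic_form_lincomb_left[OF vh ug wk] magnetic_form_lincomb_right[OF vh ug vh]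
          magnetic_form_lincomb_right[OF vh ug ug]
        using auv auu avu by (simp add: Q_def power2_eq_square algebra_simps)
      then have *: "E * (N - 2 * s * R + s\<^sup>2 * U) \<le> Q - 2 * s * (N + E * R) + s\<^sup>2 * (R + E * U)"
        using E_le[OF wk] L2_norm_minus_scaled[OF uL vL, of s] by (simp add: N_def U_def R_def)
      have U_le: "U \<le> C\<^sup>2 * N"
      proof -
        have "L2_norm disk u \<le> C0 * L2_norm disk v" by (rule C0[OF vL u])
        also have "\<dots> \<le> C * L2_norm disk v"
          by (intro mult_right_mono L2_norm_nonneg) (simp add: C_def)
        finally show ?thesis
          unfolding U_def N_def power_mult_distrib[symmetric]
          by (intro power_mono L2_norm_nonneg)
      qed
      have R_le: "2 * s * R \<le> N + s\<^sup>2 * U"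
        using L2_norm_minus_scaled[OF uL vL, of s] zero_le_power2[of "L2_norm disk ?w"]
        by (simp add: N_def U_def R_def)
      have "s\<^sup>2 * U \<le> N"
        using U_le Cpos by (simp add: s_def power_divide field_simps)
      with R_le have "s * R \<le> N" by simp
      then have "s * (s * R) \<le> s * N"
        using Cpos by (intro mult_left_mono) (auto simp: s_def)
      moreover have "E * N \<le> Q - 2 * s * N + s * (s * R)"
        using * by (simp add: algebra_simps power2_eq_square)
      ultimately have "E * N + s * N \<le> Q" by simp
      then show ?thesis by (simp add: N_def Q_def s_def algebra_simps)
    qed
    have "E + 1 / C \<le> Inf S"
    proof (rule cInf_greatest)
      show "S \<noteq> {}" using in_S by blast
      fix y assume "y \<in> S"
      then obtain v h where y: "y = Re (magnetic_form b v h v h) / (L2_norm disk v)\<^sup>2"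
        and "weak_gradient v h" "L2_norm disk v > 0" by (auto simp: S_def)
      with gap[of v h] show "E + 1 / C \<le> y" by (simp add: y field_simps)
    qed
    with Cpos show False by (simp add: E_def)
  qed
  then have "lambda b \<le> ereal E"
    unfolding lambda_def spectrum_def by (intro Inf_lower imageI) simp
  also have "E \<le> Re (magnetic_form b v0 h0 v0 h0) / (L2_norm disk v0)\<^sup>2"
    unfolding E_def by (intro cInf_lower in_S bdd)
  finally show ?thesis by simp
qed

section \<open>Trial functions on the disk\<close>

text \<open>
  The one-dimensional integration by parts behind weak derivatives. The derivative of the product is only
  needed on \<open>S\<close>, since the product vanishes on the complement of the closed set \<open>K\<close>, and these two
  open sets cover the line.
\<close>
lemma integral_derivative_of_localized_product:
  fixes u u' :: "real \<Rightarrow> complex" and \<psi> \<psi>' :: "real \<Rightarrow> real"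
  assumes S: "open S" "S \<subseteq> {-1<..<1}" and K: "closed K" "K \<subseteq> S" "\<And>t. t \<notin> K \<Longrightarrow> \<psi> t = 0"
    and u: "\<And>t. t \<in> S \<Longrightarrow> (u has_vector_derivative u' t) (at t)" "continuous_on S u'"
    and \<psi>: "\<And>t. (\<psi> has_real_derivative \<psi>' t) (at t)" "continuous_on UNIV \<psi>'"
  shows "(LBINT t. indicator S t *\<^sub>R (u t * of_real (\<psi>' t) + u' t * of_real (\<psi> t))) = 0"
proof -
  define F where "F t = indicator S t *\<^sub>R (u t * of_real (\<psi> t))" for t
  define f where "f t = indicator S t *\<^sub>R (u t * of_real (\<psi>' t) + u' t * of_real (\<psi> t))" for t
  have oK: "open (- K)" using K(1) by blast
  have \<psi>'0: "\<psi>' t = 0" if "t \<notin> K" for t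
  proof -
    have "((\<lambda>_. 0) has_real_derivative 0) (at t)" by simp
    then have "(\<psi> has_real_derivative 0) (at t)"
      by (rule has_field_derivative_transform_within_open[OF _ oK]) (use that K(3) in auto)
    then show ?thesis using \<psi>(1)[of t] DERIV_unique by blast
  qed
  have F0: "F t = 0" and f0: "f t = 0" if "t \<notin> K" for t
    using that K(3) \<psi>'0 by (simp_all add: F_def f_def)
  have dF: "(F has_vector_derivative f t) (at t)" for t
  proof (cases "t \<in> S")
    case True
    have "((\<lambda>t. u t * of_real (\<psi> t)) has_vector_derivative f t) (at t)"
      using has_vector_derivative_mult[OF u(1)[OF True] has_vector_derivative_of_real[OF \<psi>(1)]] True
      by (simp add: f_def)
    then show ?thesis
      by (rule has_vector_derivative_transform_within_open[OF _ S(1) True]) (simp add: F_def)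
  next
    case False
    then have t: "t \<in> - K" using K(2) by blast
    have "((\<lambda>_. 0) has_vector_derivative 0) (at t)" by simp
    then have "(F has_vector_derivative 0) (at t)"
      by (rule has_vector_derivative_transform_within_open[OF _ oK t]) (simp add: F0)
    with t show ?thesis by (simp add: f0)
  qed
  have cu: "continuous_on S u"
    using u(1) has_vector_derivative_continuous by (blast intro: continuous_at_imp_continuous_on)
  have c\<psi>: "continuous_on UNIV \<psi>"
    using \<psi>(1) by (blast intro: continuous_at_imp_continuous_on DERIV_isCont)
  have cf: "continuous_on UNIV f"
  proof -
    have "continuous_on S f"
    proof (rule continuous_on_eq)
      show "continuous_on S (\<lambda>t. u t * of_real (\<psi>' t) + u' t * of_real (\<psi> t))"
        by (intro continuous_intros cu u(2) continuous_on_subset[OF c\<psi>] continuous_on_subset[OF \<psi>(2)]) auto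
    qed (simp add: f_def)
    moreover have "continuous_on (- K) f"
      by (rule continuous_on_eq[of _ "\<lambda>_. 0"]) (auto simp: f0)
    ultimately have "continuous_on (S \<union> - K) f"
      using S(1) oK by (intro continuous_on_open_Un)
    moreover have "S \<union> - K = UNIV" using K(2) by blast
    ultimately show ?thesis by simp
  qed
  have "(LBINT t. indicator {-1..1} t *\<^sub>R f t) = F 1 - F (-1)"
    by (rule integral_FTC_Icc) (auto intro: has_vector_derivative_at_within dF continuous_on_subset[OF cf])
  moreover have "indicator {-1..1} t *\<^sub>R f t = f t" for t
    using S(2) by (auto simp: f_def indicator_def)
  moreover have "F 1 = 0" "F (-1) = 0" using S(2) by (auto simp: F_def indicator_def)
  ultimately have "(LBINT t. f t) = 0" by simp
  then show ?thesis by (simp only: f_def)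
qed

lemma integral_disk:
  fixes f :: "real \<times> real \<Rightarrow> 'a::{banach, second_countable_topology}"
  shows "(LINT x|disk. f x) = (LINT x|lborel. indicator (ball 0 1) x *\<^sub>R f x)"
  by (simp add: disk_def integral_restrict_space)

lemma integrable_disk:
  fixes f :: "real \<times> real \<Rightarrow> 'a::{banach, second_countable_topology}"
  shows "integrable disk f \<longleftrightarrow> integrable lborel (\<lambda>x. indicator (ball 0 1) x *\<^sub>R f x)"
  by (simp add: disk_def integrable_restrict_space)

text \<open>
  By Fubini, the weak derivative in a coordinate direction can be checked on the lines in that direction, and
  only one of these passes through the origin.
\<close>
lemma weak_gradient_if_C1_off_origin:
  fixes u :: "real \<times> real \<Rightarrow> complex"
  assumes meas: "u \<in> borel_measurable borel" "(\<lambda>x. fst (g x)) \<in> borel_measurable borel"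
      "(\<lambda>x. snd (g x)) \<in> borel_measurable borel"
    and bound: "\<And>x. x \<in> ball 0 1 \<Longrightarrow> norm (u x) \<le> K" "\<And>x. x \<in> ball 0 1 \<Longrightarrow> norm (fst (g x)) \<le> K"
      "\<And>x. x \<in> ball 0 1 \<Longrightarrow> norm (snd (g x)) \<le> K"
    and d1: "\<And>s t. t \<noteq> 0 \<Longrightarrow> ((\<lambda>s. u (s, t)) has_vector_derivative fst (g (s, t))) (at s)"
    and d2: "\<And>s t. s \<noteq> 0 \<Longrightarrow> ((\<lambda>t. u (s, t)) has_vector_derivative snd (g (s, t))) (at t)"
    and c1: "\<And>t. t \<noteq> 0 \<Longrightarrow> continuous_on UNIV (\<lambda>s. fst (g (s, t)))"
    and c2: "\<And>s. s \<noteq> 0 \<Longrightarrow> continuous_on UNIV (\<lambda>t. snd (g (s, t)))"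
  shows "weak_gradient u g"
proof -
  have L: "u \<in> L2 disk" "(\<lambda>x. fst (g x)) \<in> L2 disk" "(\<lambda>x. snd (g x)) \<in> L2 disk"
    using bounded_L2_disk[OF meas(1) bound(1)] bounded_L2_disk[OF meas(2) bound(2)]
      bounded_L2_disk[OF meas(3) bound(3)] by blast+
  show ?thesis
    unfolding weak_gradient_def
  proof (intro conjI ballI L)
    fix \<psi> assume test: "\<psi> \<in> test_functions"
    define C where "C = closure {x. \<psi> x \<noteq> 0}"
    have C: "closed C" "C \<subseteq> ball 0 1" using test by (simp_all add: test_functions_def C_def)
    have off: "\<psi> x = 0" if "x \<notin> C" for x
      using that closure_subset[of "{x. \<psi> x \<noteq> 0}"] by (auto simp: C_def)
    obtain \<psi>1 \<psi>2 where
      d: "\<And>x. (\<psi> has_derivative (\<lambda>h. fst h * \<psi>1 x + snd h * \<psi>2 x)) (at x)"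
      and c: "continuous_on UNIV \<psi>1" "continuous_on UNIV \<psi>2"
      using smooth_has_derivative[of \<psi>] test unfolding test_functions_def by auto
    have fd: "frechet_derivative \<psi> (at x) = (\<lambda>h. fst h * \<psi>1 x + snd h * \<psi>2 x)" for x
      by (rule frechet_derivative_at[OF d, symmetric])
    note T = test_function_L2[OF test, unfolded fd fst_conv snd_conv, simplified]
    have p1: "((\<lambda>s. \<psi> (s, t)) has_real_derivative \<psi>1 (s, t)) (at s)" for s t
    proof -
      have "((\<lambda>s. (s, t)) has_derivative (\<lambda>h. (h, 0))) (at s)"
        by (intro derivative_eq_intros) auto
      from has_derivative_compose[OF this d] show ?thesis
        by (simp add: has_field_derivative_def mult_commute_abs)
    qed
    have p2: "((\<lambda>t. \<psi> (s, t)) has_real_derivative \<psi>2 (s, t)) (at t)" for s t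
    proof -
      have "((\<lambda>t. (s, t)) has_derivative (\<lambda>h. (0, h))) (at t)"
        by (intro derivative_eq_intros) auto
      from has_derivative_compose[OF this d] show ?thesis
        by (simp add: has_field_derivative_def mult_commute_abs)
    qed
    have slice: "open {s. (s, t) \<in> ball (0::real \<times> real) 1}" "{s. (s, t) \<in> ball (0::real \<times> real) 1} \<subseteq> {-1<..<1}"
      "closed {s. (s, t) \<in> C}" for t
    proof -
      have cont: "continuous_on UNIV (\<lambda>s. (s, t))" by (intro continuous_intros)
      show "open {s. (s, t) \<in> ball (0::real \<times> real) 1}"
        using open_vimage[OF open_ball cont] by (simp only: vimage_def)
      show "closed {s. (s, t) \<in> C}"
        using closed_vimage[OF C(1) cont] by (simp only: vimage_def)
      show "{s. (s, t) \<in> ball (0::real \<times> real) 1} \<subseteq> {-1<..<1}"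
      proof
        fix s assume "s \<in> {s. (s, t) \<in> ball (0::real \<times> real) 1}"
        then have "norm s < 1" using norm_fst_le[of s t] by simp
        then show "s \<in> {-1<..<1}" by auto
      qed
    qed
    have slice': "open {t. (s, t) \<in> ball (0::real \<times> real) 1}" "{t. (s, t) \<in> ball (0::real \<times> real) 1} \<subseteq> {-1<..<1}"
      "closed {t. (s, t) \<in> C}" for s
    proof -
      have cont: "continuous_on UNIV (\<lambda>t. (s, t))" by (intro continuous_intros)
      show "open {t. (s, t) \<in> ball (0::real \<times> real) 1}"
        using open_vimage[OF open_ball cont] by (simp only: vimage_def)
      show "closed {t. (s, t) \<in> C}"
        using closed_vimage[OF C(1) cont] by (simp only: vimage_def)
      show "{t. (s, t) \<in> ball (0::real \<times> real) 1} \<subseteq> {-1<..<1}"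
      proof
        fix t assume "t \<in> {t. (s, t) \<in> ball (0::real \<times> real) 1}"
        then have "norm t < 1" using norm_snd_le[of t s] by simp
        then show "t \<in> {-1<..<1}" by auto
      qed
    qed
    have prod: "integrable disk (\<lambda>x. p x * of_real (k x))"
      if "p \<in> L2 disk" "(\<lambda>x. of_real (k x) :: complex) \<in> L2 disk" for p :: "real \<times> real \<Rightarrow> complex" and k
      using L2_mult_cnj_integrable[OF that] by simp
    define B where "B = ball (0::real \<times> real) 1"
    have AE0: "AE t in lborel. t \<noteq> (0::real)" by (rule AE_lborel_singleton)
    let ?f1 = "\<lambda>s t. indicator B (s, t) *\<^sub>R (u (s, t) * of_real (\<psi>1 (s, t)) + fst (g (s, t)) * of_real (\<psi> (s, t)))"
    let ?f2 = "\<lambda>s t. indicator B (s, t) *\<^sub>R (u (s, t) * of_real (\<psi>2 (s, t)) + snd (g (s, t)) * of_real (\<psi> (s, t)))"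
    have i: "integrable disk (\<lambda>x. u x * of_real (\<psi>1 x) + fst (g x) * of_real (\<psi> x))"
      "integrable disk (\<lambda>x. u x * of_real (\<psi>2 x) + snd (g x) * of_real (\<psi> x))"
      by (intro Bochner_Integration.integrable_add prod L T)+
    have "(LINT x|disk. u x * of_real (\<psi>1 x) + fst (g x) * of_real (\<psi> x))
        = (LBINT t. LBINT s. ?f1 s t)"
      using lborel_pair.integral_snd[of ?f1] i(1)
      by (simp add: integral_disk integrable_disk lborel_prod case_prod_unfold B_def)
    also have "\<dots> = (LBINT t::real. 0)"
    proof (rule integral_cong_AE)
      show "(\<lambda>t. LBINT s. ?f1 s t) \<in> borel_measurable lborel"
        using lborel_pair.integrable_snd[of ?f1] i(1)
        by (simp add: integrable_disk lborel_prod case_prod_unfold B_def)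
      show "AE t in lborel. (LBINT s. ?f1 s t) = 0"
        using AE0
      proof eventually_elim
        fix t :: real assume t: "t \<noteq> 0"
        have "(LBINT s. indicator {s. (s, t) \<in> B} s *\<^sub>R
            (u (s, t) * of_real (\<psi>1 (s, t)) + fst (g (s, t)) * of_real (\<psi> (s, t)))) = 0"
          unfolding B_def
        proof (rule integral_derivative_of_localized_product[OF slice])
          show "continuous_on UNIV (\<lambda>s. \<psi>1 (s, t))"
            by (rule continuous_on_compose2[OF c(1) _ subset_UNIV]) (intro continuous_intros)
          show "continuous_on {s. (s, t) \<in> ball 0 1} (\<lambda>s. fst (g (s, t)))"
            by (rule continuous_on_subset[OF c1[OF t] subset_UNIV])
        qed (use t C off d1 p1 in auto)
        then show "(LBINT s. ?f1 s t) = 0" by (simp add: indicator_def)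
      qed
    qed simp
    finally have z1: "(LINT x|disk. u x * of_real (\<psi>1 x) + fst (g x) * of_real (\<psi> x)) = 0" by simp
    have "(LINT x|disk. u x * of_real (\<psi>2 x) + snd (g x) * of_real (\<psi> x))
        = (LBINT s. LBINT t. ?f2 s t)"
      using lborel_pair.integral_fst[of ?f2] i(2)
      by (simp add: integral_disk integrable_disk lborel_prod case_prod_unfold B_def)
    also have "\<dots> = (LBINT s::real. 0)"
    proof (rule integral_cong_AE)
      show "(\<lambda>s. LBINT t. ?f2 s t) \<in> borel_measurable lborel"
        using lborel_pair.integrable_fst[of ?f2] i(2)
        by (simp add: integrable_disk lborel_prod case_prod_unfold B_def)
      show "AE s in lborel. (LBINT t. ?f2 s t) = 0"
        using AE0
      proof eventually_elim
        fix s :: real assume s: "s \<noteq> 0"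
        have "(LBINT t. indicator {t. (s, t) \<in> B} t *\<^sub>R
            (u (s, t) * of_real (\<psi>2 (s, t)) + snd (g (s, t)) * of_real (\<psi> (s, t)))) = 0"
          unfolding B_def
        proof (rule integral_derivative_of_localized_product[OF slice'])
          show "continuous_on UNIV (\<lambda>t. \<psi>2 (s, t))"
            by (rule continuous_on_compose2[OF c(2) _ subset_UNIV]) (intro continuous_intros)
          show "continuous_on {t. (s, t) \<in> ball 0 1} (\<lambda>t. snd (g (s, t)))"
            by (rule continuous_on_subset[OF c2[OF s] subset_UNIV])
        qed (use s C off d2 p2 in auto)
        then show "(LBINT t. ?f2 s t) = 0" by (simp add: indicator_def)
      qed
    qed simp
    finally have z2: "(LINT x|disk. u x * of_real (\<psi>2 x) + snd (g x) * of_real (\<psi> x)) = 0" by simp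
    show "(LINT x|disk. u x * of_real (frechet_derivative \<psi> (at x) (1, 0)))
        = - (LINT x|disk. fst (g x) * of_real (\<psi> x))"
      using z1 prod[OF L(1) T(2)] prod[OF L(2) T(1)] by (simp add: fd eq_neg_iff_add_eq_0)
    show "(LINT x|disk. u x * of_real (frechet_derivative \<psi> (at x) (0, 1)))
        = - (LINT x|disk. snd (g x) * of_real (\<psi> x))"
      using z2 prod[OF L(1) T(3)] prod[OF L(3) T(1)] by (simp add: fd eq_neg_iff_add_eq_0)
  qed
qed

lemma norm_square_pair: "(norm x)\<^sup>2 = (fst x)\<^sup>2 + (snd x)\<^sup>2" for x :: "real \<times> real"
  by (cases x) (simp add: norm_Pair)

text \<open>
  In the variable \<open>\<beta> (1 - |x|\<^sup>2) / 2\<close> Lebesgue measure on the disk becomes a constant multiple of Lebesgue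
  measure on an interval, because the superlevel sets are disks whose area is affine in the level.
\<close>
lemma distr_disk_boundary_distance:
  fixes \<beta> :: real
  assumes \<beta>: "\<beta> > 0"
  shows "distr disk borel (\<lambda>x. \<beta> * (1 - (norm x)\<^sup>2) / 2)
    = density lborel (\<lambda>t. ennreal (2 * pi / \<beta> * indicator {0<..\<beta> / 2} t))"
    (is "?L = ?R")
proof -
  let ?s = "\<lambda>x::real \<times> real. \<beta> * (1 - (norm x)\<^sup>2) / 2"
  have meas: "?s \<in> disk \<rightarrow>\<^sub>M borel"
    by (rule borel_measurable_disk) measurable
  have L: "emeasure ?L {a<..} = ennreal (2 * pi / \<beta> * max 0 (\<beta> / 2 - max 0 a))" for a
  proof -
    define r where "r = sqrt (max 0 (1 - 2 * max 0 a / \<beta>))"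
    have r: "r\<^sup>2 = max 0 (1 - 2 * max 0 a / \<beta>)" "r \<ge> 0" by (simp_all add: r_def)
    have r1: "r \<le> 1" using \<beta> by (simp add: r_def)
    have "x \<in> ?s -` {a<..} \<inter> ball 0 1 \<longleftrightarrow> x \<in> ball 0 r" for x
    proof -
      have "norm x < r \<longleftrightarrow> (norm x)\<^sup>2 < r\<^sup>2"
        using r(2) by (metis norm_ge_zero power2_less_imp_less power_strict_mono zero_less_numeral)
      also have "\<dots> \<longleftrightarrow> (norm x)\<^sup>2 < 1 - 2 * max 0 a / \<beta>"
        unfolding r(1) using zero_le_power2[of "norm x"] by (simp only: less_max_iff_disj) linarith
      also have "\<dots> \<longleftrightarrow> max 0 a < ?s x"
        using \<beta> by (simp add: field_simps)
      also have "\<dots> \<longleftrightarrow> a < ?s x \<and> 0 < ?s x" by auto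
      also have "0 < ?s x \<longleftrightarrow> norm x < 1"
        using \<beta> by (simp add: zero_less_mult_iff abs_square_less_1)
      finally show ?thesis by simp
    qed
    then have eq: "?s -` {a<..} \<inter> ball 0 1 = ball 0 r" by blast
    have "emeasure ?L {a<..} = emeasure disk (?s -` {a<..} \<inter> ball 0 1)"
      using meas by (subst emeasure_distr) auto
    also have "\<dots> = emeasure lborel (ball (0 :: real \<times> real) r)"
      unfolding eq disk_def using r1 by (intro emeasure_restrict_space) auto
    also have "\<dots> = ennreal (pi * r\<^sup>2)"
      using r(2) by (simp add: emeasure_ball unit_ball_vol_2 power2_eq_square)
    also have "pi * r\<^sup>2 = 2 * pi / \<beta> * max 0 (\<beta> / 2 - max 0 a)"
      unfolding r(1) using \<beta> by (auto simp: max_def field_simps)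
    finally show ?thesis .
  qed
  have R: "emeasure ?R {a<..} = ennreal (2 * pi / \<beta> * max 0 (\<beta> / 2 - max 0 a))" for a
  proof -
    have "emeasure ?R {a<..} = (\<integral>\<^sup>+ t. ennreal (2 * pi / \<beta>) * indicator {max 0 a<..\<beta> / 2} t \<partial>lborel)"
      by (subst emeasure_density)
        (auto intro!: nn_integral_cong simp: indicator_def)
    also have "\<dots> = ennreal (2 * pi / \<beta>) * emeasure lborel {max 0 a<..\<beta> / 2}"
      by (rule nn_integral_cmult_indicator) simp
    also have "emeasure lborel {max 0 a<..\<beta> / 2} = ennreal (max 0 (\<beta> / 2 - max 0 a))"
      by (cases "max 0 a \<le> \<beta> / 2") (simp_all add: max_absorb2 max_absorb1)
    finally show ?thesis using \<beta> by (simp add: ennreal_mult[symmetric])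
  qed
  show ?thesis
    by (rule measure_eqI_lessThan) (simp_all only: L R, simp_all)
qed

lemma integral_disk_boundary_distance:
  fixes f :: "real \<Rightarrow> real"
  assumes \<beta>: "\<beta> > 0" and f: "f \<in> borel_measurable borel"
  shows "(LINT x|disk. f (\<beta> * (1 - (norm x)\<^sup>2) / 2))
    = 2 * pi / \<beta> * (LBINT t. indicator {0<..\<beta> / 2} t * f t)"
proof -
  have "(LINT x|disk. f (\<beta> * (1 - (norm x)\<^sup>2) / 2))
      = (LINT t|distr disk borel (\<lambda>x. \<beta> * (1 - (norm x)\<^sup>2) / 2). f t)"
    using f by (subst integral_distr) (auto intro!: borel_measurable_disk)
  also have "\<dots> = (LBINT t. (2 * pi / \<beta> * indicator {0<..\<beta> / 2} t) * f t)"
    unfolding distr_disk_boundary_distance[OF \<beta>] using \<beta> f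
    by (subst integral_density) auto
  finally show ?thesis by (simp add: mult.assoc)
qed

definition conj_coordinate :: "real \<times> real \<Rightarrow> complex" where
  "conj_coordinate x = of_real (fst x) - \<i> * of_real (snd x)"

text \<open>
  The trial function is \<open>cnj x ^ k\<close> times this function of \<open>q = |x|\<^sup>2\<close>. As \<open>cnj x ^ k\<close> has modulus
  \<open>q\<close> to the power \<open>k / 2\<close>, the modulus of the trial function is \<open>|x|\<close> times the value of \<open>\<phi>\<close>.
\<close>
definition radial_profile :: "(real \<Rightarrow> real) \<Rightarrow> real \<Rightarrow> nat \<Rightarrow> real \<Rightarrow> real" where
  "radial_profile \<phi> b k q = q powr ((1 - real k) / 2) * \<phi> (sqrt b * (1 - q) / 2)"

definition radial_profile' :: "(real \<Rightarrow> real) \<Rightarrow> (real \<Rightarrow> real) \<Rightarrow> real \<Rightarrow> nat \<Rightarrow> real \<Rightarrow> real" where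
  "radial_profile' \<phi> \<phi>' b k q = q powr ((1 - real k) / 2)
     * ((1 - real k) / (2 * q) * \<phi> (sqrt b * (1 - q) / 2) - sqrt b / 2 * \<phi>' (sqrt b * (1 - q) / 2))"

definition trial :: "(real \<Rightarrow> real) \<Rightarrow> real \<Rightarrow> nat \<Rightarrow> real \<times> real \<Rightarrow> complex" where
  "trial \<phi> b k x = conj_coordinate x ^ k * of_real (radial_profile \<phi> b k ((norm x)\<^sup>2))"

text \<open>
  The derivative of the trial function along a curve through \<open>x\<close> on which \<open>cnj x\<close> has derivative \<open>e\<close> and
  \<open>|x|\<^sup>2\<close> has derivative \<open>p\<close>.
\<close>
definition trial_partial ::
    "(real \<Rightarrow> real) \<Rightarrow> (real \<Rightarrow> real) \<Rightarrow> real \<Rightarrow> nat \<Rightarrow> real \<times> real \<Rightarrow> complex \<Rightarrow> real \<Rightarrow> complex" where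
  "trial_partial \<phi> \<phi>' b k x e p = conj_coordinate x ^ k * of_real (radial_profile' \<phi> \<phi>' b k ((norm x)\<^sup>2) * p)
     + of_nat k * conj_coordinate x ^ (k - 1) * e * of_real (radial_profile \<phi> b k ((norm x)\<^sup>2))"

definition trial_gradient ::
    "(real \<Rightarrow> real) \<Rightarrow> (real \<Rightarrow> real) \<Rightarrow> real \<Rightarrow> nat \<Rightarrow> real \<times> real \<Rightarrow> complex \<times> complex" where
  "trial_gradient \<phi> \<phi>' b k x
     = (trial_partial \<phi> \<phi>' b k x 1 (2 * fst x), trial_partial \<phi> \<phi>' b k x (- \<i>) (2 * snd x))"

lemma norm_conj_coordinate: "norm (conj_coordinate x) = norm x"
  unfolding conj_coordinate_def by (cases x) (simp add: norm_Pair cmod_def)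

lemma radial_profile_derivative:
  assumes "q > 0" and \<phi>: "\<And>t. (\<phi> has_real_derivative \<phi>' t) (at t)"
  shows "(radial_profile \<phi> b k has_real_derivative radial_profile' \<phi> \<phi>' b k q) (at q)"
proof -
  have "((\<lambda>q. \<phi> (sqrt b * (1 - q) / 2)) has_real_derivative \<phi>' (sqrt b * (1 - q) / 2) * (- (sqrt b / 2))) (at q)"
    by (rule DERIV_chain2[OF \<phi>]) (auto intro!: derivative_eq_intros)
  from DERIV_mult[OF has_real_derivative_powr[OF assms(1), of "(1 - real k) / 2"] this]
  show ?thesis
    unfolding radial_profile_def[abs_def] radial_profile'_def
    by (rule DERIV_cong) (use assms(1) in \<open>simp add: powr_diff[of q _ 1] right_diff_distrib mult_ac\<close>)
qed

lemma trial_derivative_along: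
  assumes \<phi>: "\<And>t. (\<phi> has_real_derivative \<phi>' t) (at t)"
    and Z: "((\<lambda>t. conj_coordinate (X t)) has_vector_derivative e) (at t)"
    and q: "((\<lambda>t. (norm (X t))\<^sup>2) has_real_derivative p) (at t)" and nz: "X t \<noteq> 0"
  shows "((\<lambda>t. trial \<phi> b k (X t)) has_vector_derivative trial_partial \<phi> \<phi>' b k (X t) e p) (at t)"
proof -
  have "((\<lambda>z. z ^ k) has_field_derivative of_nat k * conj_coordinate (X t) ^ (k - 1)) (at (conj_coordinate (X t)))"
    by (auto intro!: derivative_eq_intros)
  from field_vector_diff_chain_at[OF Z this]
  have 1: "((\<lambda>t. conj_coordinate (X t) ^ k) has_vector_derivative
      e * (of_nat k * conj_coordinate (X t) ^ (k - 1))) (at t)"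
    by (simp add: o_def)
  have "(norm (X t))\<^sup>2 > 0" using nz by simp
  from DERIV_chain2[OF radial_profile_derivative[OF this \<phi>, of b k] q]
  have 2: "((\<lambda>t. complex_of_real (radial_profile \<phi> b k ((norm (X t))\<^sup>2))) has_vector_derivative
      of_real (radial_profile' \<phi> \<phi>' b k ((norm (X t))\<^sup>2) * p)) (at t)"
    by (intro has_vector_derivative_of_real)
  show ?thesis
    using has_vector_derivative_mult[OF 1 2]
    unfolding trial_def trial_partial_def by (simp add: mult_ac)
qed

lemma trial_gradient_derivative:
  assumes \<phi>: "\<And>t. (\<phi> has_real_derivative \<phi>' t) (at t)" and nz: "(s, t) \<noteq> 0"
  shows "((\<lambda>s. trial \<phi> b k (s, t)) has_vector_derivative fst (trial_gradient \<phi> \<phi>' b k (s, t))) (at s)"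
    and "((\<lambda>t. trial \<phi> b k (s, t)) has_vector_derivative snd (trial_gradient \<phi> \<phi>' b k (s, t))) (at t)"
proof -
  have "((\<lambda>s. conj_coordinate (s, t)) has_vector_derivative 1) (at s)"
    unfolding conj_coordinate_def by (auto intro!: derivative_eq_intros)
  moreover have "((\<lambda>s. (norm (s, t))\<^sup>2) has_real_derivative 2 * s) (at s)"
    unfolding norm_square_pair by (auto intro!: derivative_eq_intros)
  ultimately show "((\<lambda>s. trial \<phi> b k (s, t)) has_vector_derivative fst (trial_gradient \<phi> \<phi>' b k (s, t))) (at s)"
    using trial_derivative_along[OF \<phi>, of "\<lambda>s. (s, t)" _ s] nz by (simp add: trial_gradient_def)
  have "((\<lambda>t. conj_coordinate (s, t)) has_vector_derivative - \<i>) (at t)"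
    unfolding conj_coordinate_def by (auto intro!: derivative_eq_intros)
  moreover have "((\<lambda>t. (norm (s, t))\<^sup>2) has_real_derivative 2 * t) (at t)"
    unfolding norm_square_pair by (auto intro!: derivative_eq_intros)
  ultimately show "((\<lambda>t. trial \<phi> b k (s, t)) has_vector_derivative snd (trial_gradient \<phi> \<phi>' b k (s, t))) (at t)"
    using trial_derivative_along[OF \<phi>, of "\<lambda>t. (s, t)" _ t] nz by (simp add: trial_gradient_def)
qed

lemma power_mult_powr_square:
  assumes "q > 0"
  shows "q ^ k * (q powr ((1 - real k) / 2))\<^sup>2 = q"
proof -
  have "q ^ k * (q powr ((1 - real k) / 2))\<^sup>2
      = q powr real k * (q powr ((1 - real k) / 2) * q powr ((1 - real k) / 2))"
    using assms by (simp add: powr_realpow power2_eq_square)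
  also have "\<dots> = q powr 1"
    unfolding powr_add[symmetric] by (simp add: field_simps)
  finally show ?thesis using assms by simp
qed

lemma norm_trial_square:
  assumes "x \<noteq> 0"
  shows "(norm (trial \<phi> b k x))\<^sup>2 = (norm x)\<^sup>2 * (\<phi> (sqrt b * (1 - (norm x)\<^sup>2) / 2))\<^sup>2"
proof -
  define q where "q = (norm x)\<^sup>2"
  have q: "q > 0" using assms by (simp add: q_def)
  note power_mult_powr_square[OF q, of k]
  moreover have "(norm (trial \<phi> b k x))\<^sup>2 = q ^ k * (q powr ((1 - real k) / 2))\<^sup>2 * (\<phi> (sqrt b * (1 - q) / 2))\<^sup>2"
    by (simp add: trial_def norm_mult norm_power norm_conj_coordinate radial_profile_def
        power_mult_distrib power_mult[symmetric] mult.commute[of k] q_def)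
  ultimately show ?thesis by (simp add: q_def)
qed

text \<open>
  The decomposition of the magnetic energy density of \<open>cnj x ^ k * G (|x|\<^sup>2)\<close> into its radial and its
  angular part, after division by the common factor \<open>|x|\<close> to the power \<open>2 k - 2\<close>.
\<close>
lemma magnetic_density_polynomial_identity:
  fixes s t b k G G' :: real
  defines "Z \<equiv> of_real s - \<i> * of_real t"
  shows "(norm (- \<i> * (of_real (k * G) + Z * of_real (2 * s * G')) - of_real (b * t / 2 * G) * Z))\<^sup>2
    + (norm (- \<i> * (- \<i> * of_real (k * G) + Z * of_real (2 * t * G')) + of_real (b * s / 2 * G) * Z))\<^sup>2
    = (2 * (s\<^sup>2 + t\<^sup>2) * G' + k * G)\<^sup>2 + (k - b * (s\<^sup>2 + t\<^sup>2) / 2)\<^sup>2 * G\<^sup>2"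
proof -
  let ?a = "2 * s * t * G' + b * s * t * G / 2"
  have "- \<i> * (of_real (k * G) + Z * of_real (2 * s * G')) - of_real (b * t / 2 * G) * Z
      = Complex (- ?a) (- (k * G + 2 * s\<^sup>2 * G' - b * t\<^sup>2 / 2 * G))"
    "- \<i> * (- \<i> * of_real (k * G) + Z * of_real (2 * t * G')) + of_real (b * s / 2 * G) * Z
      = Complex (- (k * G + 2 * t\<^sup>2 * G' - b * s\<^sup>2 / 2 * G)) (- ?a)"
    by (simp_all add: Z_def complex_eq_iff power2_eq_square algebra_simps)
  then have "(norm (- \<i> * (of_real (k * G) + Z * of_real (2 * s * G')) - of_real (b * t / 2 * G) * Z))\<^sup>2
    + (norm (- \<i> * (- \<i> * of_real (k * G) + Z * of_real (2 * t * G')) + of_real (b * s / 2 * G) * Z))\<^sup>2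
    = 2 * ?a\<^sup>2 + (k * G + 2 * s\<^sup>2 * G' - b * t\<^sup>2 / 2 * G)\<^sup>2 + (k * G + 2 * t\<^sup>2 * G' - b * s\<^sup>2 / 2 * G)\<^sup>2"
    by (simp only: cmod_power2 complex.sel power2_minus)
  also have "\<dots> = (2 * (s\<^sup>2 + t\<^sup>2) * G' + k * G)\<^sup>2 + (k - b * (s\<^sup>2 + t\<^sup>2) / 2)\<^sup>2 * G\<^sup>2"
    by (simp add: power2_eq_square algebra_simps)
  finally show ?thesis .
qed

text \<open>
  The factor \<open>|x|\<close> in the modulus of the trial function cancels the weight \<open>1 / |x|\<^sup>2\<close> of the radial and
  the angular energy, so the density extends continuously to the origin.
\<close>
lemma norm_magnetic_gradient_trial:
  fixes x :: "real \<times> real" and b :: real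
  assumes "x \<noteq> 0"
  defines "q \<equiv> (norm x)\<^sup>2"
  defines "\<tau> \<equiv> sqrt b * (1 - q) / 2"
  shows "(norm (fst (magnetic_gradient b (trial \<phi> b k) (trial_gradient \<phi> \<phi>' b k) x)))\<^sup>2
      + (norm (snd (magnetic_gradient b (trial \<phi> b k) (trial_gradient \<phi> \<phi>' b k) x)))\<^sup>2
    = (\<phi> \<tau> - sqrt b * q * \<phi>' \<tau>)\<^sup>2 + (real k - b * q / 2)\<^sup>2 * (\<phi> \<tau>)\<^sup>2"
proof -
  define Z where "Z = conj_coordinate x"
  define G where "G = radial_profile \<phi> b k q"
  define G' where "G' = radial_profile' \<phi> \<phi>' b k q"
  have q: "q > 0" using assms by (simp add: q_def)
  have Z0: "Z \<noteq> 0" using norm_conj_coordinate[of x] assms(1) by (auto simp: Z_def)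
  have kZ: "of_nat k * Z ^ (k - 1) = of_nat k * Z ^ k / Z" using Z0 by (cases k) auto
  have qst: "q = (fst x)\<^sup>2 + (snd x)\<^sup>2" by (simp add: q_def norm_square_pair)
  let ?A = "- \<i> * (of_real (k * G) + Z * of_real (2 * fst x * G')) - of_real (b * snd x / 2 * G) * Z"
  let ?B = "- \<i> * (- \<i> * of_real (k * G) + Z * of_real (2 * snd x * G')) + of_real (b * fst x / 2 * G) * Z"
  have "fst (magnetic_gradient b (trial \<phi> b k) (trial_gradient \<phi> \<phi>' b k) x)
      = - \<i> * (Z ^ k * of_real (G' * (2 * fst x)) + of_nat k * Z ^ (k - 1) * 1 * of_real G)
        + of_real (b * (- snd x / 2)) * (Z ^ k * of_real G)"
    by (simp only: magnetic_gradient_def trial_gradient_def trial_partial_def trial_def vec_pot_def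
        Z_def q_def G_def G'_def fst_conv)
  also have "\<dots> = Z ^ k / Z * ?A"
    unfolding kZ using Z0 by (simp add: field_simps)
  finally have A: "fst (magnetic_gradient b (trial \<phi> b k) (trial_gradient \<phi> \<phi>' b k) x) = Z ^ k / Z * ?A" .
  have "snd (magnetic_gradient b (trial \<phi> b k) (trial_gradient \<phi> \<phi>' b k) x)
      = - \<i> * (Z ^ k * of_real (G' * (2 * snd x)) + of_nat k * Z ^ (k - 1) * (- \<i>) * of_real G)
        + of_real (b * (fst x / 2)) * (Z ^ k * of_real G)"
    by (simp only: magnetic_gradient_def trial_gradient_def trial_partial_def trial_def vec_pot_def
        Z_def q_def G_def G'_def snd_conv)
  also have "\<dots> = Z ^ k / Z * ?B"
    unfolding kZ using Z0 by (simp add: field_simps)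
  finally have B: "snd (magnetic_gradient b (trial \<phi> b k) (trial_gradient \<phi> \<phi>' b k) x) = Z ^ k / Z * ?B" .
  have nZ: "(norm (Z ^ k / Z))\<^sup>2 = q ^ k / q"
    by (simp add: Z_def norm_divide norm_power norm_conj_coordinate q_def power_divide power_mult[symmetric] mult.commute)
  have "(norm (fst (magnetic_gradient b (trial \<phi> b k) (trial_gradient \<phi> \<phi>' b k) x)))\<^sup>2
      + (norm (snd (magnetic_gradient b (trial \<phi> b k) (trial_gradient \<phi> \<phi>' b k) x)))\<^sup>2
    = q ^ k / q * ((norm ?A)\<^sup>2 + (norm ?B)\<^sup>2)"
    unfolding A B norm_mult power_mult_distrib nZ by (simp only: distrib_left)
  also have "(norm ?A)\<^sup>2 + (norm ?B)\<^sup>2 = (2 * q * G' + k * G)\<^sup>2 + (k - b * q / 2)\<^sup>2 * G\<^sup>2"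
    unfolding Z_def conj_coordinate_def qst by (rule magnetic_density_polynomial_identity)
  also have "2 * q * G' + k * G = q powr ((1 - real k) / 2) * (\<phi> \<tau> - sqrt b * q * \<phi>' \<tau>)"
  proof -
    have "G = q powr ((1 - real k) / 2) * \<phi> \<tau>"
      "G' = q powr ((1 - real k) / 2) * ((1 - real k) / (2 * q) * \<phi> \<tau> - sqrt b / 2 * \<phi>' \<tau>)"
      by (simp_all only: G_def G'_def radial_profile_def radial_profile'_def \<tau>_def)
    then show ?thesis using q by (simp add: field_simps)
  qed
  also have "G = q powr ((1 - real k) / 2) * \<phi> \<tau>"
    by (simp add: G_def radial_profile_def \<tau>_def)
  finally have *: "(norm (fst (magnetic_gradient b (trial \<phi> b k) (trial_gradient \<phi> \<phi>' b k) x)))\<^sup>2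
      + (norm (snd (magnetic_gradient b (trial \<phi> b k) (trial_gradient \<phi> \<phi>' b k) x)))\<^sup>2
    = (q ^ k / q * (q powr ((1 - real k) / 2))\<^sup>2)
      * ((\<phi> \<tau> - sqrt b * q * \<phi>' \<tau>)\<^sup>2 + (real k - b * q / 2)\<^sup>2 * (\<phi> \<tau>)\<^sup>2)"
    by (simp only: power_mult_distrib distrib_left mult_ac)
  have "q ^ k / q * (q powr ((1 - real k) / 2))\<^sup>2 = 1" using power_mult_powr_square[OF q, of k] q by simp
  with * show ?thesis by simp
qed

section \<open>Decaying solutions of the Weber equation\<close>

lemma integrable_half_line_iff:
  fixes f :: "real \<Rightarrow> 'a::{banach, second_countable_topology}"
  shows "integrable half_line f \<longleftrightarrow> set_integrable lborel {0<..} f"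
  by (simp add: half_line_def set_integrable_def integrable_restrict_space)

lemma integral_half_line:
  fixes f :: "real \<Rightarrow> 'a::{banach, second_countable_topology}"
  shows "(LINT x|half_line. f x) = (LBINT x:{0<..}. f x)"
  by (simp add: half_line_def set_lebesgue_integral_def integral_restrict_space)

lemma space_half_line [simp]: "space half_line = {0<..}"
  by (simp add: half_line_def space_restrict_space)

lemma borel_measurable_half_line:
  "f \<in> borel_measurable borel \<Longrightarrow> f \<in> borel_measurable half_line"
  by (simp add: half_line_def measurable_restrict_space1)

lemma integral_half_line_FTC:
  fixes F f :: "real \<Rightarrow> real"
  assumes "\<And>x. x > 0 \<Longrightarrow> (F has_real_derivative f x) (at x)" "\<And>x. x > 0 \<Longrightarrow> isCont f x"
    and "integrable half_line f" "(F \<longlongrightarrow> A) (at_right 0)" "(F \<longlongrightarrow> B) at_top"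
  shows "(LINT x|half_line. f x) = B - A"
proof -
  have e: "einterval (ereal 0) \<infinity> = {0<..}" by (auto simp: einterval_def)
  have "(LBINT x=ereal 0..\<infinity>. f x) = B - A"
    using assms
    by (intro interval_integral_FTC_integrable)
      (auto simp: e ereal_tendsto_simps integrable_half_line_iff[symmetric]
        has_real_derivative_iff_has_vector_derivative[symmetric])
  then show ?thesis
    by (simp add: integral_half_line interval_lebesgue_integral_def e)
qed

definition hermite_weight :: "real \<Rightarrow> real \<Rightarrow> real \<Rightarrow> real" where
  "hermite_weight a s z = z powr (a - 1) * exp (- (2 * s * z) - z\<^sup>2)"

text \<open>
  Up to the factor \<open>Gamma a\<close> this is the Hermite function of order \<open>- a\<close>, in its integral representation.
\<close>
definition hermite :: "real \<Rightarrow> real \<Rightarrow> real" where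
  "hermite a s = (LINT z|half_line. hermite_weight a s z)"

lemma hermite_weight_pos: "z > 0 \<Longrightarrow> hermite_weight a s z > 0"
  by (simp add: hermite_weight_def)

lemma hermite_weight_Suc: "z > 0 \<Longrightarrow> hermite_weight (a + 1) s z = z * hermite_weight a s z"
  by (simp add: hermite_weight_def powr_diff)

lemma hermite_weight_measurable [measurable]: "hermite_weight a s \<in> borel_measurable half_line"
  unfolding hermite_weight_def[abs_def] by (rule borel_measurable_half_line) measurable

lemma integrable_Gamma_weight:
  assumes "a > 0"
  shows "integrable half_line (\<lambda>z. z powr (a - 1) * exp (- z))"
proof -
  have "(\<lambda>t. complex_of_real t powr (complex_of_real a - 1) / of_real (exp t)) absolutely_integrable_on {0<..}"
    by (rule absolutely_integrable_Gamma_integral') (use assms in simp)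
  then have "(\<lambda>t. norm (complex_of_real t powr (complex_of_real a - 1) / of_real (exp t))) absolutely_integrable_on {0<..}"
    by (rule absolutely_integrable_norm[unfolded comp_def])
  then have "(\<lambda>t. t powr (a - 1) * exp (- t)) absolutely_integrable_on {0<..}"
    by (rule absolutely_integrable_spike[OF _ negligible_empty])
      (auto simp: norm_divide norm_powr_real_powr exp_minus field_simps)
  then show ?thesis
    unfolding integrable_half_line_iff set_integrable_def
    by (subst (asm) integrable_completion) (auto)
qed

lemma exp_gaussian_le:
  "exp (- (2 * s * z) - z\<^sup>2) \<le> exp ((1 - 2 * s)\<^sup>2 / 4) * exp (- z)" for s z :: real
proof -
  have "0 \<le> (z - (1 - 2 * s) / 2)\<^sup>2" by simp
  then have "- (2 * s * z) - z\<^sup>2 \<le> (1 - 2 * s)\<^sup>2 / 4 + - z"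
    by (simp add: power2_eq_square field_simps)
  then show ?thesis
    unfolding exp_add[symmetric] by simp
qed

lemma hermite_weight_integrable:
  assumes "a > 0"
  shows "integrable half_line (hermite_weight a s)"
proof (rule Bochner_Integration.integrable_bound)
  show "integrable half_line (\<lambda>z. exp ((1 - 2 * s)\<^sup>2 / 4) * (z powr (a - 1) * exp (- z)))"
    by (intro integrable_mult_right integrable_Gamma_weight assms)
  show "AE z in half_line. norm (hermite_weight a s z)
      \<le> norm (exp ((1 - 2 * s)\<^sup>2 / 4) * (z powr (a - 1) * exp (- z)))"
  proof (rule AE_I2)
    fix z :: real
    have "z powr (a - 1) * exp (- (2 * s * z) - z\<^sup>2)
        \<le> z powr (a - 1) * (exp ((1 - 2 * s)\<^sup>2 / 4) * exp (- z))"
      by (intro mult_left_mono exp_gaussian_le) auto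
    then show "norm (hermite_weight a s z)
      \<le> norm (exp ((1 - 2 * s)\<^sup>2 / 4) * (z powr (a - 1) * exp (- z)))"
      by (simp add: hermite_weight_def abs_mult mult_ac)
  qed
qed measurable

lemma hermite_pos:
  assumes "a > 0"
  shows "hermite a s > 0"
proof -
  have nn: "AE z in half_line. 0 \<le> hermite_weight a s z"
    by (rule AE_I2) (simp add: hermite_weight_pos less_imp_le)
  have "hermite a s \<noteq> 0"
  proof
    assume "hermite a s = 0"
    then have "AE z in half_line. hermite_weight a s z = 0"
      unfolding hermite_def
      using integral_nonneg_eq_0_iff_AE[OF hermite_weight_integrable[OF assms] nn] by simp
    then have "AE z in half_line. False"
      by (rule AE_mp) (rule AE_I2, use hermite_weight_pos[of _ a s] in \<open>force\<close>)
    then have "emeasure lborel {0::real<..} = 0"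
      using AE_iff_measurable[of "space half_line" half_line "\<lambda>_. False", OF sets.top]
      by (simp add: half_line_def emeasure_restrict_space space_restrict_space greaterThan_def)
    moreover have "emeasure lborel {0<..<1::real} \<le> emeasure lborel {0::real<..}"
      by (intro emeasure_mono) auto
    ultimately show False by simp
  qed
  moreover have "hermite a s \<ge> 0"
    unfolding hermite_def by (intro integral_nonneg_AE nn)
  ultimately show ?thesis by simp
qed

lemma hermite_antimono:
  assumes "a > 0" "s \<le> r"
  shows "hermite a r \<le> hermite a s"
  unfolding hermite_def
proof (rule integral_mono[OF hermite_weight_integrable hermite_weight_integrable])
  fix z :: real assume "z \<in> space half_line"
  then have "s * z \<le> r * z" using assms by (intro mult_right_mono) auto
  then show "hermite_weight a r z \<le> hermite_weight a s z"
    unfolding hermite_weight_def by (intro mult_left_mono) auto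
qed (use assms in auto)

lemma abs_exp_minus_one_minus_self_le: "\<bar>exp y - 1 - y\<bar> \<le> y\<^sup>2 / 2 * exp \<bar>y\<bar>" for y :: real
proof -
  obtain t where t: "\<bar>t\<bar> \<le> \<bar>y\<bar>" "exp y = (\<Sum>m<2. y ^ m / fact m) + exp t / fact 2 * y ^ 2"
    using Maclaurin_exp_le[of y 2] by blast
  then have "exp y - 1 - y = y\<^sup>2 / 2 * exp t"
    by (simp add: numeral_2_eq_2)
  then have "\<bar>exp y - 1 - y\<bar> = y\<^sup>2 / 2 * exp t"
    by (simp only: abs_mult abs_exp_cancel) simp
  also have "\<dots> \<le> y\<^sup>2 / 2 * exp \<bar>y\<bar>"
    using t(1) by (intro mult_left_mono) auto
  finally show ?thesis .
qed

lemma hermite_has_derivative: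
  assumes a: "a > 0"
  shows "(hermite a has_real_derivative - 2 * hermite (a + 1) s) (at s)"
proof -
  have bound: "norm ((hermite a (s + h) - hermite a s) / h - - 2 * hermite (a + 1) s)
      \<le> 2 * hermite (a + 2) (s - 1) * \<bar>h\<bar>" if h: "h \<noteq> 0" "\<bar>h\<bar> < 1" for h
  proof -
    note i = hermite_weight_integrable[OF a] hermite_weight_integrable[of "a + 1"]
      hermite_weight_integrable[of "a + 2"]
    let ?d = "\<lambda>z. hermite_weight a (s + h) z - hermite_weight a s z + 2 * h * hermite_weight (a + 1) s z"
    have di: "integrable half_line ?d"
      using a by (intro Bochner_Integration.integrable_add Bochner_Integration.integrable_diff
        integrable_mult_right i) auto
    have "hermite a (s + h) - hermite a s + 2 * h * hermite (a + 1) s = (LINT z|half_line. ?d z)"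
      unfolding hermite_def using a by (simp add: i)
    moreover have "\<bar>LINT z|half_line. ?d z\<bar> \<le> (LINT z|half_line. 2 * h\<^sup>2 * hermite_weight (a + 2) (s - 1) z)"
    proof (rule integral_abs_bound_integral[OF di])
      show "integrable half_line (\<lambda>z. 2 * h\<^sup>2 * hermite_weight (a + 2) (s - 1) z)"
        using a by (intro integrable_mult_right i) auto
      fix z :: real assume "z \<in> space half_line"
      then have z: "z > 0" by simp
      have e: "exp (- (2 * (s + h) * z) - z\<^sup>2) = exp (- (2 * s * z) - z\<^sup>2) * exp (- 2 * h * z)"
        unfolding exp_add[symmetric] by (simp add: algebra_simps)
      have "?d z = hermite_weight a s z * (exp (- 2 * h * z) - 1 - (- 2 * h * z))"
        unfolding hermite_weight_Suc[OF z] unfolding hermite_weight_def e by (simp add: ring_distribs mult_ac)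
      then have "\<bar>?d z\<bar> = hermite_weight a s z * \<bar>exp (- 2 * h * z) - 1 - (- 2 * h * z)\<bar>"
        using hermite_weight_pos[OF z, of a s] by (simp add: abs_mult)
      also have "\<dots> \<le> hermite_weight a s z * ((- 2 * h * z)\<^sup>2 / 2 * exp \<bar>- 2 * h * z\<bar>)"
        using hermite_weight_pos[OF z, of a s]
        by (intro mult_left_mono abs_exp_minus_one_minus_self_le) auto
      also have "\<dots> \<le> hermite_weight a s z * ((- 2 * h * z)\<^sup>2 / 2 * exp (2 * z))"
      proof -
        have "\<bar>h\<bar> * z \<le> 1 * z" using h z by (intro mult_right_mono) auto
        then show ?thesis
          using hermite_weight_pos[OF z, of a s] z by (intro mult_left_mono) (auto simp: abs_mult)
      qed
      also have "\<dots> = 2 * h\<^sup>2 * (z * (z * (hermite_weight a s z * exp (2 * z))))"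
        by (simp add: power2_eq_square)
      also have "hermite_weight a s z * exp (2 * z) = hermite_weight a (s - 1) z"
        unfolding hermite_weight_def mult.assoc exp_add[symmetric] by (simp add: algebra_simps)
      also have "z * (z * hermite_weight a (s - 1) z) = hermite_weight (a + 2) (s - 1) z"
        using hermite_weight_Suc[OF z, of "a + 1" "s - 1"] hermite_weight_Suc[OF z, of a "s - 1"]
        by (simp add: add.assoc)
      finally show "\<bar>?d z\<bar> \<le> 2 * h\<^sup>2 * hermite_weight (a + 2) (s - 1) z" .
    qed
    ultimately have "\<bar>hermite a (s + h) - hermite a s + 2 * h * hermite (a + 1) s\<bar>
        \<le> 2 * h\<^sup>2 * hermite (a + 2) (s - 1)"
      by (simp add: hermite_def)
    moreover have "norm ((hermite a (s + h) - hermite a s) / h - - 2 * hermite (a + 1) s)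
      = \<bar>hermite a (s + h) - hermite a s + 2 * h * hermite (a + 1) s\<bar> / \<bar>h\<bar>"
      unfolding real_norm_def abs_divide[symmetric] using h by (simp add: field_simps)
    ultimately show ?thesis
      using h by (simp add: divide_le_eq power2_eq_square mult_ac)
  qed
  have "((\<lambda>h. (hermite a (s + h) - hermite a s) / h - - 2 * hermite (a + 1) s) \<longlongrightarrow> 0) (at 0)"
  proof (rule Lim_null_comparison)
    show "\<forall>\<^sub>F h in at 0. norm ((hermite a (s + h) - hermite a s) / h - - 2 * hermite (a + 1) s)
      \<le> 2 * hermite (a + 2) (s - 1) * \<bar>h\<bar>"
      unfolding eventually_at using bound by (intro exI[of _ 1]) (auto simp: dist_real_def)
    show "((\<lambda>h. 2 * hermite (a + 2) (s - 1) * \<bar>h\<bar>) \<longlongrightarrow> 0) (at 0)"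
      by (auto intro!: tendsto_eq_intros)
  qed
  then show ?thesis
    unfolding DERIV_def by (subst (asm) LIM_zero_iff)
qed

text \<open>
  Integration of the derivative of \<open>z powr a * exp (- (2 * s * z) - z\<^sup>2)\<close> over the half-line.
\<close>
lemma hermite_recurrence:
  assumes a: "a > 0"
  shows "a * hermite a s = 2 * s * hermite (a + 1) s + 2 * hermite (a + 2) s"
proof -
  let ?f = "\<lambda>z. a * hermite_weight a s z - 2 * s * hermite_weight (a + 1) s z - 2 * hermite_weight (a + 2) s z"
  note i = hermite_weight_integrable[OF a] hermite_weight_integrable[of "a + 1"]
    hermite_weight_integrable[of "a + 2"]
  have fi: "integrable half_line ?f"
    using a by (intro Bochner_Integration.integrable_diff integrable_mult_right i) auto
  have "(LINT z|half_line. ?f z) = 0 - 0"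
  proof (rule integral_half_line_FTC[OF _ _ fi])
    fix z :: real assume z: "z > 0"
    have w: "hermite_weight a s z = z powr (a - 1) * exp (- (2 * s * z) - z\<^sup>2)"
      "hermite_weight (a + 1) s z = z powr a * exp (- (2 * s * z) - z\<^sup>2)"
      "hermite_weight (a + 2) s z = z * z powr a * exp (- (2 * s * z) - z\<^sup>2)"
      using hermite_weight_Suc[OF z, of "a + 1" s] by (auto simp: hermite_weight_def add.assoc)
    show "((\<lambda>z. z powr a * exp (- (2 * s * z) - z\<^sup>2)) has_real_derivative ?f z) (at z)"
      unfolding w using z by (auto intro!: derivative_eq_intros simp: algebra_simps)
    show "isCont ?f z"
      unfolding hermite_weight_def using z by (intro continuous_intros) auto
  next
    show "((\<lambda>z. z powr a * exp (- (2 * s * z) - z\<^sup>2)) \<longlongrightarrow> 0) (at_right 0)"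
    proof -
      have "((\<lambda>z::real. z powr a) \<longlongrightarrow> 0) (at_right 0)"
        using a by (intro tendsto_zero_powrI) (auto intro!: tendsto_eq_intros eventually_at_rightI[of 0 1])
      moreover have "((\<lambda>z. exp (- (2 * s * z) - z\<^sup>2)) \<longlongrightarrow> exp (- (2 * s * 0) - 0\<^sup>2)) (at_right 0)"
        by (intro tendsto_intros)
      ultimately show ?thesis
        using tendsto_mult by fastforce
    qed
    show "((\<lambda>z. z powr a * exp (- (2 * s * z) - z\<^sup>2)) \<longlongrightarrow> 0) at_top"
    proof (rule Lim_null_comparison)
      define n where "n = nat \<lceil>a\<rceil>"
      let ?K = "exp ((1 - 2 * s)\<^sup>2 / 4)"
      show "\<forall>\<^sub>F z in at_top. norm (z powr a * exp (- (2 * s * z) - z\<^sup>2)) \<le> ?K * (z ^ n / exp z)"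
        using eventually_ge_at_top[of 1]
      proof eventually_elim
        fix z :: real assume z: "1 \<le> z"
        have "z powr a \<le> z powr real n" using z by (intro powr_mono) (auto simp: n_def intro: real_nat_ceiling_ge)
        also have "\<dots> = z ^ n" using z by (simp add: powr_realpow)
        finally have "z powr a * exp (- (2 * s * z) - z\<^sup>2) \<le> z ^ n * (?K * exp (- z))"
          using exp_gaussian_le[of s z] z by (intro mult_mono) auto
        then show "norm (z powr a * exp (- (2 * s * z) - z\<^sup>2)) \<le> ?K * (z ^ n / exp z)"
          using z by (simp add: abs_mult exp_minus field_simps)
      qed
      show "((\<lambda>z. ?K * (z ^ n / exp z)) \<longlongrightarrow> 0) at_top"
        using tendsto_mult_right_zero[OF tendsto_power_div_exp_0] by blast
    qed
  qed
  then show ?thesis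
    unfolding hermite_def using a by (simp add: i)
qed

text \<open>
  The one-sided continuity in \<open>a\<close> that lets the energy \<open>1 - 2 * a\<close> of a Weber function be lowered slightly.
\<close>
lemma hermite_tendsto_parameter:
  assumes a: "a > 0"
  shows "(\<lambda>n. hermite (a + 1 / real (Suc n)) s) \<longlonglongrightarrow> hermite a s"
  unfolding hermite_def
proof (rule integral_dominated_convergence[where w = "\<lambda>z. hermite_weight a s z + hermite_weight (a + 1) s z"])
  show "integrable half_line (\<lambda>z. hermite_weight a s z + hermite_weight (a + 1) s z)"
    using a by (intro Bochner_Integration.integrable_add hermite_weight_integrable) auto
  show "AE z in half_line. (\<lambda>n. hermite_weight (a + 1 / real (Suc n)) s z) \<longlonglongrightarrow> hermite_weight a s z"
  proof (rule AE_I2)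
    fix z :: real assume "z \<in> space half_line"
    then have z: "z > 0" by simp
    have l: "(\<lambda>n. a + 1 / real (Suc n) - 1) \<longlonglongrightarrow> a + 0 - 1"
      by (intro tendsto_intros LIMSEQ_Suc[OF lim_1_over_n])
    show "(\<lambda>n. hermite_weight (a + 1 / real (Suc n)) s z) \<longlonglongrightarrow> hermite_weight a s z"
      unfolding hermite_weight_def
      using tendsto_mult[OF tendsto_powr[OF tendsto_const[of z] l] tendsto_const] z by simp
  qed
  fix n
  show "AE z in half_line. norm (hermite_weight (a + 1 / real (Suc n)) s z)
      \<le> hermite_weight a s z + hermite_weight (a + 1) s z"
  proof (rule AE_I2)
    fix z :: real assume "z \<in> space half_line"
    then have z: "z > 0" by simp
    define e where "e = 1 / real (Suc n)"
    have e: "0 \<le> e" "e \<le> 1" by (auto simp: e_def)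
    have "z powr (a + e - 1) \<le> z powr (a - 1) + z powr a"
    proof (cases "z \<le> 1")
      case True
      have "z powr (a + e - 1) \<le> z powr (a - 1)"
        using True z e by (intro powr_mono') auto
      moreover have "0 \<le> z powr a" by simp
      ultimately show ?thesis by linarith
    next
      case False
      have "z powr (a + e - 1) \<le> z powr a" using False e by (intro powr_mono) auto
      moreover have "0 \<le> z powr (a - 1)" by simp
      ultimately show ?thesis by linarith
    qed
    then have "z powr (a + e - 1) * exp (- (2 * s * z) - z\<^sup>2)
      \<le> (z powr (a - 1) + z powr a) * exp (- (2 * s * z) - z\<^sup>2)"
      by (intro mult_right_mono) auto
    then show "norm (hermite_weight (a + 1 / real (Suc n)) s z)
      \<le> hermite_weight a s z + hermite_weight (a + 1) s z"
      by (simp add: hermite_weight_def e_def distrib_right abs_mult)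
  qed
qed measurable

text \<open>
  The Weber function \<open>weber a\<close> is the solution of \<open>w'' = (s\<^sup>2 - E) w\<close> with \<open>E = 1 - 2 * a\<close> that decays
  at \<open>+\<infinity>\<close>; up to scaling it is a parabolic cylinder function.
\<close>
definition weber :: "real \<Rightarrow> real \<Rightarrow> real" where
  "weber a s = exp (- s\<^sup>2 / 2) * hermite a s"

definition weber' :: "real \<Rightarrow> real \<Rightarrow> real" where
  "weber' a s = - exp (- s\<^sup>2 / 2) * (2 * hermite (a + 1) s + s * hermite a s)"

lemma weber_has_derivative:
  assumes "a > 0"
  shows "(weber a has_real_derivative weber' a s) (at s)"
  unfolding weber_def[abs_def] weber'_def
  by (rule derivative_eq_intros hermite_has_derivative assms refl | simp add: algebra_simps)+

lemma weber'_has_derivative: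
  assumes "a > 0"
  shows "(weber' a has_real_derivative (s\<^sup>2 - (1 - 2 * a)) * weber a s) (at s)"
proof -
  have a1: "a + 1 > 0" using assms by simp
  note d = hermite_has_derivative[OF assms, of s] hermite_has_derivative[OF a1, of s]
  have "(weber' a has_real_derivative
     s * exp (- s\<^sup>2 / 2) * (2 * hermite (a + 1) s + s * hermite a s)
     - exp (- s\<^sup>2 / 2) * (2 * (- 2 * hermite (a + 1 + 1) s) + (hermite a s + s * (- 2 * hermite (a + 1) s)))) (at s)"
    unfolding weber'_def[abs_def]
    by (rule derivative_eq_intros d refl | simp)+
  moreover have "s * exp (- s\<^sup>2 / 2) * (2 * hermite (a + 1) s + s * hermite a s)
     - exp (- s\<^sup>2 / 2) * (2 * (- 2 * hermite (a + 1 + 1) s) + (hermite a s + s * (- 2 * hermite (a + 1) s)))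
    = exp (- s\<^sup>2 / 2) * (s\<^sup>2 * hermite a s - hermite a s
       + 2 * (2 * s * hermite (a + 1) s + 2 * hermite (a + 2) s))"
    by (simp add: algebra_simps power2_eq_square)
  ultimately show ?thesis
    unfolding hermite_recurrence[OF assms, symmetric] by (simp add: weber_def algebra_simps)
qed

lemma weber_pos: "a > 0 \<Longrightarrow> weber a s > 0"
  by (simp add: weber_def hermite_pos)

text \<open>
  The Hermite factor is decreasing, so both functions inherit the decay of the Gaussian; the weaker
  exponential rate is all that is used below.
\<close>
lemma weber_decay:
  assumes "a > 0"
  obtains K where "\<And>t. t \<ge> 0 \<Longrightarrow> \<bar>weber a (t - \<xi>)\<bar> \<le> K * exp (- t)"
    "\<And>t. t \<ge> 0 \<Longrightarrow> \<bar>weber' a (t - \<xi>)\<bar> \<le> K * exp (- t)"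
proof
  let ?K = "(2 * hermite (a + 1) (- \<xi>) + hermite a (- \<xi>)) * exp (2 + \<xi>)"
  have p: "hermite a s > 0" "hermite (a + 1) s > 0" for s using assms by (auto intro: hermite_pos)
  fix t :: real assume t: "t \<ge> 0"
  define s where "s = t - \<xi>"
  have h: "hermite a s \<le> hermite a (- \<xi>)" "hermite (a + 1) s \<le> hermite (a + 1) (- \<xi>)"
    using t assms by (auto intro!: hermite_antimono simp: s_def)
  have q: "- s\<^sup>2 / 2 + \<bar>s\<bar> \<le> 2 - s"
  proof -
    have "0 \<le> (\<bar>s\<bar> - 2)\<^sup>2" by simp
    then have "- s\<^sup>2 / 2 + 2 * \<bar>s\<bar> \<le> 2"
      by (simp add: power2_diff)
    then show ?thesis by linarith
  qed
  have e2: "exp (2 - s) = exp (2 + \<xi>) * exp (- t)" unfolding exp_add[symmetric] by (simp add: s_def)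
  have es: "exp (- s\<^sup>2 / 2) * exp \<bar>s\<bar> \<le> exp (2 - s)"
    unfolding exp_add[symmetric] using q by simp
  have e0: "exp (- s\<^sup>2 / 2) \<le> exp (2 - s)" using q by simp
  have sa: "\<bar>s\<bar> \<le> exp \<bar>s\<bar>" using exp_ge_add_one_self[of "\<bar>s\<bar>"] by linarith
  have e1: "exp (- s\<^sup>2 / 2) * \<bar>s\<bar> \<le> exp (2 - s)"
    using order_trans[OF mult_left_mono[OF sa, of "exp (- s\<^sup>2 / 2)"] es] by simp
  have "\<bar>weber a s\<bar> = exp (- s\<^sup>2 / 2) * hermite a s"
    using p(1)[of s] by (simp add: weber_def abs_mult)
  also have "\<dots> \<le> exp (2 - s) * (2 * hermite (a + 1) (- \<xi>) + hermite a (- \<xi>))"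
    using h e0 p[of s] p[of "- \<xi>"] by (intro mult_mono) auto
  finally show "\<bar>weber a (t - \<xi>)\<bar> \<le> ?K * exp (- t)"
    by (simp add: s_def[symmetric] e2 mult_ac)
  have "\<bar>weber' a s\<bar> \<le> exp (- s\<^sup>2 / 2) * \<bar>2 * hermite (a + 1) s + s * hermite a s\<bar>"
    by (simp add: weber'_def abs_mult)
  also have "\<dots> \<le> exp (- s\<^sup>2 / 2) * (2 * hermite (a + 1) s + \<bar>s\<bar> * hermite a s)"
    using p[of s] by (intro mult_left_mono) (auto simp: abs_mult intro: order_trans[OF abs_triangle_ineq])
  also have "\<dots> = exp (- s\<^sup>2 / 2) * (2 * hermite (a + 1) s) + (exp (- s\<^sup>2 / 2) * \<bar>s\<bar>) * hermite a s"
    by (simp add: algebra_simps)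
  also have "\<dots> \<le> exp (2 - s) * (2 * hermite (a + 1) (- \<xi>)) + exp (2 - s) * hermite a (- \<xi>)"
    using h e0 e1 p[of s] p[of "- \<xi>"] by (intro add_mono mult_mono) auto
  finally show "\<bar>weber' a (t - \<xi>)\<bar> \<le> ?K * exp (- t)"
    by (simp add: s_def[symmetric] e2 algebra_simps)
qed

section \<open>The ground state of the de Gennes operator\<close>

text \<open>
  Exponential decay on the half-line makes functions integrable and is stable under products with
  polynomials, which is what the integrations by parts require.
\<close>
definition rapid :: "(real \<Rightarrow> real) \<Rightarrow> bool" where
  "rapid f \<longleftrightarrow> continuous_on UNIV f \<and> (\<exists>K. \<forall>t\<ge>0. \<bar>f t\<bar> \<le> K * exp (- t))"

lemma rapid_integrable:
  assumes "rapid f"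
  shows "integrable half_line f"
proof -
  from assms obtain K where c: "continuous_on UNIV f" and K: "\<And>t. t \<ge> 0 \<Longrightarrow> \<bar>f t\<bar> \<le> K * exp (- t)"
    unfolding rapid_def by blast
  show ?thesis
  proof (rule Bochner_Integration.integrable_bound)
    show "integrable half_line (\<lambda>t. K * (t powr (1 - 1) * exp (- t)))"
      by (intro integrable_mult_right integrable_Gamma_weight) simp
    show "f \<in> borel_measurable half_line"
      by (intro borel_measurable_half_line borel_measurable_continuous_onI c)
    show "AE t in half_line. norm (f t) \<le> norm (K * (t powr (1 - 1) * exp (- t)))"
    proof (rule AE_I2)
      fix t assume "t \<in> space half_line"
      then show "norm (f t) \<le> norm (K * (t powr (1 - 1) * exp (- t)))"
        using order_trans[OF K[of t] abs_ge_self] by simp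
    qed
  qed
qed

lemma rapid_tendsto_0:
  assumes "rapid f"
  shows "(f \<longlongrightarrow> 0) at_top"
proof -
  from assms obtain K where K: "\<And>t. t \<ge> 0 \<Longrightarrow> \<bar>f t\<bar> \<le> K * exp (- t)"
    unfolding rapid_def by blast
  show ?thesis
  proof (rule Lim_null_comparison)
    show "\<forall>\<^sub>F t in at_top. norm (f t) \<le> K * exp (- t)"
      using eventually_ge_at_top[of 0] by eventually_elim (use K in auto)
    show "((\<lambda>t. K * exp (- t)) \<longlongrightarrow> 0) at_top"
      by (intro tendsto_mult_right_zero filterlim_compose[OF exp_at_bot filterlim_uminus_at_bot_at_top])
  qed
qed

lemma rapid_add: "rapid f \<Longrightarrow> rapid g \<Longrightarrow> rapid (\<lambda>t. f t + g t)"
proof -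
  assume "rapid f" "rapid g"
  then obtain K L where "continuous_on UNIV f" "continuous_on UNIV g"
    and KL: "\<And>t. t \<ge> 0 \<Longrightarrow> \<bar>f t\<bar> \<le> K * exp (- t)" "\<And>t. t \<ge> 0 \<Longrightarrow> \<bar>g t\<bar> \<le> L * exp (- t)"
    unfolding rapid_def by blast
  moreover have "\<bar>f t + g t\<bar> \<le> (K + L) * exp (- t)" if "t \<ge> 0" for t
    using KL[OF that] by (simp add: distrib_right)
  ultimately show "rapid (\<lambda>t. f t + g t)"
    unfolding rapid_def by (blast intro: continuous_on_add)
qed

lemma rapid_cmult: "rapid f \<Longrightarrow> rapid (\<lambda>t. c * f t)"
proof -
  assume "rapid f"
  then obtain K where "continuous_on UNIV f"
    and K: "\<And>t. t \<ge> 0 \<Longrightarrow> \<bar>f t\<bar> \<le> K * exp (- t)"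
    unfolding rapid_def by blast
  moreover have "\<bar>c * f t\<bar> \<le> (\<bar>c\<bar> * K) * exp (- t)" if "t \<ge> 0" for t
    using mult_left_mono[OF K[OF that], of "\<bar>c\<bar>"] by (simp add: abs_mult mult_ac)
  ultimately show "rapid (\<lambda>t. c * f t)"
    unfolding rapid_def by (blast intro: continuous_on_mult_left)
qed

lemma rapid_diff: "rapid f \<Longrightarrow> rapid g \<Longrightarrow> rapid (\<lambda>t. f t - g t)"
  using rapid_add[of f "\<lambda>t. - 1 * g t"] rapid_cmult[of g "- 1"] by simp

text \<open>
  The case \<open>k = 1\<close> is \<open>x \<le> exp x\<close>; the general one is its \<open>k\<close>-th power at \<open>x / k\<close>.
\<close>
lemma power_le_const_exp: "x \<ge> 0 \<Longrightarrow> x ^ k \<le> real k ^ k * exp x" for x :: real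
proof (cases "k = 0")
  case False
  assume x: "x \<ge> 0"
  have "x / real k \<le> exp (x / real k)"
    using exp_ge_add_one_self[of "x / real k"] by linarith
  then have "(x / real k) ^ k \<le> exp (x / real k) ^ k"
    using x by (intro power_mono) auto
  also have "\<dots> = exp x"
    using False by (simp add: exp_of_nat_mult[symmetric])
  finally show ?thesis
    using False by (simp add: power_divide field_simps)
qed simp

lemma rapid_mult:
  assumes "rapid f" "rapid g"
  shows "rapid (\<lambda>t. (t - \<xi>) ^ k * (f t * g t))"
proof -
  from assms obtain K L where c: "continuous_on UNIV f" "continuous_on UNIV g"
    and KL: "\<And>t. t \<ge> 0 \<Longrightarrow> \<bar>f t\<bar> \<le> K * exp (- t)" "\<And>t. t \<ge> 0 \<Longrightarrow> \<bar>g t\<bar> \<le> L * exp (- t)"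
    unfolding rapid_def by blast
  have "\<bar>(t - \<xi>) ^ k * (f t * g t)\<bar> \<le> (real k ^ k * exp \<bar>\<xi>\<bar> * (K * L)) * exp (- t)" if t: "t \<ge> 0" for t
  proof -
    have "\<bar>t - \<xi>\<bar> ^ k \<le> real k ^ k * exp \<bar>t - \<xi>\<bar>" by (rule power_le_const_exp) simp
    also have "\<dots> \<le> real k ^ k * exp (\<bar>\<xi>\<bar> + t)" using t by (intro mult_left_mono) auto
    finally have "\<bar>t - \<xi>\<bar> ^ k * (\<bar>f t\<bar> * \<bar>g t\<bar>)
        \<le> (real k ^ k * exp (\<bar>\<xi>\<bar> + t)) * ((K * exp (- t)) * (L * exp (- t)))"
      using KL[OF t] by (intro mult_mono) (auto intro: order_trans[OF abs_ge_zero])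
    also have "\<dots> = (real k ^ k * exp \<bar>\<xi>\<bar> * (K * L)) * exp (- t)"
      by (simp add: exp_add exp_minus field_simps)
    finally show ?thesis by (simp add: abs_mult power_abs)
  qed
  moreover have "continuous_on UNIV (\<lambda>t. (t - \<xi>) ^ k * (f t * g t))"
    using c by (intro continuous_intros)
  ultimately show ?thesis unfolding rapid_def by blast
qed

lemma rapid_mult': "rapid f \<Longrightarrow> rapid g \<Longrightarrow> rapid (\<lambda>t. f t * g t)"
  using rapid_mult[of f g 0 0] by simp

lemma integral_half_line_rapid_derivative:
  assumes "rapid F" "rapid f" "\<And>t. (F has_real_derivative f t) (at t)"
  shows "(LINT t|half_line. f t) = - F 0"
proof -
  have "(F \<longlongrightarrow> F 0) (at_right 0)"
    using assms(1) unfolding rapid_def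
    by (metis UNIV_I continuous_on_def tendsto_within_subset subset_UNIV)
  moreover have "isCont f t" for t
    using assms(2) unfolding rapid_def by (simp add: continuous_on_eq_continuous_at)
  ultimately show ?thesis
    using integral_half_line_FTC[OF assms(3) _ rapid_integrable[OF assms(2)] _ rapid_tendsto_0[OF assms(1)]]
    by simp
qed

text \<open>
  A common description of the Weber functions, where \<open>E < 1\<close>, and of their limiting case \<open>E = 1\<close>, the Gaussian.
\<close>
definition decaying_solution :: "real \<Rightarrow> (real \<Rightarrow> real) \<Rightarrow> (real \<Rightarrow> real) \<Rightarrow> bool" where
  "decaying_solution E w w' \<longleftrightarrow>
     (\<forall>s. w s > 0 \<and> (w has_real_derivative w' s) (at s)
        \<and> (w' has_real_derivative (s\<^sup>2 - E) * w s) (at s)) \<and>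
     (\<forall>\<xi>. rapid (\<lambda>t. w (t - \<xi>)) \<and> rapid (\<lambda>t. w' (t - \<xi>)))"

lemma decaying_solution_weber:
  assumes "a > 0"
  shows "decaying_solution (1 - 2 * a) (weber a) (weber' a)"
  unfolding decaying_solution_def
proof (intro conjI allI)
  fix \<xi> :: real
  obtain K where K: "\<And>t. t \<ge> 0 \<Longrightarrow> \<bar>weber a (t - \<xi>)\<bar> \<le> K * exp (- t)"
    "\<And>t. t \<ge> 0 \<Longrightarrow> \<bar>weber' a (t - \<xi>)\<bar> \<le> K * exp (- t)"
    using weber_decay[OF assms] by blast
  have "isCont (\<lambda>t. weber a (t - \<xi>)) t" "isCont (\<lambda>t. weber' a (t - \<xi>)) t" for t
    by (rule isCont_o2[OF _ DERIV_isCont[OF weber_has_derivative[OF assms]]], simp)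
      (rule isCont_o2[OF _ DERIV_isCont[OF weber'_has_derivative[OF assms]]], simp)
  then have "continuous_on UNIV (\<lambda>t. weber a (t - \<xi>))" "continuous_on UNIV (\<lambda>t. weber' a (t - \<xi>))"
    by (simp_all add: continuous_at_imp_continuous_on)
  then show "rapid (\<lambda>t. weber a (t - \<xi>))" "rapid (\<lambda>t. weber' a (t - \<xi>))"
    unfolding rapid_def by (auto intro!: exI[of _ K] K)
qed (simp_all add: weber_pos weber_has_derivative weber'_has_derivative assms)

lemma decaying_solution_gaussian:
  "decaying_solution 1 (\<lambda>s. exp (- s\<^sup>2 / 2)) (\<lambda>s. - s * exp (- s\<^sup>2 / 2))"
  unfolding decaying_solution_def
proof (intro conjI allI)
  fix \<xi> :: real
  have q: "exp (- s\<^sup>2 / 2) \<le> exp 2 * exp (- s)" "\<bar>s\<bar> * exp (- s\<^sup>2 / 2) \<le> exp 2 * exp (- s)" for s :: real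
  proof -
    have "0 \<le> (\<bar>s\<bar> - 2)\<^sup>2" by simp
    then have "- s\<^sup>2 / 2 + 2 * \<bar>s\<bar> \<le> 2" by (simp add: power2_diff)
    then have *: "\<bar>s\<bar> + - s\<^sup>2 / 2 \<le> 2 + - s" by linarith
    have sa: "\<bar>s\<bar> \<le> exp \<bar>s\<bar>" using exp_ge_add_one_self[of "\<bar>s\<bar>"] by linarith
    from * show "exp (- s\<^sup>2 / 2) \<le> exp 2 * exp (- s)" unfolding exp_add[symmetric] by simp
    have "\<bar>s\<bar> * exp (- s\<^sup>2 / 2) \<le> exp \<bar>s\<bar> * exp (- s\<^sup>2 / 2)"
      by (intro mult_right_mono sa) simp
    also have "\<dots> \<le> exp 2 * exp (- s)" using * unfolding exp_add[symmetric] by simp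
    finally show "\<bar>s\<bar> * exp (- s\<^sup>2 / 2) \<le> exp 2 * exp (- s)" .
  qed
  have e: "exp 2 * exp (- (t - \<xi>)) = exp (2 + \<xi>) * exp (- t)" for t
    unfolding exp_add[symmetric] by simp
  have "\<bar>exp (- (t - \<xi>)\<^sup>2 / 2)\<bar> \<le> exp (2 + \<xi>) * exp (- t)"
    "\<bar>- (t - \<xi>) * exp (- (t - \<xi>)\<^sup>2 / 2)\<bar> \<le> exp (2 + \<xi>) * exp (- t)" for t
    using q[of "t - \<xi>"] unfolding e by (simp_all only: abs_mult abs_minus_cancel abs_exp_cancel)
  then show "rapid (\<lambda>t. exp (- (t - \<xi>)\<^sup>2 / 2))" "rapid (\<lambda>t. - (t - \<xi>) * exp (- (t - \<xi>)\<^sup>2 / 2))"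
    unfolding rapid_def by (intro conjI continuous_intros exI[of _ "exp (2 + \<xi>)"]; simp)+
qed (auto intro!: derivative_eq_intros simp: power2_eq_square algebra_simps)

lemma decaying_solution_shift_derivative:
  assumes "decaying_solution E w w'"
  shows "((\<lambda>t. w (t - \<xi>)) has_real_derivative w' (t - \<xi>)) (at t)"
    and "((\<lambda>t. w' (t - \<xi>)) has_real_derivative ((t - \<xi>)\<^sup>2 - E) * w (t - \<xi>)) (at t)"
proof -
  have "(w has_real_derivative w' (t - \<xi>)) (at (t + - \<xi>))"
    "(w' has_real_derivative ((t - \<xi>)\<^sup>2 - E) * w (t - \<xi>)) (at (t + - \<xi>))"
    using assms unfolding decaying_solution_def by auto
  then show "((\<lambda>t. w (t - \<xi>)) has_real_derivative w' (t - \<xi>)) (at t)"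
    "((\<lambda>t. w' (t - \<xi>)) has_real_derivative ((t - \<xi>)\<^sup>2 - E) * w (t - \<xi>)) (at t)"
    unfolding DERIV_shift by simp_all
qed

lemma decaying_solution_imp_eigenfunction:
  assumes w: "decaying_solution E w w'" and N: "w' (- \<xi>) = 0"
  shows "de_gennes_eigenfunction \<xi> E (\<lambda>t. w (t - \<xi>))"
proof -
  note d = decaying_solution_shift_derivative[OF w, of \<xi>]
  have r: "rapid (\<lambda>t. w (t - \<xi>))" using w by (simp add: decaying_solution_def)
  then have c: "continuous_on UNIV (\<lambda>t. w (t - \<xi>))" by (simp add: rapid_def)
  have L: "(\<lambda>t. k * w (t - \<xi>)) \<in> L2 half_line" for k
  proof -
    have "rapid (\<lambda>t. k * w (t - \<xi>))" by (rule rapid_cmult[OF r])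
    then have "integrable half_line (\<lambda>t. (k * w (t - \<xi>)) * (k * w (t - \<xi>)))"
      using rapid_integrable rapid_mult' by blast
    moreover have "(\<lambda>t. k * w (t - \<xi>)) \<in> borel_measurable half_line"
      by (intro borel_measurable_half_line borel_measurable_continuous_onI continuous_intros c)
    ultimately show ?thesis by (simp add: L2_def power2_eq_square)
  qed
  have "w' (t - \<xi>) = (LBINT s:{0..t}. (s - \<xi>)\<^sup>2 * w (s - \<xi>) - E * w (s - \<xi>))" if "t \<ge> 0" for t
  proof -
    have "(LBINT s:{0..t}. ((s - \<xi>)\<^sup>2 - E) * w (s - \<xi>)) = w' (t - \<xi>) - w' (0 - \<xi>)"
      unfolding set_lebesgue_integral_def
    proof (rule integral_FTC_Icc[OF that])
      show "continuous_on {0..t} (\<lambda>s. ((s - \<xi>)\<^sup>2 - E) * w (s - \<xi>))"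
        by (intro continuous_intros continuous_on_subset[OF c]) auto
    qed (use d(2) has_real_derivative_iff_has_vector_derivative has_vector_derivative_at_within in blast)
    then show ?thesis using N by (simp add: left_diff_distrib)
  qed
  then have "de_gennes \<xi> (\<lambda>t. w (t - \<xi>)) (\<lambda>t. E * w (t - \<xi>))"
    unfolding de_gennes_def using L[of 1] L[of E]
    by (intro conjI exI[of _ "\<lambda>t. w' (t - \<xi>)"] allI impI has_field_derivative_at_within[OF d(1)]) auto
  moreover have "w (0 - \<xi>) \<noteq> 0"
    using w unfolding decaying_solution_def by (metis less_irrefl)
  ultimately show ?thesis unfolding de_gennes_eigenfunction_def by blast
qed

text \<open>
  The integral formula in the definition of the operator turns an eigenfunction into a classical solution
  of the differential equation that is continuous up to the boundary.
\<close>
lemma eigenfunction_ode: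
  assumes "de_gennes_eigenfunction \<xi> E u"
  obtains u' where "u' 0 = 0" "continuous_on {0..} u" "continuous_on {0..} u'"
    "\<And>t. t > 0 \<Longrightarrow> (u has_real_derivative u' t) (at t)"
    "\<And>t. t > 0 \<Longrightarrow> (u' has_real_derivative ((t - \<xi>)\<^sup>2 - E) * u t) (at t)"
proof -
  from assms obtain u' where
    d: "\<And>t. t \<ge> 0 \<Longrightarrow> (u has_real_derivative u' t) (at t within {0..})" and
    i: "\<And>t. t \<ge> 0 \<Longrightarrow> u' t = (LBINT s:{0..t}. (s - \<xi>)\<^sup>2 * u s - E * u s)"
    unfolding de_gennes_eigenfunction_def de_gennes_def by blast
  have c: "continuous_on {0..} u"
    using d by (meson atLeast_iff DERIV_continuous continuous_on_eq_continuous_within)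
  let ?g = "\<lambda>s. ((s - \<xi>)\<^sup>2 - E) * u s"
  have cg: "continuous_on {0..} ?g"
    by (intro continuous_intros c)
  have i': "u' t = integral {0..t} ?g" if "t \<ge> 0" for t
  proof -
    have "set_integrable lborel {0..t} ?g"
      by (intro borel_integrable_atLeastAtMost' continuous_on_subset[OF cg]) auto
    then show ?thesis
      using i[OF that] by (simp add: set_borel_integral_eq_integral(2) left_diff_distrib[symmetric])
  qed
  have dI: "((\<lambda>x. integral {0..x} ?g) has_real_derivative ?g t) (at t within {0..T})" if "t \<in> {0..T}" for t T
    using that by (intro integral_has_real_derivative continuous_on_subset[OF cg]) auto
  have dT: "(u' has_real_derivative ?g t) (at t within {0..T})" if "t \<in> {0..T}" for t T
    using dI[OF that] by (rule has_field_derivative_transform_within[of _ _ _ _ 1]) (use that i' in auto)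
  show thesis
  proof
    show "u' 0 = 0" using i'[of 0] by simp
    show "continuous_on {0..} u'"
      unfolding continuous_on_eq_continuous_within
    proof
      fix t :: real assume t: "t \<in> {0..}"
      have "continuous (at t within {0..t + 1}) u'"
        using DERIV_continuous[OF dT[of t "t + 1"]] t by auto
      moreover have "at t within {0..t + 1} = at t within {0..}"
        using t by (intro at_within_nhd[of t "{..<t + 1}"]) auto
      ultimately show "continuous (at t within {0..}) u'" by simp
    qed
    fix t :: real assume t: "t > 0"
    show "(u has_real_derivative u' t) (at t)"
      using DERIV_subset[OF d[of t], of "{0..t + 1}"] t at_within_Icc_at[of 0 t "t + 1"] by simp
    show "(u' has_real_derivative ?g t) (at t)"
      using dT[of t "t + 1"] t at_within_Icc_at[of 0 t "t + 1"] by simp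
  qed (rule c)
qed

lemma not_L2_if_bounded_below:
  fixes u :: "real \<Rightarrow> real"
  assumes L: "u \<in> L2 half_line" and "T \<ge> 0" "c > 0" "\<And>t. t \<ge> T \<Longrightarrow> c \<le> (u t)\<^sup>2"
  shows False
proof -
  have i: "integrable half_line (\<lambda>t. (u t)\<^sup>2)" using L by (simp add: L2_def)
  have le: "c * real n \<le> (LINT t|half_line. (u t)\<^sup>2)" for n
  proof -
    have "integrable lborel (\<lambda>t. c * indicat_real {T<..T + real n} t)"
      by simp
    then have j: "set_integrable lborel {0<..} (\<lambda>t. c * indicat_real {T<..T + real n} t)"
      unfolding set_integrable_def
      by (rule Bochner_Integration.integrable_bound) (auto split: split_indicator)
    have "(LINT t|half_line. c * indicator {T<..T + real n} t)
        = (LBINT t. c * indicator {T<..T + real n} t)"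
      unfolding integral_half_line set_lebesgue_integral_def
      using \<open>T \<ge> 0\<close> by (intro Bochner_Integration.integral_cong) (auto simp: indicator_def)
    also have "\<dots> = c * real n" by simp
    finally have "c * real n = (LINT t|half_line. c * indicator {T<..T + real n} t)" by (rule sym)
    also have "\<dots> \<le> (LINT t|half_line. (u t)\<^sup>2)"
      using assms by (intro integral_mono i) (use j in \<open>auto simp: integrable_half_line_iff split: split_indicator\<close>)
    finally show ?thesis .
  qed
  obtain n where "(LINT t|half_line. (u t)\<^sup>2) / c < real n" using reals_Archimedean2 by blast
  with le[of n] \<open>c > 0\<close> show False by (simp add: field_simps)
qed

text \<open>
  If \<open>E < 0\<close>, then \<open>(u u')' = u'\<^sup>2 + ((t - \<xi>)\<^sup>2 - E) u\<^sup>2 \<ge> 0\<close> and \<open>u'(0) = 0\<close>, so \<open>u\<^sup>2\<close> is nondecreasing and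
  \<open>u\<close> is not square-integrable.
\<close>
lemma eigenvalue_nonneg:
  assumes e: "de_gennes_eigenfunction \<xi> E u"
  shows "E \<ge> 0"
proof (rule ccontr)
  assume "\<not> E \<ge> 0"
  then have E: "E < 0" by simp
  obtain u' where u: "u' 0 = 0" "continuous_on {0..} u" "continuous_on {0..} u'"
    "\<And>t. t > 0 \<Longrightarrow> (u has_real_derivative u' t) (at t)"
    "\<And>t. t > 0 \<Longrightarrow> (u' has_real_derivative ((t - \<xi>)\<^sup>2 - E) * u t) (at t)"
    using eigenfunction_ode[OF e] by blast
  have v: "u t * u' t \<ge> 0" if "t \<ge> 0" for t
  proof -
    have "u 0 * u' 0 \<le> u t * u' t"
    proof (rule DERIV_nonneg_imp_increasing_open[OF that])
      fix x assume x: "0 < x" "x < t"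
      have "((\<lambda>t. u t * u' t) has_real_derivative u' x * u' x + ((x - \<xi>)\<^sup>2 - E) * (u x * u x)) (at x)"
        using x by (auto intro!: derivative_eq_intros u(4,5) simp: algebra_simps)
      moreover have "0 \<le> u' x * u' x + ((x - \<xi>)\<^sup>2 - E) * (u x * u x)"
        using E by (intro add_nonneg_nonneg mult_nonneg_nonneg[OF _ zero_le_square])
          (auto intro: order_trans[OF less_imp_le])
      ultimately show "\<exists>y. ((\<lambda>t. u t * u' t) has_real_derivative y) (at x) \<and> 0 \<le> y" by blast
    next
      show "continuous_on {0..t} (\<lambda>t. u t * u' t)"
        by (intro continuous_intros continuous_on_subset[OF u(2)] continuous_on_subset[OF u(3)]) auto
    qed
    with u(1) show ?thesis by simp
  qed
  obtain T where T: "T \<ge> 0" "u T \<noteq> 0" using e unfolding de_gennes_eigenfunction_def by blast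
  have "(u T)\<^sup>2 \<le> (u t)\<^sup>2" if "t \<ge> T" for t
  proof (rule DERIV_nonneg_imp_increasing_open[OF that])
    fix x assume x: "T < x" "x < t"
    have "((\<lambda>t. (u t)\<^sup>2) has_real_derivative 2 * (u x * u' x)) (at x)"
      using x T by (auto intro!: derivative_eq_intros u(4) simp: algebra_simps)
    then show "\<exists>y. ((\<lambda>t. (u t)\<^sup>2) has_real_derivative y) (at x) \<and> 0 \<le> y"
      using v[of x] x T by (intro exI[of _ "2 * (u x * u' x)"]) auto
  next
    show "continuous_on {T..t} (\<lambda>t. (u t)\<^sup>2)"
      using T by (intro continuous_intros continuous_on_subset[OF u(2)]) auto
  qed
  then show False
    using e T by (intro not_L2_if_bounded_below[of u T "(u T)\<^sup>2"])
      (auto simp: de_gennes_eigenfunction_def de_gennes_def)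
qed

text \<open>
  Nonnegativity of the eigenvalues makes the infimum that defines \<open>mu\<close> a genuine lower bound.
\<close>
lemma mu_le:
  assumes "de_gennes_eigenfunction \<xi> E u"
  shows "mu \<xi> \<le> E"
  unfolding mu_def using assms
  by (intro cInf_lower bdd_belowI[of _ 0]) (auto intro: eigenvalue_nonneg)

text \<open>
  For large \<open>t\<close> a positive eigenfunction is convex, and being square-integrable it must be decreasing. So it is
  bounded together with its derivative, and the Wronskian with a decaying solution, which is constant,
  tends to zero. Hence the two solutions are proportional.
\<close>
lemma positive_eigenfunction_eq_decaying_solution:
  assumes e: "de_gennes_eigenfunction \<xi> E \<phi>" and pos: "\<And>t. t > 0 \<Longrightarrow> \<phi> t > 0"
    and w: "decaying_solution E w w'"
  obtains c where "c > 0" "\<And>t. t \<ge> 0 \<Longrightarrow> \<phi> t = c * w (t - \<xi>)" "w' (- \<xi>) = 0"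
proof -
  obtain \<phi>' where \<phi>: "\<phi>' 0 = 0" "continuous_on {0..} \<phi>" "continuous_on {0..} \<phi>'"
    "\<And>t. t > 0 \<Longrightarrow> (\<phi> has_real_derivative \<phi>' t) (at t)"
    "\<And>t. t > 0 \<Longrightarrow> (\<phi>' has_real_derivative ((t - \<xi>)\<^sup>2 - E) * \<phi> t) (at t)"
    using eigenfunction_ode[OF e] by blast
  have L2: "\<phi> \<in> L2 half_line" using e by (simp add: de_gennes_eigenfunction_def de_gennes_def)
  define v where "v t = w (t - \<xi>)" for t
  define v' where "v' t = w' (t - \<xi>)" for t
  have d: "(v has_real_derivative v' t) (at t)"
    "(v' has_real_derivative ((t - \<xi>)\<^sup>2 - E) * v t) (at t)" for t
    unfolding v_def v'_def by (rule decaying_solution_shift_derivative[OF w])+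
  have vpos: "v t > 0" for t using w by (simp add: decaying_solution_def v_def)
  have lim: "(v \<longlongrightarrow> 0) at_top" "(v' \<longlongrightarrow> 0) at_top"
    using w unfolding decaying_solution_def v_def[abs_def] v'_def[abs_def]
    by (auto intro: rapid_tendsto_0)
  have cv: "continuous_on A v" "continuous_on A v'" for A
    using d by (auto intro!: continuous_at_imp_continuous_on DERIV_isCont)
  \<comment> \<open>Beyond \<open>T\<close> the solutions are convex where they are positive.\<close>
  define T where "T = max 1 (\<xi> + \<bar>E\<bar> + 1)"
  have T: "T > 0" and q: "(t - \<xi>)\<^sup>2 - E \<ge> 0" if "t \<ge> T" for t
  proof -
    have a: "\<bar>E\<bar> + 1 \<le> t - \<xi>" using that by (simp add: T_def)
    then have "(\<bar>E\<bar> + 1)\<^sup>2 \<le> (t - \<xi>)\<^sup>2" by (intro power_mono) auto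
    moreover have "\<bar>E\<bar> \<le> (\<bar>E\<bar> + 1)\<^sup>2" by (simp add: power2_eq_square algebra_simps)
    ultimately show "(t - \<xi>)\<^sup>2 - E \<ge> 0" by linarith
  qed (simp add: T_def)
  have T0: "T > 0" by (simp add: T_def)
  have mono: "\<phi>' s \<le> \<phi>' t" if "T \<le> s" "s \<le> t" for s t
  proof (rule DERIV_nonneg_imp_increasing_open[OF that(2)])
    fix x assume "s < x" "x < t"
    then show "\<exists>y. (\<phi>' has_real_derivative y) (at x) \<and> 0 \<le> y"
      using \<phi>(5)[of x] q[of x] pos[of x] that T0
      by (intro exI[of _ "((x - \<xi>)\<^sup>2 - E) * \<phi> x"]) (auto intro!: mult_nonneg_nonneg)
  next
    show "continuous_on {s..t} \<phi>'" using that T0 by (intro continuous_on_subset[OF \<phi>(3)]) auto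
  qed
  have neg: "\<phi>' s \<le> 0" if s: "T \<le> s" for s
  proof (rule ccontr)
    assume "\<not> \<phi>' s \<le> 0"
    then have p: "\<phi>' t > 0" if "t \<ge> s" for t using mono[OF s that] by simp
    have "\<phi> s \<le> \<phi> t" if "s \<le> t" for t
    proof (rule DERIV_nonneg_imp_increasing_open[OF that])
      fix x assume "s < x" "x < t"
      then show "\<exists>y. (\<phi> has_real_derivative y) (at x) \<and> 0 \<le> y"
        using \<phi>(4)[of x] p[of x] s T0 by (intro exI[of _ "\<phi>' x"]) auto
    next
      show "continuous_on {s..t} \<phi>" using s T0 by (intro continuous_on_subset[OF \<phi>(2)]) auto
    qed
    then show False
      using s T0 pos[of s] L2
      by (intro not_L2_if_bounded_below[of \<phi> s "(\<phi> s)\<^sup>2"]) (auto intro!: power_mono)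
  qed
  have dec: "\<phi> t \<le> \<phi> T" if "T \<le> t" for t
  proof (rule DERIV_nonpos_imp_decreasing_open[OF that])
    fix x assume "T < x" "x < t"
    then show "\<exists>y. (\<phi> has_real_derivative y) (at x) \<and> y \<le> 0"
      using \<phi>(4)[of x] neg[of x] T0 by (intro exI[of _ "\<phi>' x"]) auto
  next
    show "continuous_on {T..t} \<phi>" using T0 by (intro continuous_on_subset[OF \<phi>(2)]) auto
  qed
  define W where "W t = \<phi> t * v' t - \<phi>' t * v t" for t
  have cW: "continuous_on {0..} W"
    unfolding W_def[abs_def] by (intro continuous_intros cv \<phi>)
  have const: "W t = W 0" if "t > 0" for t
  proof (rule DERIV_isconst_end[OF that])
    show "continuous_on {0..t} W" by (rule continuous_on_subset[OF cW]) auto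
    fix x assume "0 < x" "x < t"
    then show "(W has_real_derivative 0) (at x)"
      unfolding W_def[abs_def]
      by (auto intro!: derivative_eq_intros d \<phi>(4,5) simp: algebra_simps)
  qed
  have "(W \<longlongrightarrow> 0) at_top"
  proof (rule Lim_null_comparison)
    show "\<forall>\<^sub>F t in at_top. norm (W t) \<le> \<phi> T * \<bar>v' t\<bar> + \<bar>\<phi>' T\<bar> * \<bar>v t\<bar>"
      using eventually_ge_at_top[of T]
    proof eventually_elim
      fix t assume t: "T \<le> t"
      have "\<bar>\<phi> t\<bar> \<le> \<phi> T" using dec[OF t] pos[of t] T0 t by simp
      moreover have "\<bar>\<phi>' t\<bar> \<le> \<bar>\<phi>' T\<bar>" using neg[OF t] mono[of T t] t by simp
      ultimately have "\<bar>\<phi> t\<bar> * \<bar>v' t\<bar> + \<bar>\<phi>' t\<bar> * \<bar>v t\<bar> \<le> \<phi> T * \<bar>v' t\<bar> + \<bar>\<phi>' T\<bar> * \<bar>v t\<bar>"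
        by (intro add_mono mult_right_mono) auto
      moreover have "\<bar>W t\<bar> \<le> \<bar>\<phi> t\<bar> * \<bar>v' t\<bar> + \<bar>\<phi>' t\<bar> * \<bar>v t\<bar>"
        unfolding W_def abs_mult[symmetric] by (rule abs_triangle_ineq4)
      ultimately show "norm (W t) \<le> \<phi> T * \<bar>v' t\<bar> + \<bar>\<phi>' T\<bar> * \<bar>v t\<bar>" by simp
    qed
    show "((\<lambda>t. \<phi> T * \<bar>v' t\<bar> + \<bar>\<phi>' T\<bar> * \<bar>v t\<bar>) \<longlongrightarrow> 0) at_top"
      using lim by (auto intro!: tendsto_eq_intros)
  qed
  moreover have "(W \<longlongrightarrow> W 0) at_top"
    by (rule tendsto_eventually) (rule eventually_mono[OF eventually_gt_at_top[of 0] const])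
  ultimately have "W 0 = 0" using tendsto_unique trivial_limit_at_top_linorder by blast
  then have W0: "W t = 0" if "t \<ge> 0" for t using const[of t] that by (cases "t = 0") auto
  have ratio: "\<phi> t / v t = \<phi> 0 / v 0" if "t > 0" for t
  proof (rule DERIV_isconst_end[OF that])
    show "continuous_on {0..t} (\<lambda>t. \<phi> t / v t)"
      using vpos by (intro continuous_intros cv continuous_on_subset[OF \<phi>(2)]) (auto simp: less_imp_neq[symmetric])
    fix x assume x: "0 < x" "x < t"
    have "((\<lambda>t. \<phi> t / v t) has_real_derivative (\<phi>' x * v x - \<phi> x * v' x) / (v x * v x)) (at x)"
      using x vpos[of x] by (intro DERIV_divide d \<phi>(4)) auto
    then show "((\<lambda>t. \<phi> t / v t) has_real_derivative 0) (at x)"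
      using W0[of x] x by (simp add: W_def)
  qed
  define c where "c = \<phi> 0 / v 0"
  have eq: "\<phi> t = c * v t" if "t \<ge> 0" for t
    using ratio[of t] that vpos[of t] vpos[of 0] by (cases "t = 0") (auto simp: c_def field_simps)
  have c: "c > 0" using eq[of 1] pos[of 1] vpos[of 1] by (simp add: zero_less_mult_iff)
  show thesis
  proof
    show "c > 0" by (rule c)
    show "\<phi> t = c * w (t - \<xi>)" if "t \<ge> 0" for t using eq[OF that] by (simp add: v_def)
    show "w' (- \<xi>) = 0"
      using W0[of 0] \<phi>(1) eq[of 0] c vpos[of 0] by (simp add: W_def v'_def)
  qed
qed

lemma mu_0_le_1: "mu 0 \<le> 1"
  using decaying_solution_imp_eigenfunction[OF decaying_solution_gaussian, of 0] by (intro mu_le) auto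

text \<open>
  An energy \<open>\<Theta>\<^sub>0 < 1\<close> is of the form \<open>1 - 2 a\<close> with \<open>a > 0\<close>, so the ground state is a shifted Weber
  function \<open>w\<close> with \<open>w'(- \<xi>) = 0\<close>. The bound \<open>\<Theta>\<^sub>0 \<le> 1\<close> comes from the Gaussian, which is an eigenfunction for
  \<open>\<xi> = 0\<close>; equality would make the ground state a shifted Gaussian and violate the Neumann
  condition. If \<open>\<Theta>\<^sub>0\<close> were different from \<open>\<xi>\<^sup>2\<close>, then \<open>w''(- \<xi>) = (\<xi>\<^sup>2 - \<Theta>\<^sub>0) w(- \<xi>)\<close> would be nonzero, and \<open>w'\<close> would
  change sign at \<open>- \<xi>\<close>. For slightly larger \<open>a\<close>, that is, slightly smaller energy, the derivative of the Weber
  function would still have a zero \<open>x\<close>, and \<open>mu (- x)\<close> would be less than \<open>\<Theta>\<^sub>0\<close>.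
\<close>
lemma ground_state:
  assumes \<xi>: "\<xi> > 0" and min: "\<And>\<eta>. mu \<xi> \<le> mu \<eta>"
    and e: "de_gennes_eigenfunction \<xi> Theta0 \<phi>" and pos: "\<And>t. t > 0 \<Longrightarrow> \<phi> t > 0"
  obtains c w w' where "c > 0" "decaying_solution (\<xi>\<^sup>2) w w'" "w' (- \<xi>) = 0"
    "\<And>t. t \<ge> 0 \<Longrightarrow> \<phi> t = c * w (t - \<xi>)" "Theta0 = \<xi>\<^sup>2" "\<xi> < 1"
proof -
  have T: "Theta0 = mu \<xi>"
    unfolding Theta0_def using min by (intro cInf_eq_minimum) auto
  have "Theta0 \<le> 1" using T min[of 0] mu_0_le_1 by simp
  moreover have "Theta0 \<noteq> 1"
  proof
    assume "Theta0 = 1"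
    with e have "de_gennes_eigenfunction \<xi> 1 \<phi>" by simp
    then have "- (- \<xi>) * exp (- (- \<xi>)\<^sup>2 / 2) = (0::real)"
      by (rule positive_eigenfunction_eq_decaying_solution[OF _ pos decaying_solution_gaussian]) simp_all
    with \<xi> show False by simp
  qed
  ultimately have T1: "Theta0 < 1" by simp
  define a where "a = (1 - Theta0) / 2"
  have a: "a > 0" "Theta0 = 1 - 2 * a" using T1 by (simp_all add: a_def field_simps)
  note w = decaying_solution_weber[OF a(1)]
  obtain c where c: "c > 0" "\<And>t. t \<ge> 0 \<Longrightarrow> \<phi> t = c * weber a (t - \<xi>)" "weber' a (- \<xi>) = 0"
    using positive_eigenfunction_eq_decaying_solution[OF e pos w[folded a(2)]] by blast
  have "Theta0 = \<xi>\<^sup>2"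
  proof (rule ccontr)
    assume ne: "Theta0 \<noteq> \<xi>\<^sup>2"
    define D where "D = ((- \<xi>)\<^sup>2 - (1 - 2 * a)) * weber a (- \<xi>)"
    have D: "(weber' a has_real_derivative D) (at (- \<xi>))"
      unfolding D_def by (rule weber'_has_derivative[OF a(1)])
    have D0: "D \<noteq> 0" using ne a weber_pos[OF a(1), of "- \<xi>"] by (auto simp: D_def)
    have "\<exists>s r. s < r \<and> weber' a s * weber' a r < 0"
    proof (cases "D > 0")
      case True
      obtain d1 where "d1 > 0" "\<And>h. 0 < h \<Longrightarrow> h < d1 \<Longrightarrow> weber' a (- \<xi>) < weber' a (- \<xi> + h)"
        using DERIV_pos_inc_right[OF D True] by blast
      moreover obtain d2 where "d2 > 0" "\<And>h. 0 < h \<Longrightarrow> h < d2 \<Longrightarrow> weber' a (- \<xi> - h) < weber' a (- \<xi>)"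
        using DERIV_pos_inc_left[OF D True] by blast
      ultimately show ?thesis
        using c(3) by (intro exI[of _ "- \<xi> - d2 / 2"] exI[of _ "- \<xi> + d1 / 2"]) (auto simp: mult_less_0_iff)
    next
      case False
      with D0 have neg: "D < 0" by simp
      obtain d1 where "d1 > 0" "\<And>h. 0 < h \<Longrightarrow> h < d1 \<Longrightarrow> weber' a (- \<xi> + h) < weber' a (- \<xi>)"
        using DERIV_neg_dec_right[OF D neg] by blast
      moreover obtain d2 where "d2 > 0" "\<And>h. 0 < h \<Longrightarrow> h < d2 \<Longrightarrow> weber' a (- \<xi>) < weber' a (- \<xi> - h)"
        using DERIV_neg_dec_left[OF D neg] by blast
      ultimately show ?thesis
        using c(3) by (intro exI[of _ "- \<xi> - d2 / 2"] exI[of _ "- \<xi> + d1 / 2"]) (auto simp: mult_less_0_iff)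
    qed
    then obtain s r where sr: "s < r" "weber' a s * weber' a r < 0" by blast
    \<comment> \<open>a sequence of parameters decreasing to \<open>a\<close>, that is, of energies increasing to \<open>\<Theta>\<^sub>0\<close>\<close>
    define A where "A n = a + 1 / real (Suc n)" for n
    have A: "A n > a" for n by (simp add: A_def)
    have lim: "(\<lambda>n. weber' (A n) x) \<longlonglongrightarrow> weber' a x" for x
    proof -
      have "(\<lambda>n. hermite (A n) x) \<longlonglongrightarrow> hermite a x"
        using hermite_tendsto_parameter[OF a(1)] by (simp only: A_def)
      moreover have "(\<lambda>n. hermite (A n + 1) x) \<longlonglongrightarrow> hermite (a + 1) x"
        using hermite_tendsto_parameter[of "a + 1" x] a(1) by (simp add: A_def add_ac)
      ultimately show ?thesis
        unfolding weber'_def by (intro tendsto_intros)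
    qed
    have "(\<lambda>n. weber' (A n) s * weber' (A n) r) \<longlonglongrightarrow> weber' a s * weber' a r"
      by (intro tendsto_mult lim)
    then have "\<forall>\<^sub>F n in sequentially. weber' (A n) s * weber' (A n) r < 0"
      using sr(2) by (rule order_tendstoD)
    then obtain n where n: "weber' (A n) s * weber' (A n) r < 0"
      by (auto simp: eventually_sequentially)
    have An: "A n > 0" using A[of n] a(1) by linarith
    have cont: "isCont (weber' (A n)) x" for x
      using weber'_has_derivative[OF An] by (rule DERIV_isCont)
    have "\<exists>x. s \<le> x \<and> x \<le> r \<and> weber' (A n) x = 0"
    proof (cases "weber' (A n) s < 0")
      case True
      then show ?thesis
        using n sr(1) cont by (intro IVT) (auto simp: mult_less_0_iff)
    next
      case False
      then show ?thesis
        using n sr(1) cont by (intro IVT2) (auto simp: mult_less_0_iff)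
    qed
    then obtain x where x: "weber' (A n) x = 0" by blast
    have "mu (- x) \<le> 1 - 2 * A n"
      using decaying_solution_imp_eigenfunction[OF decaying_solution_weber[OF An], of "- x"] x
      by (intro mu_le) auto
    also have "\<dots> < Theta0" using A[of n] a(2) by simp
    finally show False using T min[of "- x"] by simp
  qed
  moreover from this T1 have "\<xi> < 1" using power_less_imp_less_base[of \<xi> 2 1] by simp
  ultimately show thesis
    using that[of c "weber a" "weber' a"] c w a(2) by simp
qed

section \<open>Moments of the ground state\<close>

locale normalized_ground_state =
  fixes \<xi> c :: real and w w' :: "real \<Rightarrow> real"
  assumes xi_pos: "\<xi> > 0" and c_pos: "c > 0"
    and solution: "decaying_solution (\<xi>\<^sup>2) w w'"
    and neumann: "w' (- \<xi>) = 0"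
    and normalized: "(LINT t|half_line. (c * w (t - \<xi>))\<^sup>2) = 1"
begin

definition \<phi> :: "real \<Rightarrow> real" where "\<phi> t = c * w (t - \<xi>)"
definition \<phi>' :: "real \<Rightarrow> real" where "\<phi>' t = c * w' (t - \<xi>)"

text \<open>
  The only datum besides \<open>\<xi>\<close> on which the low moments depend; it equals \<open>3 C\<^sub>1\<close>.
\<close>
definition boundary_sq :: real where "boundary_sq = (\<phi> 0)\<^sup>2"

definition value_moment :: "nat \<Rightarrow> real" where "value_moment k = (LINT t|half_line. (t - \<xi>) ^ k * (\<phi> t * \<phi> t))"
definition mixed_moment :: "nat \<Rightarrow> real" where "mixed_moment k = (LINT t|half_line. (t - \<xi>) ^ k * (\<phi> t * \<phi>' t))"
definition slope_moment :: "nat \<Rightarrow> real" where "slope_moment k = (LINT t|half_line. (t - \<xi>) ^ k * (\<phi>' t * \<phi>' t))"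

lemma \<phi>_pos: "\<phi> t > 0"
  using solution c_pos by (simp add: \<phi>_def decaying_solution_def)

lemma boundary_sq_pos: "boundary_sq > 0"
  using \<phi>_pos[of 0] by (simp add: boundary_sq_def)

lemma \<phi>'_0: "\<phi>' 0 = 0"
  using neumann by (simp add: \<phi>'_def)

lemma \<phi>_derivative: "(\<phi> has_real_derivative \<phi>' t) (at t)"
  unfolding \<phi>_def[abs_def] \<phi>'_def by (intro DERIV_cmult decaying_solution_shift_derivative[OF solution])

lemma \<phi>'_derivative: "(\<phi>' has_real_derivative ((t - \<xi>)\<^sup>2 - \<xi>\<^sup>2) * \<phi> t) (at t)"
  using DERIV_cmult[OF decaying_solution_shift_derivative(2)[OF solution, of \<xi> t], of c]
  by (simp add: \<phi>_def \<phi>'_def[abs_def] mult_ac)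

lemma rapid_\<phi>: "rapid \<phi>" and rapid_\<phi>': "rapid \<phi>'"
  using solution unfolding \<phi>_def[abs_def] \<phi>'_def[abs_def] decaying_solution_def
  by (simp_all add: rapid_cmult)

lemmas rapid_products = rapid_mult[OF rapid_\<phi> rapid_\<phi>, of \<xi>] rapid_mult[OF rapid_\<phi> rapid_\<phi>', of \<xi>]
  rapid_mult[OF rapid_\<phi>' rapid_\<phi>', of \<xi>]

lemmas integrable_products = rapid_products[THEN rapid_integrable]

text \<open>
  This and the next two lemmas integrate the derivatives of \<open>(t - \<xi>)\<^sup>k \<phi>\<^sup>2\<close>, \<open>(t - \<xi>)\<^sup>k \<phi> \<phi>'\<close> and \<open>(t - \<xi>)\<^sup>k \<phi>'\<^sup>2\<close>.
  The boundary terms at infinity vanish by decay, and those at zero with a factor \<open>\<phi>'\<close> by the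
  Neumann condition. For \<open>k = 0\<close> the first term drops out, whatever \<open>k - 1\<close> means.
\<close>
lemma derivative_identity_value: "real k * value_moment (k - 1) + 2 * mixed_moment k = - ((- \<xi>) ^ k * boundary_sq)"
proof -
  let ?f = "\<lambda>t. real k * ((t - \<xi>) ^ (k - 1) * (\<phi> t * \<phi> t)) + 2 * ((t - \<xi>) ^ k * (\<phi> t * \<phi>' t))"
  have "(LINT t|half_line. ?f t) = - ((0 - \<xi>) ^ k * (\<phi> 0 * \<phi> 0))"
  proof (rule integral_half_line_rapid_derivative[OF rapid_products(1)])
    show "rapid ?f" by (intro rapid_add rapid_cmult rapid_products)
    show "((\<lambda>t. (t - \<xi>) ^ k * (\<phi> t * \<phi> t)) has_real_derivative ?f t) (at t)" for t
      by (auto intro!: derivative_eq_intros \<phi>_derivative simp: algebra_simps)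
  qed
  moreover have "(LINT t|half_line. ?f t) = real k * value_moment (k - 1) + 2 * mixed_moment k"
    unfolding value_moment_def mixed_moment_def by (simp add: integrable_products)
  ultimately show ?thesis by (simp add: boundary_sq_def power2_eq_square)
qed

lemma derivative_identity_mixed: "real k * mixed_moment (k - 1) + slope_moment k + value_moment (k + 2) - \<xi>\<^sup>2 * value_moment k = 0"
proof -
  let ?f = "\<lambda>t. real k * ((t - \<xi>) ^ (k - 1) * (\<phi> t * \<phi>' t)) + (t - \<xi>) ^ k * (\<phi>' t * \<phi>' t)
    + (t - \<xi>) ^ (k + 2) * (\<phi> t * \<phi> t) - \<xi>\<^sup>2 * ((t - \<xi>) ^ k * (\<phi> t * \<phi> t))"
  have "(LINT t|half_line. ?f t) = - ((0 - \<xi>) ^ k * (\<phi> 0 * \<phi>' 0))"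
  proof (rule integral_half_line_rapid_derivative[OF rapid_products(2)])
    show "rapid ?f" by (intro rapid_add rapid_diff rapid_cmult rapid_products)
    show "((\<lambda>t. (t - \<xi>) ^ k * (\<phi> t * \<phi>' t)) has_real_derivative ?f t) (at t)" for t
      by (auto intro!: derivative_eq_intros \<phi>_derivative \<phi>'_derivative
        simp: algebra_simps power_add power2_eq_square)
  qed
  moreover have "(LINT t|half_line. ?f t) = real k * mixed_moment (k - 1) + slope_moment k + value_moment (k + 2) - \<xi>\<^sup>2 * value_moment k"
    unfolding value_moment_def mixed_moment_def slope_moment_def by (simp add: integrable_products del: power_Suc add_2_eq_Suc')
  ultimately show ?thesis by (simp add: \<phi>'_0)
qed

lemma derivative_identity_slope: "real k * slope_moment (k - 1) + 2 * mixed_moment (k + 2) - 2 * \<xi>\<^sup>2 * mixed_moment k = - 0"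
proof -
  let ?f = "\<lambda>t. real k * ((t - \<xi>) ^ (k - 1) * (\<phi>' t * \<phi>' t)) + 2 * ((t - \<xi>) ^ (k + 2) * (\<phi> t * \<phi>' t))
    - 2 * \<xi>\<^sup>2 * ((t - \<xi>) ^ k * (\<phi> t * \<phi>' t))"
  have "(LINT t|half_line. ?f t) = - ((0 - \<xi>) ^ k * (\<phi>' 0 * \<phi>' 0))"
  proof (rule integral_half_line_rapid_derivative[OF rapid_products(3)])
    show "rapid ?f" by (intro rapid_add rapid_diff rapid_cmult rapid_products)
    show "((\<lambda>t. (t - \<xi>) ^ k * (\<phi>' t * \<phi>' t)) has_real_derivative ?f t) (at t)" for t
      by (auto intro!: derivative_eq_intros \<phi>_derivative \<phi>'_derivative
        simp: algebra_simps power_add power2_eq_square)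
  qed
  moreover have "(LINT t|half_line. ?f t) = real k * slope_moment (k - 1) + 2 * mixed_moment (k + 2) - 2 * \<xi>\<^sup>2 * mixed_moment k"
    unfolding mixed_moment_def slope_moment_def by (simp add: integrable_products del: power_Suc add_2_eq_Suc')
  ultimately show ?thesis by (simp add: \<phi>'_0)
qed

text \<open>
  The three families of identities form a linear system, which is triangular enough to be solved degree by
  degree. In particular \<open>\<xi>\<close> is the mean of the density \<open>\<phi>\<^sup>2\<close>.
\<close>
lemma moments:
  "value_moment 0 = 1" "value_moment 1 = 0" "value_moment 2 = \<xi>\<^sup>2 / 2"
  "mixed_moment 0 = - boundary_sq / 2" "mixed_moment 1 = (\<xi> * boundary_sq - 1) / 2" "mixed_moment 2 = - \<xi>\<^sup>2 * boundary_sq / 2"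
  "slope_moment 0 = \<xi>\<^sup>2 / 2" "slope_moment 1 = boundary_sq / 3" "slope_moment 2 = 5 / 8 - 5 / 8 * \<xi> * boundary_sq + \<xi> ^ 4 / 8"
proof -
  show m0: "value_moment 0 = 1"
    using normalized by (simp add: value_moment_def \<phi>_def power2_eq_square)
  show l0: "mixed_moment 0 = - boundary_sq / 2" using derivative_identity_value[of 0] by simp
  show l1: "mixed_moment 1 = (\<xi> * boundary_sq - 1) / 2" using derivative_identity_value[of 1] m0 by simp
  show l2: "mixed_moment 2 = - \<xi>\<^sup>2 * boundary_sq / 2" using derivative_identity_slope[of 0] l0 by (simp add: numeral_2_eq_2)
  show m1: "value_moment 1 = 0" using derivative_identity_value[of 2] l2 by simp
  have a: "3 * value_moment 2 + 2 * mixed_moment 3 = \<xi> ^ 3 * boundary_sq" "slope_moment 0 + 2 * mixed_moment 3 - 2 * \<xi>\<^sup>2 * mixed_moment 1 = 0" "slope_moment 0 + value_moment 2 - \<xi>\<^sup>2 = 0"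
    using derivative_identity_value[of 3] derivative_identity_slope[of 1] derivative_identity_mixed[of 0] m0
    by (simp_all add: numeral_eq_Suc)
  then show m2: "value_moment 2 = \<xi>\<^sup>2 / 2"
    unfolding l1 by (simp add: field_simps power2_eq_square power3_eq_cube)
  with a show n0: "slope_moment 0 = \<xi>\<^sup>2 / 2" by simp
  have b: "mixed_moment 0 + slope_moment 1 + value_moment 3 = 0" "2 * slope_moment 1 + 2 * mixed_moment 4 - 2 * \<xi>\<^sup>2 * mixed_moment 2 = 0" "4 * value_moment 3 + 2 * mixed_moment 4 = - (\<xi> ^ 4 * boundary_sq)"
    using derivative_identity_mixed[of 1] derivative_identity_slope[of 2] derivative_identity_value[of 4] m1
    by (simp_all add: numeral_eq_Suc)
  then show n1: "slope_moment 1 = boundary_sq / 3"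
    unfolding l0 l2 by (simp add: field_simps power2_eq_square power4_eq_xxxx)
  have d: "2 * mixed_moment 1 + slope_moment 2 + value_moment 4 - \<xi>\<^sup>2 * value_moment 2 = 0" "3 * slope_moment 2 + 2 * mixed_moment 5 - 2 * \<xi>\<^sup>2 * mixed_moment 3 = 0"
    "5 * value_moment 4 + 2 * mixed_moment 5 = \<xi> ^ 5 * boundary_sq"
    using derivative_identity_mixed[of 2] derivative_identity_slope[of 3] derivative_identity_value[of 5]
    by (simp_all add: numeral_eq_Suc)
  have l3: "mixed_moment 3 = \<xi> ^ 3 * boundary_sq / 2 - 3 / 4 * \<xi>\<^sup>2" using a(1) m2 by simp
  show "slope_moment 2 = 5 / 8 - 5 / 8 * \<xi> * boundary_sq + \<xi> ^ 4 / 8"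
  proof -
    have "\<xi> * boundary_sq - 1 + slope_moment 2 + value_moment 4 - \<xi> ^ 4 / 2 = 0"
      using d(1) unfolding l1 m2 by (simp add: field_simps power_numeral_reduce)
    moreover have "3 * slope_moment 2 + 2 * mixed_moment 5 - \<xi> ^ 5 * boundary_sq + 3 / 2 * \<xi> ^ 4 = 0"
      using d(2) unfolding l3 by (simp add: algebra_simps power_numeral_reduce)
    ultimately show ?thesis using d(3) by simp
  qed
qed

text \<open>
  Up to the turning point \<open>2 \<xi>\<close> the function is concave with vanishing initial slope, and beyond it the slope is
  increasing with limit zero.
\<close>
lemma \<phi>'_nonpos:
  assumes "t \<ge> 0"
  shows "\<phi>' t \<le> 0"
proof (cases "t \<le> 2 * \<xi>")
  case True
  have "\<phi>' t \<le> \<phi>' 0"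
  proof (rule DERIV_nonpos_imp_nonincreasing[OF assms])
    fix x assume x: "0 \<le> x" "x \<le> t"
    then have "x * (x - 2 * \<xi>) * \<phi> x \<le> 0"
      using True \<phi>_pos[of x] by (intro mult_nonpos_nonneg mult_nonneg_nonpos) auto
    then have "((x - \<xi>)\<^sup>2 - \<xi>\<^sup>2) * \<phi> x \<le> 0" by (simp add: power2_eq_square algebra_simps)
    then show "\<exists>z. (\<phi>' has_real_derivative z) (at x) \<and> z \<le> 0" using \<phi>'_derivative by blast
  qed
  then show ?thesis by (simp add: \<phi>'_0)
next
  case False
  have "\<phi>' t \<le> \<phi>' s" if "t \<le> s" for s
  proof (rule DERIV_nonneg_imp_nondecreasing[OF that])
    fix x assume x: "t \<le> x" "x \<le> s"
    then have "x * (x - 2 * \<xi>) * \<phi> x \<ge> 0"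
      using False assms \<phi>_pos[of x] by (intro mult_nonneg_nonneg) auto
    then have "((x - \<xi>)\<^sup>2 - \<xi>\<^sup>2) * \<phi> x \<ge> 0" by (simp add: power2_eq_square algebra_simps)
    then show "\<exists>z. (\<phi>' has_real_derivative z) (at x) \<and> 0 \<le> z" using \<phi>'_derivative by blast
  qed
  then show ?thesis
    by (intro tendsto_lowerbound[OF rapid_tendsto_0[OF rapid_\<phi>']] eventually_mono[OF eventually_ge_at_top[of t]]) auto
qed

text \<open>
  Integration of \<open>(t - 1 / \<phi>(0)\<^sup>2)\<^sup>2\<close> against the positive measure \<open>- (\<phi>\<^sup>2)' dt\<close>. The inequality says
  that a decreasing probability density of height \<open>\<phi>(0)\<^sup>2\<close> has at least the mean of the uniform one.
\<close>
lemma half_le_xi_boundary_sq: "1 / 2 \<le> \<xi> * boundary_sq"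
proof -
  \<comment> \<open>\<open>(t - \<xi> + a)\<^sup>2\<close> is the weight \<open>(t - 1 / \<phi>(0)\<^sup>2)\<^sup>2\<close>.\<close>
  define a where "a = \<xi> - 1 / boundary_sq"
  let ?f = "\<lambda>t. - ((t - \<xi>) ^ 2 * (\<phi> t * \<phi>' t)) - 2 * a * ((t - \<xi>) ^ 1 * (\<phi> t * \<phi>' t))
    - a\<^sup>2 * ((t - \<xi>) ^ 0 * (\<phi> t * \<phi>' t))"
  have "?f t \<ge> 0" if "t > 0" for t
  proof -
    have "(t - \<xi> + a)\<^sup>2 * (\<phi> t * \<phi>' t) \<le> 0"
      using \<phi>_pos[of t] \<phi>'_nonpos[of t] that by (intro mult_nonneg_nonpos) auto
    then show ?thesis by (simp add: power2_eq_square algebra_simps)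
  qed
  then have "0 \<le> (LINT t|half_line. ?f t)"
    by (intro integral_nonneg_AE AE_I2) simp
  also have "\<dots> = - mixed_moment 2 - 2 * a * mixed_moment 1 - a\<^sup>2 * mixed_moment 0"
    unfolding mixed_moment_def by (simp add: integrable_products del: power_0 power_one_right power_Suc0_right One_nat_def)
  also have "\<dots> = \<xi> - 1 / (2 * boundary_sq)"
    using boundary_sq_pos unfolding moments a_def by (simp add: field_simps power2_eq_square)
  finally show ?thesis using boundary_sq_pos by (simp add: field_simps)
qed

text \<open>
  The integral of \<open>(\<phi>' + (t - \<xi>) \<phi>)\<^sup>2\<close> is nonnegative.
\<close>
lemma one_minus_xi_square_le: "1 - \<xi>\<^sup>2 \<le> \<xi> * boundary_sq"
proof -
  let ?f = "\<lambda>t. (t - \<xi>) ^ 0 * (\<phi>' t * \<phi>' t) + 2 * ((t - \<xi>) ^ 1 * (\<phi> t * \<phi>' t)) + (t - \<xi>) ^ 2 * (\<phi> t * \<phi> t)"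
  have "?f t = (\<phi>' t + (t - \<xi>) * \<phi> t)\<^sup>2" for t by (simp add: power2_eq_square algebra_simps)
  then have "0 \<le> (LINT t|half_line. ?f t)" by simp
  also have "\<dots> = slope_moment 0 + 2 * mixed_moment 1 + value_moment 2"
    unfolding mixed_moment_def slope_moment_def value_moment_def
    by (simp add: integrable_products del: power_0 power_one_right power_Suc0_right One_nat_def)
  also have "\<dots> = \<xi>\<^sup>2 + \<xi> * boundary_sq - 1" unfolding moments by simp
  finally show ?thesis by simp
qed

text \<open>
  The energy density of the trial function in the boundary variable, divided by \<open>b\<close>, and below it the
  density of its squared norm; \<open>\<delta>\<close> measures by how much the angular momentum is off its optimal real value.
\<close>
definition numerator_density :: "real \<Rightarrow> real \<Rightarrow> real \<Rightarrow> real" where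
  "numerator_density h \<delta> t = ((1 - 2 * h * t) * \<phi>' t - h * \<phi> t)\<^sup>2 + (t - \<xi> - h * \<delta>)\<^sup>2 * (\<phi> t)\<^sup>2"

definition denominator_density :: "real \<Rightarrow> real \<Rightarrow> real" where
  "denominator_density h t = (1 - 2 * h * t) * (\<phi> t)\<^sup>2"

lemma integral_numerator_density:
  "integrable half_line (numerator_density h \<delta>)"
  "(LINT t|half_line. numerator_density h \<delta> t)
    = (\<xi>\<^sup>2 - boundary_sq / 3 * h) * (1 - 2 * h * \<xi>) + h\<^sup>2 * (\<delta>\<^sup>2 + 3 / 2 - \<xi> * boundary_sq / 2 + 5 / 2 * \<xi> ^ 4)"
proof -
  define r where "r = 1 - 2 * h * \<xi>"
  let ?f = "\<lambda>t. r\<^sup>2 * ((t - \<xi>) ^ 0 * (\<phi>' t * \<phi>' t)) - 4 * h * r * ((t - \<xi>) ^ 1 * (\<phi>' t * \<phi>' t))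
     + 4 * h\<^sup>2 * ((t - \<xi>) ^ 2 * (\<phi>' t * \<phi>' t)) - 2 * h * r * ((t - \<xi>) ^ 0 * (\<phi> t * \<phi>' t))
     + 4 * h\<^sup>2 * ((t - \<xi>) ^ 1 * (\<phi> t * \<phi>' t)) + (h\<^sup>2 + h\<^sup>2 * \<delta>\<^sup>2) * ((t - \<xi>) ^ 0 * (\<phi> t * \<phi> t))
     - 2 * h * \<delta> * ((t - \<xi>) ^ 1 * (\<phi> t * \<phi> t)) + (t - \<xi>) ^ 2 * (\<phi> t * \<phi> t)"
  have eq: "numerator_density h \<delta> = ?f"
  proof
    fix t
    define s where "s = t - \<xi>"
    have t: "t = s + \<xi>" by (simp add: s_def)
    show "numerator_density h \<delta> t = ?f t"
      unfolding numerator_density_def s_def[symmetric] r_def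
      unfolding t by (simp add: power2_eq_square algebra_simps)
  qed
  show "integrable half_line (numerator_density h \<delta>)"
    unfolding eq by (intro Bochner_Integration.integrable_add Bochner_Integration.integrable_diff
      integrable_mult_right integrable_products)
  have "(LINT t|half_line. numerator_density h \<delta> t) = r\<^sup>2 * slope_moment 0 - 4 * h * r * slope_moment 1 + 4 * h\<^sup>2 * slope_moment 2
     - 2 * h * r * mixed_moment 0 + 4 * h\<^sup>2 * mixed_moment 1 + (h\<^sup>2 + h\<^sup>2 * \<delta>\<^sup>2) * value_moment 0 - 2 * h * \<delta> * value_moment 1 + value_moment 2"
    unfolding eq mixed_moment_def slope_moment_def value_moment_def
    by (simp add: integrable_products del: power_0 power_one_right power_Suc0_right One_nat_def)
  also have "\<dots> = (\<xi>\<^sup>2 - boundary_sq / 3 * h) * (1 - 2 * h * \<xi>) + h\<^sup>2 * (\<delta>\<^sup>2 + 3 / 2 - \<xi> * boundary_sq / 2 + 5 / 2 * \<xi> ^ 4)"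
    unfolding moments r_def by (simp add: field_simps power_numeral_reduce)
  finally show "(LINT t|half_line. numerator_density h \<delta> t)
    = (\<xi>\<^sup>2 - boundary_sq / 3 * h) * (1 - 2 * h * \<xi>) + h\<^sup>2 * (\<delta>\<^sup>2 + 3 / 2 - \<xi> * boundary_sq / 2 + 5 / 2 * \<xi> ^ 4)" .
qed

lemma integral_denominator_density:
  "integrable half_line (denominator_density h)"
  "(LINT t|half_line. denominator_density h t) = 1 - 2 * h * \<xi>"
proof -
  have eq: "denominator_density h = (\<lambda>t. (1 - 2 * h * \<xi>) * ((t - \<xi>) ^ 0 * (\<phi> t * \<phi> t))
      - 2 * h * ((t - \<xi>) ^ 1 * (\<phi> t * \<phi> t)))"
    by (rule ext) (simp add: denominator_density_def power2_eq_square algebra_simps)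
  show "integrable half_line (denominator_density h)"
    unfolding eq by (intro Bochner_Integration.integrable_diff integrable_mult_right integrable_products)
  have "(LINT t|half_line. denominator_density h t) = (1 - 2 * h * \<xi>) * value_moment 0 - 2 * h * value_moment 1"
    unfolding eq value_moment_def
    by (simp add: integrable_products del: power_0 power_one_right power_Suc0_right One_nat_def)
  then show "(LINT t|half_line. denominator_density h t) = 1 - 2 * h * \<xi>"
    unfolding moments by simp
qed

end

section \<open>The trial energy\<close>

text \<open>
  The trial function need not be differentiable at the origin, but it has bounded partial derivatives
  elsewhere, because its energy density is bounded.
\<close>
lemma trial_weak_gradient:
  assumes b: "b > 0" and \<phi>: "\<And>t. (\<phi> has_real_derivative \<phi>' t) (at t)" and cy': "continuous_on UNIV \<phi>'"
  shows "weak_gradient (trial \<phi> b k) (trial_gradient \<phi> \<phi>' b k)"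
proof -
  have cy: "continuous_on UNIV \<phi>"
    using \<phi> by (blast intro: continuous_at_imp_continuous_on DERIV_isCont)
  have [measurable]: "\<phi> \<in> borel_measurable borel" "\<phi>' \<in> borel_measurable borel"
    by (rule borel_measurable_continuous_onI[OF cy], rule borel_measurable_continuous_onI[OF cy'])
  have comp: "continuous_on A (\<lambda>q. \<phi> (sqrt b * (1 - f q) / 2))" "continuous_on A (\<lambda>q. \<phi>' (sqrt b * (1 - f q) / 2))"
    if "continuous_on A f" for A and f :: "real \<Rightarrow> real"
    by (rule continuous_on_compose2[OF cy _ subset_UNIV], use that in \<open>auto intro!: continuous_intros\<close>)
      (rule continuous_on_compose2[OF cy' _ subset_UNIV], use that in \<open>auto intro!: continuous_intros\<close>)
  define M where "M q = q * (\<phi> (sqrt b * (1 - q) / 2))\<^sup>2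
    + ((\<phi> (sqrt b * (1 - q) / 2) - sqrt b * q * \<phi>' (sqrt b * (1 - q) / 2))\<^sup>2
      + (real k - b * q / 2)\<^sup>2 * (\<phi> (sqrt b * (1 - q) / 2))\<^sup>2)" for q
  have "continuous_on {0..1} M"
    unfolding M_def by (intro continuous_intros comp) simp_all
  then have "bounded (M ` {0..1})"
    by (rule compact_imp_bounded[OF compact_continuous_image[OF _ compact_Icc]])
  then obtain K where K: "\<And>q. q \<in> {0..1} \<Longrightarrow> norm (M q) \<le> K"
    unfolding bounded_iff by blast
  let ?u = "trial \<phi> b k"
  let ?g = "trial_gradient \<phi> \<phi>' b k"
  have small: "norm z \<le> 1 + K" if "(norm z)\<^sup>2 \<le> K" for z :: complex
  proof (rule power2_le_imp_le)
    have "0 \<le> K" using order_trans[OF zero_le_power2 that] .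
    then show "(norm z)\<^sup>2 \<le> (1 + K)\<^sup>2" "0 \<le> 1 + K"
      using that by (auto simp: power2_eq_square algebra_simps intro: order_trans add_nonneg_nonneg)
  qed
  have K0: "K \<ge> 0" using order_trans[OF norm_ge_zero K[of 0]] by simp
  have "norm (?u x) \<le> (1 + K) * (1 + b) \<and> norm (fst (?g x)) \<le> (1 + K) * (1 + b) \<and> norm (snd (?g x)) \<le> (1 + K) * (1 + b)"
    if "x \<in> ball 0 1" for x
  proof (cases "x = 0")
    case True
    then show ?thesis
      using b K0 by (simp add: trial_def trial_gradient_def trial_partial_def radial_profile_def radial_profile'_def)
  next
    case False
    define q where "q = (norm x)\<^sup>2"
    have q: "q \<in> {0..1}" using that by (auto simp: q_def abs_square_le_1)
    let ?m = "magnetic_gradient b ?u ?g x"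
    have "(norm (?u x))\<^sup>2 + ((norm (fst ?m))\<^sup>2 + (norm (snd ?m))\<^sup>2) \<le> K"
      unfolding norm_trial_square[OF False] norm_magnetic_gradient_trial[OF False]
      using K[OF q] by (simp add: M_def q_def)
    then have sq: "(norm (?u x))\<^sup>2 \<le> K" "(norm (fst ?m))\<^sup>2 \<le> K" "(norm (snd ?m))\<^sup>2 \<le> K"
      using zero_le_power2[of "norm (?u x)"] zero_le_power2[of "norm (fst ?m)"] zero_le_power2[of "norm (snd ?m)"]
      by linarith+
    have coord: "\<bar>fst x\<bar> \<le> 1" "\<bar>snd x\<bar> \<le> 1"
      using that norm_fst_le[of "fst x" "snd x"] norm_snd_le[of "snd x" "fst x"] by auto
    have bnd: "norm (\<i> * (v - of_real (b * r) * ?u x)) \<le> (1 + K) * (1 + b)"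
      if "(norm v)\<^sup>2 \<le> K" "\<bar>r\<bar> \<le> 1" for v :: complex and r
    proof -
      have "norm (\<i> * (v - of_real (b * r) * ?u x)) = norm (v - of_real (b * r) * ?u x)"
        by (simp only: norm_mult[of \<i>] norm_ii mult_1)
      also have "\<dots> \<le> norm v + norm (of_real (b * r) * ?u x)"
        by (rule norm_triangle_ineq4)
      also have "norm (of_real (b * r) * ?u x) \<le> b * 1 * (1 + K)"
        unfolding norm_mult norm_of_real abs_mult using b that(2) small[OF sq(1)] K0
        by (intro mult_mono) auto
      finally show ?thesis using small[OF that(1)] by (simp add: algebra_simps)
    qed
    have "fst (?g x) = \<i> * (fst ?m - of_real (b * fst (vec_pot x)) * ?u x)"
      "snd (?g x) = \<i> * (snd ?m - of_real (b * snd (vec_pot x)) * ?u x)"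
      by (simp_all add: magnetic_gradient_def)
    then have "norm (fst (?g x)) \<le> (1 + K) * (1 + b)" "norm (snd (?g x)) \<le> (1 + K) * (1 + b)"
      using bnd[OF sq(2), of "fst (vec_pot x)"] bnd[OF sq(3), of "snd (vec_pot x)"] coord
      by (simp_all add: vec_pot_def)
    moreover have "norm (?u x) \<le> (1 + K) * (1 + b)"
    proof (rule order_trans[OF small[OF sq(1)]])
      have "(1 + K) * 1 \<le> (1 + K) * (1 + b)"
        using K0 b by (intro mult_left_mono) auto
      then show "1 + K \<le> (1 + K) * (1 + b)" by (simp only: mult_1_right)
    qed
    ultimately show ?thesis by blast
  qed
  note bound = this
  have mz: "conj_coordinate \<in> borel_measurable borel"
    unfolding conj_coordinate_def[abs_def] by (intro borel_measurable_continuous_onI continuous_intros)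
  have mq: "(\<lambda>x::real \<times> real. (norm x)\<^sup>2) \<in> borel_measurable borel"
    by (intro borel_measurable_continuous_onI continuous_intros)
  have "radial_profile \<phi> b k \<in> borel_measurable borel" "radial_profile' \<phi> \<phi>' b k \<in> borel_measurable borel"
    unfolding radial_profile_def[abs_def] radial_profile'_def[abs_def] by measurable
  note mp = this[THEN measurable_compose[OF mq]]
  have mo: "(\<lambda>x. complex_of_real (f x)) \<in> borel_measurable borel"
    if "f \<in> borel_measurable borel" for f :: "real \<times> real \<Rightarrow> real"
    using that by measurable
  have mc: "(\<lambda>x::real \<times> real. 2 * fst x) \<in> borel_measurable borel"
    "(\<lambda>x::real \<times> real. 2 * snd x) \<in> borel_measurable borel"
    by (intro borel_measurable_continuous_onI continuous_intros)+
  have m: "?u \<in> borel_measurable borel" "(\<lambda>x. fst (?g x)) \<in> borel_measurable borel"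
    "(\<lambda>x. snd (?g x)) \<in> borel_measurable borel"
    unfolding trial_def[abs_def] trial_gradient_def trial_partial_def fst_conv snd_conv
    by (intro borel_measurable_times borel_measurable_add borel_measurable_power borel_measurable_const
        mo mz mp mc)+
  have cp: "continuous_on {0<..} (radial_profile \<phi> b k)" "continuous_on {0<..} (radial_profile' \<phi> \<phi>' b k)"
    unfolding radial_profile_def[abs_def] radial_profile'_def[abs_def]
    by (intro continuous_on_mult continuous_on_diff continuous_on_divide continuous_on_powr comp
        continuous_on_const continuous_on_id; simp)+
  have line: "continuous_on UNIV (\<lambda>t. trial_partial \<phi> \<phi>' b k (X t) e (p t))"
    if X: "continuous_on UNIV X" "\<And>t. X t \<noteq> 0" and p: "continuous_on UNIV p"
    for X :: "real \<Rightarrow> real \<times> real" and e p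
  proof -
    have q: "continuous_on UNIV (\<lambda>t. (norm (X t))\<^sup>2)" using X(1) by (intro continuous_intros)
    have q_pos: "(\<lambda>t. (norm (X t))\<^sup>2) ` UNIV \<subseteq> {0<..}" using X(2) by auto
    have z: "continuous_on UNIV (\<lambda>t. conj_coordinate (X t))"
      unfolding conj_coordinate_def using X(1) by (intro continuous_intros)
    show ?thesis
      unfolding trial_partial_def
      by (intro continuous_on_mult continuous_on_add continuous_on_power continuous_on_of_real
          continuous_on_const z p continuous_on_compose2[OF cp(1) q q_pos] continuous_on_compose2[OF cp(2) q q_pos])
  qed
  have c1: "continuous_on UNIV (\<lambda>s. fst (?g (s, t)))" if "t \<noteq> 0" for t
    unfolding trial_gradient_def fst_conv using that
    by (intro line continuous_intros) (simp add: zero_prod_def)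
  have c2: "continuous_on UNIV (\<lambda>t. snd (?g (s, t)))" if "s \<noteq> 0" for s
    unfolding trial_gradient_def fst_conv snd_conv using that
    by (intro line continuous_intros) (simp add: zero_prod_def)
  show ?thesis
  proof (rule weak_gradient_if_C1_off_origin[OF m])
    show "((\<lambda>s. ?u (s, t)) has_vector_derivative fst (?g (s, t))) (at s)" if "t \<noteq> 0" for s t
      using that by (intro trial_gradient_derivative \<phi>) (simp add: zero_prod_def)
    show "((\<lambda>t. ?u (s, t)) has_vector_derivative snd (?g (s, t))) (at t)" if "s \<noteq> 0" for s t
      using that by (intro trial_gradient_derivative \<phi>) (simp add: zero_prod_def)
  qed (use bound c1 c2 in auto)
qed

lemma AE_disk_nonzero: "AE x in disk. x \<noteq> 0"
  unfolding disk_def by (subst AE_restrict_space_iff) (auto intro: AE_mp[OF AE_lborel_singleton])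

context normalized_ground_state
begin

lemma continuous_\<phi>: "continuous_on UNIV \<phi>" and continuous_\<phi>': "continuous_on UNIV \<phi>'"
  using rapid_\<phi> rapid_\<phi>' by (simp_all add: rapid_def)

text \<open>
  The disk corresponds to \<open>0 < t < sqrt b / 2\<close>. Passing to the half-line increases the energy and decreases
  the norm, because \<open>1 - 2 h t\<close> is negative for larger \<open>t\<close>.
\<close>
lemma trial_quotient_le:
  assumes b: "b > 4 * \<xi>\<^sup>2" and k: "real k = b / 2 - \<xi> * sqrt b - \<delta>"
  defines "h \<equiv> 1 / sqrt b"
  shows "lambda b \<le> ereal (b * ((LINT t|half_line. numerator_density h \<delta> t)
    / (LINT t|half_line. denominator_density h t)))"
    and "1 - 2 * h * \<xi> > 0"
proof -
  have "sqrt (4 * \<xi>\<^sup>2) < sqrt b" using b by simp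
  then have sb: "2 * \<xi> < sqrt b" using xi_pos by (simp add: real_sqrt_mult)
  have b0: "b > 0" using b zero_le_power2[of \<xi>] by linarith
  have sb0: "sqrt b > 0" using b0 by simp
  show D: "1 - 2 * h * \<xi> > 0" using sb sb0 by (simp add: h_def field_simps)
  let ?u = "trial \<phi> b k"
  let ?g = "trial_gradient \<phi> \<phi>' b k"
  let ?N = "numerator_density h \<delta>"
  let ?D = "denominator_density h"
  have wg: "weak_gradient ?u ?g"
    by (rule trial_weak_gradient[OF b0 \<phi>_derivative continuous_\<phi>'])
  have [measurable]: "\<phi> \<in> borel_measurable borel" "\<phi>' \<in> borel_measurable borel"
    by (rule borel_measurable_continuous_onI[OF continuous_\<phi>], rule borel_measurable_continuous_onI[OF continuous_\<phi>'])
  have mN: "?N \<in> borel_measurable borel" and mD: "?D \<in> borel_measurable borel"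
    unfolding numerator_density_def[abs_def] denominator_density_def[abs_def] by measurable
  have q: "(norm x)\<^sup>2 = 1 - 2 * h * (sqrt b * (1 - (norm x)\<^sup>2) / 2)" for x :: "real \<times> real"
    using sb0 by (simp add: h_def field_simps)
  have hb: "h * sqrt b = 1" using sb0 by (simp add: h_def)
  have pN: "(norm (fst (magnetic_gradient b ?u ?g x)))\<^sup>2 + (norm (snd (magnetic_gradient b ?u ?g x)))\<^sup>2
      = b * ?N (sqrt b * (1 - (norm x)\<^sup>2) / 2)" if "x \<noteq> 0" for x
  proof -
    define \<tau> where "\<tau> = sqrt b * (1 - (norm x)\<^sup>2) / 2"
    have qt: "(norm x)\<^sup>2 = 1 - 2 * h * \<tau>" unfolding \<tau>_def by (rule q)
    have e1: "\<phi> \<tau> - sqrt b * (norm x)\<^sup>2 * \<phi>' \<tau> = - sqrt b * ((1 - 2 * h * \<tau>) * \<phi>' \<tau> - h * \<phi> \<tau>)"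
      unfolding qt using hb by (simp add: algebra_simps)
    have "b * (1 - 2 * h * \<tau>) / 2 = b / 2 - sqrt b * \<tau>"
      using sb0 b0 by (simp add: h_def field_simps)
    then have e2: "real k - b * (norm x)\<^sup>2 / 2 = sqrt b * (\<tau> - \<xi> - h * \<delta>)"
      unfolding qt k using hb by (simp add: algebra_simps)
    show ?thesis
      unfolding norm_magnetic_gradient_trial[OF that] \<tau>_def[symmetric] e1 e2 numerator_density_def
      using b0 by (simp add: power_mult_distrib distrib_left mult.assoc)
  qed
  have "Re (magnetic_form b ?u ?g ?u ?g) = (LINT x|disk. b * ?N (sqrt b * (1 - (norm x)\<^sup>2) / 2))"
    unfolding Re_magnetic_form[OF wg]
  proof (rule integral_cong_AE)
    show "(\<lambda>x. (norm (fst (magnetic_gradient b ?u ?g x)))\<^sup>2 + (norm (snd (magnetic_gradient b ?u ?g x)))\<^sup>2)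
        \<in> borel_measurable disk"
      using magnetic_gradient_L2[OF wg, of b] by (auto simp: L2_def)
    show "(\<lambda>x. b * ?N (sqrt b * (1 - (norm x)\<^sup>2) / 2)) \<in> borel_measurable disk"
      by (rule borel_measurable_disk, rule borel_measurable_times, simp, rule measurable_compose[OF _ mN]) measurable
    show "AE x in disk. (norm (fst (magnetic_gradient b ?u ?g x)))\<^sup>2 + (norm (snd (magnetic_gradient b ?u ?g x)))\<^sup>2
        = b * ?N (sqrt b * (1 - (norm x)\<^sup>2) / 2)"
      using AE_disk_nonzero by eventually_elim (rule pN)
  qed
  also have "\<dots> = b * (2 * pi / sqrt b * (LBINT t. indicator {0<..sqrt b / 2} t * ?N t))"
    using integral_disk_boundary_distance[OF sb0 mN] by simp
  finally have Q: "Re (magnetic_form b ?u ?g ?u ?g)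
      = b * (2 * pi / sqrt b * (LBINT t. indicator {0<..sqrt b / 2} t * ?N t))" .
  have "(L2_norm disk ?u)\<^sup>2 = (LINT x|disk. (norm (?u x))\<^sup>2)"
    unfolding L2_norm_def by (simp add: integral_nonneg_AE)
  also have "\<dots> = (LINT x|disk. ?D (sqrt b * (1 - (norm x)\<^sup>2) / 2))"
  proof (rule integral_cong_AE)
    show "(\<lambda>x. (norm (?u x))\<^sup>2) \<in> borel_measurable disk"
      using wg by (auto simp: L2_def weak_gradient_def)
    show "(\<lambda>x. ?D (sqrt b * (1 - (norm x)\<^sup>2) / 2)) \<in> borel_measurable disk"
      by (rule borel_measurable_disk, rule measurable_compose[OF _ mD]) measurable
    show "AE x in disk. (norm (?u x))\<^sup>2 = ?D (sqrt b * (1 - (norm x)\<^sup>2) / 2)"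
      using AE_disk_nonzero
    proof eventually_elim
      fix x :: "real \<times> real" assume "x \<noteq> 0"
      then show "(norm (?u x))\<^sup>2 = ?D (sqrt b * (1 - (norm x)\<^sup>2) / 2)"
        unfolding norm_trial_square[OF \<open>x \<noteq> 0\<close>] denominator_density_def by (subst q[of x]) (rule refl)
    qed
  qed
  also have "\<dots> = 2 * pi / sqrt b * (LBINT t. indicator {0<..sqrt b / 2} t * ?D t)"
    by (rule integral_disk_boundary_distance[OF sb0 mD])
  finally have U: "(L2_norm disk ?u)\<^sup>2 = 2 * pi / sqrt b * (LBINT t. indicator {0<..sqrt b / 2} t * ?D t)" .
  define NT where "NT = (LBINT t. indicator {0<..sqrt b / 2} t * ?N t)"
  define DT where "DT = (LBINT t. indicator {0<..sqrt b / 2} t * ?D t)"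
  have N0: "?N t \<ge> 0" for t by (simp add: numerator_density_def)
  have NT: "NT \<le> (LINT t|half_line. ?N t)"
    unfolding NT_def integral_half_line set_lebesgue_integral_def
  proof (rule integral_mono')
    show "integrable lborel (\<lambda>t. indicat_real {0<..} t *\<^sub>R ?N t)"
      using integral_numerator_density(1) by (simp add: integrable_half_line_iff set_integrable_def)
  qed (auto simp: N0 split: split_indicator)
  have DT: "(LINT t|half_line. ?D t) \<le> DT"
    unfolding DT_def integral_half_line set_lebesgue_integral_def
  proof (rule integral_mono)
    show i: "integrable lborel (\<lambda>t. indicat_real {0<..} t *\<^sub>R ?D t)"
      using integral_denominator_density(1) by (simp add: integrable_half_line_iff set_integrable_def)
    show "integrable lborel (\<lambda>t. indicator {0<..sqrt b / 2} t * ?D t)"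
      using mD by (intro Bochner_Integration.integrable_bound[OF i]) (auto split: split_indicator)
    fix t :: real
    have "?D t \<le> 0" if "t > sqrt b / 2"
      unfolding denominator_density_def using that sb0
      by (intro mult_nonpos_nonneg) (auto simp: h_def field_simps)
    then show "indicat_real {0<..} t *\<^sub>R ?D t \<le> indicator {0<..sqrt b / 2} t * ?D t"
      by (auto split: split_indicator)
  qed
  have Dpos: "(LINT t|half_line. ?D t) > 0" using D by (simp add: integral_denominator_density(2))
  have pos: "L2_norm disk ?u > 0"
  proof -
    have "(L2_norm disk ?u)\<^sup>2 > 0"
      unfolding U DT_def[symmetric] using Dpos DT sb0 by (intro mult_pos_pos) auto
    then show ?thesis using L2_norm_nonneg[of disk ?u] by (simp add: zero_less_power2 less_le)
  qed
  have "lambda b \<le> ereal (Re (magnetic_form b ?u ?g ?u ?g) / (L2_norm disk ?u)\<^sup>2)"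
    by (rule lambda_le_rayleigh_quotient[OF wg pos])
  also have "Re (magnetic_form b ?u ?g ?u ?g) / (L2_norm disk ?u)\<^sup>2 = b * (NT / DT)"
    unfolding Q U NT_def[symmetric] DT_def[symmetric] using sb0 by simp
  also have "ereal \<dots> \<le> ereal (b * ((LINT t|half_line. ?N t) / (LINT t|half_line. ?D t)))"
  proof -
    have "NT / DT \<le> (LINT t|half_line. ?N t) / (LINT t|half_line. ?D t)"
      using NT DT Dpos N0 by (intro frac_le) (auto intro!: integral_nonneg_AE)
    then show ?thesis using b0 by (simp only: ereal_less_eq mult_le_cancel_left_pos)
  qed
  finally show "lambda b \<le> ereal (b * ((LINT t|half_line. ?N t) / (LINT t|half_line. ?D t)))" .
qed

text \<open>
  The angular momentum is the integer nearest to its optimal real value \<open>b / 2 - \<xi> sqrt b\<close>, which is positive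
  for \<open>b > 4 \<xi>\<^sup>2\<close>; rounding costs \<open>\<delta>\<^sup>2 \<le> 1 / 4\<close> in the constant term.
\<close>
lemma lambda_le:
  assumes b: "b > 4 * \<xi>\<^sup>2"
  shows "lambda b \<le> ereal (\<xi>\<^sup>2 * b - boundary_sq / 3 * sqrt b
    + (7 / 4 - \<xi> * boundary_sq / 2 + 5 / 2 * \<xi> ^ 4) / (1 - 2 * \<xi> / sqrt b))"
proof -
  define h where "h = 1 / sqrt b"
  have b0: "b > 0" using b zero_le_power2[of \<xi>] by linarith
  then have sb0: "sqrt b > 0" by simp
  have "sqrt (4 * \<xi>\<^sup>2) < sqrt b" using b by simp
  then have sb: "2 * \<xi> < sqrt b" using xi_pos by (simp add: real_sqrt_mult)
  define r where "r = b / 2 - \<xi> * sqrt b"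
  have "b / 2 = sqrt b * sqrt b / 2" using b0 by simp
  then have "r = sqrt b * (sqrt b / 2 - \<xi>)" by (simp add: r_def algebra_simps)
  then have r0: "r \<ge> 0" using sb sb0 by simp
  define k where "k = nat (round r)"
  have "round r \<ge> 0" using r0 round_mono[of 0 r] by simp
  then have rk: "real k = of_int (round r)" by (simp add: k_def)
  define \<delta> where "\<delta> = r - real k"
  have \<delta>: "\<bar>\<delta>\<bar> \<le> 1 / 2" using of_int_round_abs_le[of r] by (simp add: \<delta>_def rk abs_minus_commute)
  have k: "real k = b / 2 - \<xi> * sqrt b - \<delta>" by (simp add: \<delta>_def r_def)
  note q = trial_quotient_le[OF b k, folded h_def]
  have d2: "\<delta>\<^sup>2 \<le> 1 / 4" using abs_le_square_iff[of \<delta> "1 / 2"] \<delta> by (simp add: power2_eq_square)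
  have hh: "b * h\<^sup>2 = 1" "b * h = sqrt b"
    using sb0 b0 by (simp_all add: h_def power_divide real_div_sqrt)
  let ?D = "1 - 2 * h * \<xi>"
  let ?c = "\<delta>\<^sup>2 + 3 / 2 - \<xi> * boundary_sq / 2 + 5 / 2 * \<xi> ^ 4"
  have "b * ((LINT t|half_line. numerator_density h \<delta> t) / (LINT t|half_line. denominator_density h t))
      = b * (\<xi>\<^sup>2 - boundary_sq / 3 * h) + b * h\<^sup>2 * ?c / ?D"
    unfolding integral_numerator_density integral_denominator_density using q(2) by (simp add: field_simps)
  also have "\<dots> = \<xi>\<^sup>2 * b - boundary_sq / 3 * sqrt b + ?c / ?D"
    unfolding hh(1) hh(2)[symmetric] by (simp add: algebra_simps)
  also have "\<dots> \<le> \<xi>\<^sup>2 * b - boundary_sq / 3 * sqrt b + (7 / 4 - \<xi> * boundary_sq / 2 + 5 / 2 * \<xi> ^ 4) / ?D"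
    using d2 q(2) by (intro add_left_mono divide_right_mono) auto
  finally show ?thesis using q(1) by (simp add: h_def order_trans[OF q(1)])
qed

end

text \<open>
  With \<open>x = C\<^sub>1 \<xi>\<close> and \<open>Y = \<xi>\<^sup>4\<close> this compares the constant of the trial function with \<open>B\<^sub>1\<close>. The bound on \<open>x\<close> is nearly
  the weakest one possible here: at \<open>x = 1/6\<close> the gap is \<open>1/36 + 7/12 Y\<close>.
\<close>
lemma constant_gap:
  fixes x Y :: real
  assumes "x \<ge> 1 / 6" "Y > 0"
  shows "7 / 4 - 3 / 2 * x + 5 / 2 * Y < 5 / 4 + 5 / 3 * x + 37 / 12 * Y"
  using assms by linarith

text \<open>
  Here \<open>k\<close> stands for \<open>\<xi> / sqrt b\<close> and \<open>x\<close> for \<open>C\<^sub>1 \<xi>\<close>; the constant \<open>439 / 5000\<close> is slightly larger than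
  \<open>1 / sqrt 130\<close>. The difference of the two sides increases with \<open>x\<close> and decreases with \<open>k\<close>. The two
  lower bounds on \<open>x\<close> coincide at \<open>\<xi>\<^sup>2 = 1/2\<close>, where the estimate is tightest, and in terms of
  \<open>z = \<xi>\<^sup>2\<close> one of them suffices on either side.
\<close>
lemma denominator_free_constant_bound:
  fixes \<xi> x k :: real
  assumes \<xi>: "0 < \<xi>" "\<xi> < 1" and k: "0 < k" "k \<le> 439 / 5000 * \<xi>"
    and x: "1 / 6 \<le> x" "1 - \<xi>\<^sup>2 \<le> 3 * x"
  shows "7 / 4 - 3 / 2 * x + 5 / 2 * \<xi> ^ 4
    < (5 / 4 + 5 / 3 * x + 37 / 12 * \<xi> ^ 4 + 5 / 3 * k * (x + 5 * \<xi> ^ 4)) * (1 - 2 * k)"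
proof -
  define z where "z = \<xi>\<^sup>2"
  have Y: "\<xi> ^ 4 = z\<^sup>2" by (simp add: z_def)
  have z: "0 < z" "z < 1" using \<xi> power_strict_mono[of \<xi> 1 2] by (auto simp: z_def)
  have z2: "z - 1 / 4 \<le> z\<^sup>2" "z\<^sup>2 < 1" "0 \<le> z\<^sup>2"
    using zero_le_power2[of "z - 1 / 2"] power_strict_mono[of z 1 2] z
    by (auto simp: power2_eq_square algebra_simps)
  have z3: "0 \<le> z * z\<^sup>2" using z by simp
  define A where "A = 19 / 6 - 5 / 3 * k - 10 / 3 * k\<^sup>2"
  define R where "R = k * z\<^sup>2 * (13 / 6 - 50 / 3 * k)"
  have goal: "(5 / 4 + 5 / 3 * x + 37 / 12 * \<xi> ^ 4 + 5 / 3 * k * (x + 5 * \<xi> ^ 4)) * (1 - 2 * k)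
      - (7 / 4 - 3 / 2 * x + 5 / 2 * \<xi> ^ 4)
    = - 1 / 2 + x * A + 7 / 12 * z\<^sup>2 - 5 / 2 * k + R"
    unfolding Y A_def R_def by (simp add: field_simps power2_eq_square)
  \<comment> \<open>a linear bound for \<open>\<xi>\<close> in \<open>z\<close>, tangent near the critical point \<open>z = 1 / 2\<close>\<close>
  have "0 \<le> (\<xi> - 7071 / 10000)\<^sup>2" by simp
  then have xi_le: "\<xi> \<le> 7072 / 10000 * z + 3536 / 10000"
    using \<xi> z by (simp add: z_def power2_eq_square algebra_simps)
  define K where "K = 621 / 10000 * z + 311 / 10000"
  have kK: "k \<le> K" using k xi_le z by (simp add: K_def)
  have "0 < - 1 / 2 + x * A + 7 / 12 * z\<^sup>2 - 5 / 2 * k + R"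
  proof (cases "z \<le> 1 / 2")
    case True
    have "\<xi> \<le> 7072 / 10000"
      by (rule power2_le_imp_le) (use True in \<open>auto simp: z_def power2_eq_square\<close>)
    then have k1: "k \<le> 6210 / 100000" using k by linarith
    have "k\<^sup>2 \<le> (6210 / 100000)\<^sup>2" using k k1 by (intro power_mono) auto
    then have "305 / 100 \<le> A" using k1 by (simp add: A_def power2_eq_square)
    then have "x * (305 / 100) \<le> x * A" using x by (intro mult_left_mono) auto
    then have 1: "(1 - z) / 3 * (305 / 100) \<le> x * A" using x(2) by (simp add: z_def)
    have 2: "k * z\<^sup>2 * (113 / 100) \<le> R"
      unfolding R_def using k k1 by (intro mult_left_mono) auto
    have "k * (5 / 2 - 113 / 100 * z\<^sup>2) \<le> K * (5 / 2 - 113 / 100 * z\<^sup>2)"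
      using kK z2 by (intro mult_right_mono) auto
    then have 3: "5 / 2 * k - k * z\<^sup>2 * (113 / 100) \<le> 5 / 2 * K - K * z\<^sup>2 * (113 / 100)"
      by (simp add: algebra_simps)
    have 4: "K * z\<^sup>2 = 621 / 10000 * (z * z\<^sup>2) + 311 / 10000 * z\<^sup>2"
      by (simp add: K_def algebra_simps)
    show ?thesis
      using 1 2 3 4 z2 z3 z True K_def by argo
  next
    case False
    have k1: "k \<le> 878 / 10000" using k \<xi> by linarith
    have "k * k \<le> k * (878 / 10000)" using k k1 by (intro mult_left_mono) auto
    then have A1: "19 / 6 - 5 / 3 * k - 10 / 3 * (878 / 10000) * k \<le> A" by (simp add: A_def power2_eq_square)
    moreover have "0 \<le> 19 / 6 - 5 / 3 * k - 10 / 3 * (878 / 10000) * k" using k1 by simp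
    ultimately have "1 / 6 * (19 / 6 - 5 / 3 * k - 10 / 3 * (878 / 10000) * k) \<le> x * A"
      using x by (intro mult_mono) auto
    then have 1: "19 / 36 - 3267 / 10000 * k \<le> x * A" using k by (simp add: algebra_simps)
    have 2: "k * z\<^sup>2 * (7 / 10) \<le> R"
      unfolding R_def using k k1 by (intro mult_left_mono) auto
    have "k * (28267 / 10000 - 7 / 10 * z\<^sup>2) \<le> K * (28267 / 10000 - 7 / 10 * z\<^sup>2)"
      using kK z2 by (intro mult_right_mono) auto
    then have 3: "28267 / 10000 * k - k * z\<^sup>2 * (7 / 10) \<le> 28267 / 10000 * K - K * z\<^sup>2 * (7 / 10)"
      by (simp add: algebra_simps)
    have 4: "K * z\<^sup>2 = 621 / 10000 * (z * z\<^sup>2) + 311 / 10000 * z\<^sup>2"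
      by (simp add: K_def algebra_simps)
    show ?thesis
      using 1 2 3 4 z2 z3 z False K_def by linarith
  qed
  with goal show ?thesis by linarith
qed

theorem theorem1p5:
  fixes \<xi>0 C1 B1 B2 :: real and \<phi>0 :: "real \<Rightarrow> real"
  assumes "\<xi>0 > 0"
    and "\<And>\<xi>. mu \<xi>0 \<le> mu \<xi>"
    and "de_gennes_eigenfunction \<xi>0 Theta0 \<phi>0"
    and "\<And>t. t > 0 \<Longrightarrow> \<phi>0 t > 0"
    and "(LINT t|half_line. (\<phi>0 t)\<^sup>2) = 1"
    and "C1 = (\<phi>0 0)\<^sup>2 / 3"
    and "B1 = 5 / 4 + 5 / 3 * C1 * \<xi>0 + 37 / 12 * \<xi>0 ^ 4"
    and "B2 = 5 / 3 * \<xi>0\<^sup>2 * (C1 + 5 * \<xi>0 ^ 3)"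
  shows "(\<forall>b > 4 * Theta0.
            lambda b < ereal (Theta0 * b - C1 * sqrt b
              + (B1 + B2 * b powr (- 1 / 2)) / (1 - 2 * \<xi>0 * b powr (- 1 / 2)))) \<and>
         (\<forall>b \<ge> 130.
            lambda b < ereal (Theta0 * b - C1 * sqrt b + B1 + B2 * b powr (- 1 / 2)))"
proof -
  obtain c w w' where gs: "c > 0" "decaying_solution (\<xi>0\<^sup>2) w w'" "w' (- \<xi>0) = 0"
    "\<And>t. t \<ge> 0 \<Longrightarrow> \<phi>0 t = c * w (t - \<xi>0)" and Theta: "Theta0 = \<xi>0\<^sup>2" and xi1: "\<xi>0 < 1"
    using ground_state[OF assms(1,2,3,4)] by blast
  interpret normalized_ground_state \<xi>0 c w w'
  proof
    have "(LINT t|half_line. (c * w (t - \<xi>0))\<^sup>2) = (LINT t|half_line. (\<phi>0 t)\<^sup>2)"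
      by (intro Bochner_Integration.integral_cong) (auto simp: gs(4))
    then show "(LINT t|half_line. (c * w (t - \<xi>0))\<^sup>2) = 1" using assms(5) by simp
  qed (use assms(1) gs in auto)
  have trace: "boundary_sq = 3 * C1" using gs(4)[of 0] by (simp add: boundary_sq_def \<phi>_def assms(6))
  define x where "x = C1 * \<xi>0"
  have xP: "\<xi>0 * boundary_sq = 3 * x" by (simp add: trace x_def)
  have x: "1 / 6 \<le> x" "1 - \<xi>0\<^sup>2 \<le> 3 * x"
    using half_le_xi_boundary_sq one_minus_xi_square_le unfolding xP by simp_all
  have C1: "C1 > 0" using boundary_sq_pos trace by simp
  have B1: "B1 = 5 / 4 + 5 / 3 * x + 37 / 12 * \<xi>0 ^ 4" by (simp add: assms(7) x_def)
  have B2: "B2 * r = 5 / 3 * (\<xi>0 * r) * (x + 5 * \<xi>0 ^ 4)" for r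
    by (simp add: assms(8) x_def algebra_simps power_numeral_reduce)
  have B2_pos: "B2 > 0" using assms(1) C1 by (simp add: assms(8) add_pos_pos)
  define c0 where "c0 = 7 / 4 - 3 / 2 * x + 5 / 2 * \<xi>0 ^ 4"
  have up: "lambda b \<le> ereal (\<xi>0\<^sup>2 * b - C1 * sqrt b + c0 / (1 - 2 * \<xi>0 / sqrt b))"
    if "b > 4 * \<xi>0\<^sup>2" for b
    using lambda_le[OF that] unfolding xP by (simp add: trace c0_def)
  have root: "b powr (- 1 / 2) = 1 / sqrt b" "1 - 2 * \<xi>0 / sqrt b > 0" if "b > 4 * \<xi>0\<^sup>2" for b
  proof -
    have b0: "b > 0" using that zero_le_power2[of \<xi>0] by linarith
    then show "b powr (- 1 / 2) = 1 / sqrt b"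
      by (simp add: powr_minus_divide powr_half_sqrt)
    have "sqrt (4 * \<xi>0\<^sup>2) < sqrt b" using that by simp
    then show "1 - 2 * \<xi>0 / sqrt b > 0" using assms(1) b0 by (simp add: real_sqrt_mult)
  qed
  show ?thesis
  proof (intro conjI allI impI)
    fix b assume "b > 4 * Theta0"
    then have b: "b > 4 * \<xi>0\<^sup>2" by (simp add: Theta)
    then have b0: "b > 0" using zero_le_power2[of \<xi>0] by linarith
    have "c0 < B1" unfolding c0_def B1 using x(1) assms(1) by (intro constant_gap) auto
    also have "B1 < B1 + B2 * (1 / sqrt b)" using B2_pos b0 by simp
    finally have "c0 / (1 - 2 * \<xi>0 / sqrt b) < (B1 + B2 * (1 / sqrt b)) / (1 - 2 * \<xi>0 / sqrt b)"
      using root(2)[OF b] by (rule divide_strict_right_mono)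
    then show "lambda b < ereal (Theta0 * b - C1 * sqrt b
        + (B1 + B2 * b powr (- 1 / 2)) / (1 - 2 * \<xi>0 * b powr (- 1 / 2)))"
      using up[OF b] unfolding root(1)[OF b] Theta by (elim le_less_trans) simp
  next
    fix b :: real assume b130: "b \<ge> 130"
    have "\<xi>0\<^sup>2 < 1" using xi1 assms(1) power_strict_mono[of \<xi>0 1 2] by simp
    then have b: "b > 4 * \<xi>0\<^sup>2" using b130 by linarith
    have "5000 / 439 \<le> sqrt b"
      by (rule real_le_rsqrt) (use b130 in \<open>simp add: power2_eq_square\<close>)
    then have "\<xi>0 / sqrt b \<le> \<xi>0 / (5000 / 439)"
      using assms(1) b130 by (intro divide_left_mono) auto
    then have "c0 < (B1 + B2 * (1 / sqrt b)) * (1 - 2 * (\<xi>0 * (1 / sqrt b)))"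
      unfolding c0_def B1 B2 using assms(1) xi1 b130 x
      by (intro denominator_free_constant_bound) auto
    then have "c0 / (1 - 2 * \<xi>0 / sqrt b) < B1 + B2 * (1 / sqrt b)"
      using root(2)[OF b] by (simp add: pos_divide_less_eq)
    then show "lambda b < ereal (Theta0 * b - C1 * sqrt b + B1 + B2 * b powr (- 1 / 2))"
      using up[OF b] unfolding root(1)[OF b] Theta by (elim le_less_trans) simp
  qed
qed

end
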